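(* There is a randomized algorithm which, given $0<\varepsilon<1$ and an instance $(P,k,r,d)$ of Hybrid $(k,2)$-Clustering with $P\subset\mathbb{R}^d$, $|P|=n$, runs in time $2^{(kd/\varepsilon)^{\mathcal{O}(1)}}\cdot n^{\mathcal{O}(1)}$ and, with probability at least some positive absolute constant, returns a set $F\subset\mathbb{R}^d$ with $|F|\le k$ such that $\mathsf{cost}^{(2)}_{(1+\varepsilon)r}(P,F)\le(1+\varepsilon)\cdot\mathsf{OPT}^{(2)}_r$.
   Context: Distances are Euclidean: $d(x,y)=\|x-y\|_2$, and $d(p,Q)=\min_{q\in Q}d(p,q)$ for finite nonempty $Q\subset\mathbb{R}^d$. For $s\ge0$, $d_s(x,Q)=\max\{d(x,Q)-s,0\}$ and $\mathsf{cost}^{(2)}_s(P,F)=\sum_{p\in P}d_s(p,F)^2$. Hybrid $(k,2)$-Clustering: given finite $P\subset\mathbb{R}^d$, integer $k\ge1$, real $r\ge0$, find $F\subset\mathbb{R}^d$ with $|F|\le k$ minimizing $\mathsf{cost}^{(2)}_r(P,F)$; $\mathsf{OPT}^{(2)}_r$ denotes this minimum value. (This generalizes both $k$-center and $k$-means.) *)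

theory Defs
  imports "HOL-Probability.Probability_Mass_Function" "HOL-Analysis.L2_Norm"
begin

section \<open>Hybrid clustering\<close>

text \<open>The dimension is part of the input of the algorithm, so points are coordinate lists.\<close>

definition Rn :: "nat \<Rightarrow> real list set" where
  "Rn d = {x. length x = d}"

definition pdist :: "real list \<Rightarrow> real list \<Rightarrow> real" where
  "pdist x y = L2_set (\<lambda>i. x ! i - y ! i) {..<length x}"

definition sdist :: "real list \<Rightarrow> real list set \<Rightarrow> real" where
  "sdist x Q = Min (pdist x ` Q)"

definition sdist_shift :: "real \<Rightarrow> real list \<Rightarrow> real list set \<Rightarrow> real" where
  "sdist_shift s x Q = max (sdist x Q - s) 0"

definition cost2 :: "real \<Rightarrow> real list set \<Rightarrow> real list set \<Rightarrow> real" where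
  "cost2 s P F = (\<Sum>p\<in>P. (sdist_shift s p F)\<^sup>2)"

text \<open>Since \<^const>\<open>sdist\<close> is meaningful only for finite nonempty sets, so are the solutions.\<close>

definition solutions :: "nat \<Rightarrow> nat \<Rightarrow> real list set set" where
  "solutions d k = {F. F \<subseteq> Rn d \<and> finite F \<and> F \<noteq> {} \<and> card F \<le> k}"

definition OPT2 :: "nat \<Rightarrow> nat \<Rightarrow> real \<Rightarrow> real list set \<Rightarrow> real" where
  "OPT2 d k r P = (INF F\<in>solutions d k. cost2 r P F)"

section \<open>A randomized real RAM\<close>

text \<open>
  The machine has one memory of natural numbers and one of real numbers, both with indirect
  addressing.  Three restrictions keep unit-cost arithmetic honest: the only constants
  are natural numbers (no real constant can smuggle in advice), natural numbers are
  not multiplied in unit time, and reals influence natural numbers only through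
  comparisons (no rounding).
\<close>

type_synonym state = "(nat \<Rightarrow> nat) \<times> (nat \<Rightarrow> real)"

datatype nexp =
    NConst nat
  | NMem nexp
  | NAdd nexp nexp
  | NSub nexp nexp

datatype rexp =
    ROfNat nexp
  | RMem nexp
  | RAdd rexp rexp
  | RSub rexp rexp
  | RMul rexp rexp
  | RDiv rexp rexp
  | RSqrt rexp

datatype bexp =
    NLess nexp nexp
  | RLess rexp rexp
  | BNot bexp
  | BAnd bexp bexp

datatype com =
    NAssign nexp nexp
  | RAssign nexp rexp
  | Random nexp nexp
  | Seq com com
  | Ite bexp com com
  | While bexp com

fun neval :: "nexp \<Rightarrow> state \<Rightarrow> nat" where
  "neval (NConst c) s = c"
| "neval (NMem e) s = fst s (neval e s)"
| "neval (NAdd e f) s = neval e s + neval f s"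
| "neval (NSub e f) s = neval e s - neval f s"

fun reval :: "rexp \<Rightarrow> state \<Rightarrow> real" where
  "reval (ROfNat e) s = real (neval e s)"
| "reval (RMem e) s = snd s (neval e s)"
| "reval (RAdd e f) s = reval e s + reval f s"
| "reval (RSub e f) s = reval e s - reval f s"
| "reval (RMul e f) s = reval e s * reval f s"
| "reval (RDiv e f) s = reval e s / reval f s"
| "reval (RSqrt e) s = sqrt (reval e s)"

fun beval :: "bexp \<Rightarrow> state \<Rightarrow> bool" where
  "beval (NLess e f) s \<longleftrightarrow> neval e s < neval f s"
| "beval (RLess e f) s \<longleftrightarrow> reval e s < reval f s"
| "beval (BNot b) s \<longleftrightarrow> \<not> beval b s"
| "beval (BAnd b c) s \<longleftrightarrow> beval b s \<and> beval c s"

text \<open>Evaluating an expression costs one time unit per constant, memory access and operation.\<close>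

fun ncost :: "nexp \<Rightarrow> nat" where
  "ncost (NConst c) = 1"
| "ncost (NMem e) = 1 + ncost e"
| "ncost (NAdd e f) = 1 + ncost e + ncost f"
| "ncost (NSub e f) = 1 + ncost e + ncost f"

fun rcost :: "rexp \<Rightarrow> nat" where
  "rcost (ROfNat e) = 1 + ncost e"
| "rcost (RMem e) = 1 + ncost e"
| "rcost (RAdd e f) = 1 + rcost e + rcost f"
| "rcost (RSub e f) = 1 + rcost e + rcost f"
| "rcost (RMul e f) = 1 + rcost e + rcost f"
| "rcost (RDiv e f) = 1 + rcost e + rcost f"
| "rcost (RSqrt e) = 1 + rcost e"

fun bcost :: "bexp \<Rightarrow> nat" where
  "bcost (NLess e f) = 1 + ncost e + ncost f"
| "bcost (RLess e f) = 1 + rcost e + rcost f"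
| "bcost (BNot b) = 1 + bcost b"
| "bcost (BAnd b c) = 1 + bcost b + bcost c"

definition add_time :: "nat \<Rightarrow> (state \<times> nat) pmf \<Rightarrow> (state \<times> nat) pmf" where
  "add_time t D = map_pmf (\<lambda>(s, u). (s, t + u)) D"

text \<open>
  \<open>exec c s D\<close>: started in \<open>s\<close>, the command \<open>c\<close> terminates on every outcome of its random
  choices, and \<open>D\<close> is the joint distribution of the final state and the running time.
  The command \<^term>\<open>Random a e\<close> stores at address \<open>a\<close> a uniformly random element
  of \<open>{0, \<dots>, e}\<close>, independent of all earlier choices.
\<close>

inductive exec :: "com \<Rightarrow> state \<Rightarrow> (state \<times> nat) pmf \<Rightarrow> bool" where
  NAssign:
    "exec (NAssign a e) s
       (return_pmf (((fst s)(neval a s := neval e s), snd s), 1 + ncost a + ncost e))"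
| RAssign:
    "exec (RAssign a e) s
       (return_pmf ((fst s, (snd s)(neval a s := reval e s)), 1 + ncost a + rcost e))"
| Random:
    "exec (Random a e) s
       (map_pmf (\<lambda>v. (((fst s)(neval a s := v), snd s), 1 + ncost a + ncost e))
          (pmf_of_set {..neval e s}))"
| Seq:
    "exec c1 s D \<Longrightarrow> (\<And>s' t. (s', t) \<in> set_pmf D \<Longrightarrow> exec c2 s' (E s')) \<Longrightarrow>
     exec (Seq c1 c2) s (bind_pmf D (\<lambda>(s', t). add_time t (E s')))"
| IteTrue:
    "beval b s \<Longrightarrow> exec c1 s D \<Longrightarrow> exec (Ite b c1 c2) s (add_time (1 + bcost b) D)"
| IteFalse:
    "\<not> beval b s \<Longrightarrow> exec c2 s D \<Longrightarrow> exec (Ite b c1 c2) s (add_time (1 + bcost b) D)"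
| WhileFalse:
    "\<not> beval b s \<Longrightarrow> exec (While b c) s (return_pmf (s, 1 + bcost b))"
| WhileTrue:
    "beval b s \<Longrightarrow> exec (Seq c (While b c)) s D \<Longrightarrow>
     exec (While b c) s (add_time (1 + bcost b) D)"

inductive_cases exec_NAssignE: "exec (NAssign a e) s D"
inductive_cases exec_RAssignE: "exec (RAssign a e) s D"
inductive_cases exec_RandomE: "exec (Random a e) s D"
inductive_cases exec_SeqE: "exec (Seq c1 c2) s D"
inductive_cases exec_IteE: "exec (Ite b c1 c2) s D"
inductive_cases exec_WhileE: "exec (While b c) s D"

lemma exec_deterministic: "exec c s D \<Longrightarrow> exec c s D' \<Longrightarrow> D' = D"
proof (induction arbitrary: D' rule: exec.induct)
  case (NAssign a e s)
  then show ?case by (auto elim: exec_NAssignE)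
next
  case (RAssign a e s)
  then show ?case by (auto elim: exec_RAssignE)
next
  case (Random a e s)
  then show ?case by (auto elim: exec_RandomE)
next
  case (Seq c1 s D c2 E)
  from Seq.prems show ?case
  proof (rule exec_SeqE)
    fix D1 E1
    assume D': "D' = bind_pmf D1 (\<lambda>(s', t). add_time t (E1 s'))" and "exec c1 s D1"
      and E1: "\<And>s' t. (s', t) \<in> set_pmf D1 \<Longrightarrow> exec c2 s' (E1 s')"
    have D1: "D1 = D" by (rule Seq.IH(1)) fact
    have "E1 (fst x) = E (fst x)" if "x \<in> set_pmf D" for x
    proof -
      from that have x: "(fst x, snd x) \<in> set_pmf D" by simp
      show ?thesis by (rule Seq.IH(2)[OF x]) (rule E1, unfold D1, rule x)
    qed
    then show ?case unfolding D' D1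
      by (intro bind_pmf_cong refl) (simp only: split_beta)
  qed
next
  case (IteTrue b s c1 D c2)
  from IteTrue.prems IteTrue.hyps(1) obtain D1 where
    "D' = add_time (1 + bcost b) D1" "exec c1 s D1"
    by (auto elim: exec_IteE)
  then show ?case using IteTrue.IH by blast
next
  case (IteFalse b s c2 D c1)
  from IteFalse.prems IteFalse.hyps(1) obtain D1 where
    "D' = add_time (1 + bcost b) D1" "exec c2 s D1"
    by (auto elim: exec_IteE)
  then show ?case using IteFalse.IH by blast
next
  case (WhileFalse b s c)
  then show ?case by (auto elim!: exec_WhileE)
next
  case (WhileTrue b s c D)
  from WhileTrue.prems WhileTrue.hyps(1) obtain D1 where
    "D' = add_time (1 + bcost b) D1" "exec (Seq c (While b c)) s D1"
    by (auto elim: exec_WhileE)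
  then show ?case using WhileTrue.IH by blast
qed

text \<open>
  Input: \<open>n, k, d\<close> in the natural cells 0, 1, 2; \<open>\<epsilon>, r\<close> in the real cells 0, 1, followed by
  the coordinates of the \<open>n\<close> points in the order given by the list; all other cells are 0.
\<close>

definition input_state :: "real \<Rightarrow> real list list \<Rightarrow> nat \<Rightarrow> real \<Rightarrow> nat \<Rightarrow> state" where
  "input_state \<epsilon> ps k r d =
     ((\<lambda>_. 0)(0 := length ps, 1 := k, 2 := d),
      (\<lambda>i. let xs = \<epsilon> # r # concat ps in if i < length xs then xs ! i else 0))"

text \<open>
  Output: the number of centers in the natural cell 0, their coordinates in the real cells
  starting at 0.
\<close>

definition output_set :: "nat \<Rightarrow> state \<Rightarrow> real list set" where
  "output_set d s = (\<lambda>i. map (\<lambda>j. snd s (i * d + j)) [0..<d]) ` {..<fst s 0}"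

end

theory Submission
  imports Defs
begin

text \<open>
  The algorithm is deterministic.  It first chooses a list of \<open>W = O(k d log n / \<epsilon>)\<close> input points:
  \<open>k + 1\<close> points by farthest-first traversal, and then greedily points that minimise the
  cost with radius \<open>2 r\<close>.  Let \<open>F\<close> be any solution and \<open>V\<close> its cost.  Two of the \<open>k + 1\<close> first points
  share a center of \<open>F\<close>, so the covering radius \<open>M\<close> of the first \<open>k\<close> points is at most \<open>2 (r + sqrt V)\<close>; moreover one
  may assume \<open>V \<le> n M^2\<close>, for otherwise the first \<open>k\<close> points themselves are better than \<open>F\<close>.
  Each greedy step shrinks the gap between the current cost and \<open>4 V\<close> by the factor \<open>1 - 1/k\<close>, so
  the chosen points finally have cost at most \<open>5 V\<close> with radius \<open>2 r\<close>.

  Hence moving each center \<open>c\<close> of \<open>F\<close> by \<open>O(\<epsilon>)\<close> times \<open>S\<close> plus the distance of \<open>c\<close> to the chosen points,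
  where \<open>S = r + M/n\<close>, is harmless.  Such a center is found among the grid points of a cube around
  a chosen point whose side is \<open>S\<close> times one of \<open>O(log n)\<close> powers of two, and is described by \<open>d + 2\<close>
  digits in base \<open>W\<close>.  All \<open>W^(k (d + 2))\<close> tuples are tried; this is
  \<open>2^((k d / \<epsilon>)^O(1)) n^O(1)\<close> because \<open>x^m \<le> m^m exp x\<close> turns \<open>(log n)^m\<close> into \<open>m^m n^O(1)\<close>.
\<close>

section \<open>Distances and costs\<close>

text \<open>The scale \<open>S = r + M/n\<close> meets two opposite demands. It is small enough to
  be paid for: the bound on \<open>M\<close> gives \<open>S \<le> 3 * r + z\<close> with
  \<open>z = 2 * sqrt V / n\<close>, and \<open>n\<close> copies of \<open>z^2\<close> total at most
  \<open>4 * V\<close>. It is large enough for \<open>O(log n)\<close> scales: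
  \<open>V \<le> n * M^2\<close> bounds every relevant distance by \<open>4 * n^2 * S\<close>. With
  \<open>S = r\<close> the second demand would fail for \<open>r = 0\<close>. The center of a point
  \<open>p\<close> is within \<open>3 * r + x + y\<close> of the chosen points, where
  \<open>x\<close> and \<open>y\<close> are the excesses of \<open>p\<close> over \<open>r\<close>
  with respect to \<open>F\<close> and over \<open>2 * r\<close> with respect to the chosen points.
  Moving it by \<open>e\<close> times \<open>S\<close> plus twice that distance therefore costs at
  most \<open>e * (9 * r + 2 * x + 2 * y + z)\<close>. The multiple of \<open>r\<close> goes into
  the radius \<open>(1 + \<epsilon>) * r\<close>; the rest is absorbed by squaring and summing, as
  the squares of \<open>x\<close>, \<open>y\<close>, \<open>z\<close> sum to \<open>O(V)\<close>.
  Radius \<open>2 * r\<close> and the factor 4 come from choosing input points only: the point of a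
  cluster nearest to its center is at most twice as far from the other points as the center
  is.\<close>

lemma pdist_nonneg: "0 \<le> pdist x y"
  by (simp add: pdist_def)

lemma pdist_commute: "length x = length y \<Longrightarrow> pdist x y = pdist y x"
  unfolding pdist_def L2_set_def by (simp add: power2_commute)

lemma pdist_triangle:
  assumes "length x = length y" "length y = length z"
  shows "pdist x z \<le> pdist x y + pdist y z"
  using L2_set_triangle_ineq[of "\<lambda>i. x ! i - y ! i" "\<lambda>i. y ! i - z ! i" "{..<length x}"] assms
  by (simp add: pdist_def)

lemma sdist_le: "finite Q \<Longrightarrow> q \<in> Q \<Longrightarrow> sdist p Q \<le> pdist p q"
  unfolding sdist_def by simp

lemma sdist_attained:
  assumes "finite Q" "Q \<noteq> {}"
  obtains q where "q \<in> Q" "sdist p Q = pdist p q"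
proof -
  have "sdist p Q \<in> pdist p ` Q"
    unfolding sdist_def by (rule Min_in) (use assms in auto)
  then show ?thesis using that by auto
qed

lemma sdist_nonneg: "finite Q \<Longrightarrow> Q \<noteq> {} \<Longrightarrow> 0 \<le> sdist p Q"
  by (metis sdist_attained pdist_nonneg)

lemma sdist_insert:
  "finite Q \<Longrightarrow> Q \<noteq> {} \<Longrightarrow> sdist p (insert q Q) = min (pdist p q) (sdist p Q)"
  unfolding sdist_def by simp

lemma sdist_singleton [simp]: "sdist p {q} = pdist p q"
  unfolding sdist_def by simp

lemma sdist_antimono:
  "finite Q \<Longrightarrow> S \<subseteq> Q \<Longrightarrow> S \<noteq> {} \<Longrightarrow> sdist p Q \<le> sdist p S"
  unfolding sdist_def by (intro Min_antimono) auto

definition excess :: "real \<Rightarrow> real \<Rightarrow> real" where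
  "excess u x = (max (x - u) 0)\<^sup>2"

lemma cost2_excess: "cost2 u P F = (\<Sum>p\<in>P. excess u (sdist p F))"
  by (simp add: cost2_def sdist_shift_def excess_def)

lemma excess_nonneg [simp]: "0 \<le> excess u x"
  by (simp add: excess_def)

lemma excess_mono: "x \<le> y \<Longrightarrow> excess u x \<le> excess u y"
  unfolding excess_def by (intro power_mono) auto

lemma cost2_nonneg: "0 \<le> cost2 u P F"
  by (simp add: cost2_excess sum_nonneg)

text \<open>The squared excess of \<open>p\<close> is one summand of the cost. This turns a bound on
  the total cost into bounds on single distances.\<close>

lemma sdist_le_cost2:
  assumes "finite P" "p \<in> P"
  shows "sdist p F \<le> u + sqrt (cost2 u P F)"
proof -
  have "excess u (sdist p F) \<le> cost2 u P F"
    unfolding cost2_excess by (rule member_le_sum) (use assms in auto)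
  then have "max (sdist p F - u) 0 \<le> sqrt (cost2 u P F)"
    unfolding excess_def by (rule real_le_rsqrt)
  then show ?thesis by simp
qed

section \<open>Grids, scales and the stability of squared excesses\<close>

lemma grid_point_exists:
  fixes u S :: real and W :: nat
  assumes "\<bar>u\<bar> \<le> S" "1 \<le> W"
  shows "\<exists>i<W. \<bar>u - S * (2 * real i / real W - 1)\<bar> \<le> 2 * S / real W"
proof (cases "S = 0")
  case True
  then show ?thesis using assms by (intro exI[of _ 0]) auto
next
  case False
  then have S: "S > 0" using assms by linarith
  define y where "y = (u + S) * real W / (2 * S)"
  have y: "0 \<le> y" "y \<le> real W"
    using assms S mult_right_mono[of "- S" u "real W"] mult_right_mono[of u S "real W"]
    unfolding y_def by (auto simp: field_simps abs_le_iff)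
  obtain i where i: "i < W" "\<bar>y - real i\<bar> \<le> 1"
  proof (cases "y < real W")
    case True
    have "nat \<lfloor>y\<rfloor> < W" using True y by linarith
    moreover have "\<bar>y - real (nat \<lfloor>y\<rfloor>)\<bar> \<le> 1" using y by linarith
    ultimately show ?thesis by (rule that)
  next
    case False
    \<comment> \<open>Here \<open>y = W\<close>: the right end \<open>S\<close> of the interval is
      not a grid point, but the last grid point is exactly one spacing away.\<close>
    show ?thesis by (rule that[of "W - 1"]) (use False y assms in auto)
  qed
  have "u - S * (2 * real i / real W - 1) = 2 * S / real W * (y - real i)"
    using S assms unfolding y_def by (simp add: field_simps)
  then have "\<bar>u - S * (2 * real i / real W - 1)\<bar> = 2 * S / real W * \<bar>y - real i\<bar>"
    using S by (simp add: abs_mult)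
  also have "\<dots> \<le> 2 * S / real W * 1"
    using S i by (intro mult_left_mono) auto
  finally show ?thesis using i by auto
qed

text \<open>Take the least \<open>j\<close> that is large enough. If \<open>j > 0\<close>, its
  predecessor fails and \<open>S * 2 ^ j\<close> is below \<open>2 * \<delta>\<close>; if
  \<open>j = 0\<close>, the scale is \<open>S\<close>. The bound \<open>S + 2 * \<delta>\<close>
  covers both cases.\<close>

lemma scale_exists:
  fixes S \<delta> :: real
  assumes "0 \<le> \<delta>" "\<delta> \<le> S * 2 ^ J"
  shows "\<exists>j\<le>J. \<delta> \<le> S * 2 ^ j \<and> S * 2 ^ j \<le> S + 2 * \<delta>"
proof -
  define j where "j = (LEAST j. \<delta> \<le> S * 2 ^ j)"
  have 1: "\<delta> \<le> S * 2 ^ j" unfolding j_def using assms(2) by (rule LeastI)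
  have 2: "j \<le> J" unfolding j_def using assms(2) by (rule Least_le)
  have "S * 2 ^ j \<le> S + 2 * \<delta>"
  proof (cases j)
    case 0
    then show ?thesis using assms by simp
  next
    case (Suc i)
    then have "\<not> \<delta> \<le> S * 2 ^ i" unfolding j_def by (metis lessI not_less_Least)
    moreover have "0 \<le> S * 2 ^ J" using assms by linarith
    then have "0 \<le> S" by (smt (verit) mult_neg_pos zero_less_power)
    ultimately show ?thesis using Suc by simp
  qed
  with 1 2 show ?thesis by blast
qed

text \<open>The square of the three-term sum is bounded by Cauchy-Schwarz;
  \<open>2 * x * w \<le> x^2 + w^2\<close> and \<open>e * e \<le> e\<close> then keep every error
  term linear in \<open>e\<close>.\<close>

lemma excess_perturb:
  fixes x y z e :: real
  assumes "0 \<le> x" "0 \<le> y" "0 \<le> z" "0 \<le> e" "e \<le> 1"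
  shows "(x + e * (2 * x + 2 * y + z))\<^sup>2 \<le> (1 + 25 * e) * x\<^sup>2 + 24 * e * y\<^sup>2 + 6 * e * z\<^sup>2"
proof -
  define w where "w = 2 * x + 2 * y + z"
  have w: "w\<^sup>2 \<le> 3 * (4 * x\<^sup>2 + 4 * y\<^sup>2 + z\<^sup>2)"
  proof -
    have "3 * (4 * x\<^sup>2 + 4 * y\<^sup>2 + z\<^sup>2) - w\<^sup>2
        = (2 * x - 2 * y)\<^sup>2 + (2 * x - z)\<^sup>2 + (2 * y - z)\<^sup>2"
      unfolding w_def by (simp add: power2_eq_square algebra_simps)
    moreover have "\<dots> \<ge> 0" by simp
    ultimately show ?thesis by linarith
  qed
  have "(x + e * w)\<^sup>2 = x\<^sup>2 + e * (2 * x * w) + e * e * w\<^sup>2"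
    by (simp add: power2_eq_square algebra_simps)
  also have "2 * x * w \<le> x\<^sup>2 + w\<^sup>2"
    using sum_squares_bound[of x w] by simp
  then have "e * (2 * x * w) \<le> e * (x\<^sup>2 + w\<^sup>2)"
    using assms by (intro mult_left_mono) auto
  also have "e * e * w\<^sup>2 \<le> e * w\<^sup>2"
    using assms by (intro mult_right_mono) (auto simp: mult_left_le)
  finally have "(x + e * w)\<^sup>2 \<le> (1 + e) * x\<^sup>2 + 2 * e * w\<^sup>2"
    by (simp add: algebra_simps)
  also have "2 * e * w\<^sup>2 \<le> 2 * e * (3 * (4 * x\<^sup>2 + 4 * y\<^sup>2 + z\<^sup>2))"
    using assms w by (intro mult_left_mono) auto
  finally show ?thesis unfolding w_def by (simp add: algebra_simps)
qed

text \<open>Block \<open>c\<close> of \<open>d + 2\<close> digits encodes one center: the index of a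
  chosen point, the exponent of the scale, and \<open>d\<close> grid coordinates relative to that
  point. All digits share the range below \<open>W\<close>, so that a whole solution is a numeral in
  base \<open>W\<close>.\<close>

definition grid_center :: "(nat \<Rightarrow> real list) \<Rightarrow> real \<Rightarrow> nat \<Rightarrow> nat \<Rightarrow> (nat \<Rightarrow> nat) \<Rightarrow> nat \<Rightarrow> real list" where
  "grid_center b S W d g c = map (\<lambda>l. b (g (c * (d + 2))) ! l + S * 2 ^ g (c * (d + 2) + 1) *
     (2 * real (g (c * (d + 2) + 2 + l)) / real W - 1)) [0..<d]"

text \<open>The digits \<open>h\<close> are chosen before the block number \<open>c\<close> and the
  function \<open>g\<close>, so blocks found for different centers can be assembled into one digit
  function. The factor \<open>d\<close> arises from bounding the Euclidean norm by the sum of the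
  coordinates.\<close>

lemma pdist_grid_center:
  assumes x: "length x = d" "length (b i) = d" and i: "i < W" and J: "J < W"
    and S: "pdist x (b i) \<le> S * 2 ^ J"
  shows "\<exists>h. (\<forall>e. h e < W) \<and>
    (\<forall>g c. (\<forall>e<d + 2. g (c * (d + 2) + e) = h e) \<longrightarrow>
       pdist x (grid_center b S W d g c) \<le> 2 * real d / real W * (S + 2 * pdist x (b i)))"
proof -
  obtain j where j: "j \<le> J" "pdist x (b i) \<le> S * 2 ^ j" "S * 2 ^ j \<le> S + 2 * pdist x (b i)"
    using scale_exists[OF pdist_nonneg S] by auto
  let ?S = "S * 2 ^ j"
  have "\<forall>l\<in>{..<d}. \<exists>m<W. \<bar>(x ! l - b i ! l) - ?S * (2 * real m / real W - 1)\<bar> \<le> 2 * ?S / real W"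
  proof
    fix l assume "l \<in> {..<d}"
    then have "\<bar>x ! l - b i ! l\<bar> \<le> pdist x (b i)"
      unfolding pdist_def L2_set_def x
      by (intro real_le_rsqrt) (simp, rule member_le_sum[where f = "\<lambda>l. (x ! l - b i ! l)\<^sup>2"], auto)
    with j i show "\<exists>m<W. \<bar>(x ! l - b i ! l) - ?S * (2 * real m / real W - 1)\<bar> \<le> 2 * ?S / real W"
      by (intro grid_point_exists) auto
  qed
  then obtain m where m: "\<And>l. l < d \<Longrightarrow> m l < W"
    "\<And>l. l < d \<Longrightarrow> \<bar>(x ! l - b i ! l) - ?S * (2 * real (m l) / real W - 1)\<bar> \<le> 2 * ?S / real W"
    by (metis lessThan_iff)
  define h where "h e = (if e = 0 then i else if e = 1 then j else if e < d + 2 then m (e - 2) else 0)" for e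
  have "\<forall>e. h e < W" using i j J m(1) by (auto simp: h_def)
  moreover have "pdist x (grid_center b S W d g c) \<le> 2 * real d / real W * (S + 2 * pdist x (b i))"
    if g: "\<forall>e<d + 2. g (c * (d + 2) + e) = h e" for g c
  proof -
    have g0: "g (c * (d + 2)) = i" using g[rule_format, of 0] by (simp add: h_def)
    have g1: "g (c * (d + 2) + 1) = j" using g[rule_format, of 1] by (simp add: h_def)
    have g2: "g (c * (d + 2) + 2 + l) = m l" if "l < d" for l
      using g[rule_format, of "2 + l"] that by (simp add: h_def add.assoc)
    have "pdist x (grid_center b S W d g c) \<le> (\<Sum>l<d. \<bar>x ! l - grid_center b S W d g c ! l\<bar>)"
      unfolding pdist_def x by (rule L2_set_le_sum_abs)
    also have "\<dots> = (\<Sum>l<d. \<bar>(x ! l - b i ! l) - ?S * (2 * real (m l) / real W - 1)\<bar>)"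
    proof (rule sum.cong[OF refl])
      fix l assume "l \<in> {..<d}"
      then show "\<bar>x ! l - grid_center b S W d g c ! l\<bar>
          = \<bar>(x ! l - b i ! l) - ?S * (2 * real (m l) / real W - 1)\<bar>"
        unfolding grid_center_def g0 g1 by (simp add: g2 del: add_2_eq_Suc' mult_Suc_right)
    qed
    also have "\<dots> \<le> (\<Sum>l<d. 2 * ?S / real W)"
      using m(2) by (intro sum_mono) auto
    also have "\<dots> = 2 * real d / real W * ?S" by simp
    also have "\<dots> \<le> 2 * real d / real W * (S + 2 * pdist x (b i))"
      using j(3) by (intro mult_left_mono) auto
    finally show ?thesis .
  qed
  ultimately show ?thesis by blast
qed

section \<open>Approximating a solution by grid points\<close>

locale hybrid_instance =
  fixes P :: "real list set" and d k :: nat and r :: real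
  assumes fin: "finite P" and ne: "P \<noteq> {}" and sub: "P \<subseteq> Rn d"
    and k: "1 \<le> k" and r: "0 \<le> r"
begin

lemma len: "p \<in> P \<Longrightarrow> length p = d"
  using sub by (auto simp: Rn_def)

lemma closest_center:
  assumes "F \<in> solutions d k"
  obtains c where "\<And>p. c p \<in> F" "\<And>p. sdist p F = pdist p (c p)" "\<And>p. length (c p) = d"
proof -
  have F: "finite F" "F \<noteq> {}" "F \<subseteq> Rn d" using assms by (auto simp: solutions_def)
  have "\<forall>p. \<exists>q. q \<in> F \<and> sdist p F = pdist p q"
    using sdist_attained[OF F(1,2)] by metis
  then obtain c where "\<forall>p. c p \<in> F \<and> sdist p F = pdist p (c p)" by metis
  with F show ?thesis by (intro that[of c]) (auto simp: Rn_def)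
qed

text \<open>Pigeonhole: two of the \<open>k + 1\<close> points have the same nearest center, and
  each of them is within \<open>r + sqrt (cost2 r P F)\<close> of it.\<close>

lemma separated_radius_le:
  assumes F: "F \<in> solutions d k"
    and b: "\<And>i. i \<le> k \<Longrightarrow> b i \<in> P"
    and sep: "\<And>i j. i < j \<Longrightarrow> j \<le> k \<Longrightarrow> M \<le> pdist (b j) (b i)"
  shows "M \<le> 2 * (r + sqrt (cost2 r P F))"
proof -
  obtain c where c: "\<And>p. c p \<in> F" "\<And>p. sdist p F = pdist p (c p)" "\<And>p. length (c p) = d"
    using closest_center[OF F] by metis
  have "card ((\<lambda>i. c (b i)) ` {..k}) \<le> card F"
    using F c(1) by (intro card_mono) (auto simp: solutions_def)
  also have "\<dots> < card {..k}" using F by (auto simp: solutions_def)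
  finally have "\<not> inj_on (\<lambda>i. c (b i)) {..k}" by (rule pigeonhole)
  then obtain i j where ij: "i < j" "j \<le> k" "c (b i) = c (b j)"
    unfolding inj_on_def by (metis atMost_iff nat_neq_iff)
  have "M \<le> pdist (b j) (b i)" using sep ij by blast
  also have "\<dots> \<le> pdist (b j) (c (b j)) + pdist (c (b j)) (b i)"
    using ij b c(3) len by (intro pdist_triangle) auto
  also have "pdist (c (b j)) (b i) = pdist (b i) (c (b i))"
    using ij b c(3) len by (simp add: pdist_commute)
  finally show ?thesis
    using sdist_le_cost2[OF fin b[of i], of F r] sdist_le_cost2[OF fin b[of j], of F r] ij
    by (simp add: c(2))
qed

text \<open>An averaging argument. Let \<open>q a\<close> be the input point nearest to center
  \<open>a\<close> within its cluster. Measured only on the cluster of \<open>a\<close>, the gains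
  of adding the points \<open>q a\<close> sum to at least the gap between the current cost and
  \<open>4 * cost2 r P F\<close>. There are at most \<open>k\<close> of them and the greedy point
  gains at least as much as each, hence at least a \<open>1 / k\<close> fraction of the gap.\<close>

lemma greedy_step:
  assumes F: "F \<in> solutions d k"
    and S: "finite S" "S \<noteq> {}"
    and greedy: "\<And>q. q \<in> P \<Longrightarrow> cost2 (2 * r) P (insert f S) \<le> cost2 (2 * r) P (insert q S)"
  shows "cost2 (2 * r) P (insert f S) - 4 * cost2 r P F
      \<le> (1 - 1 / real k) * (cost2 (2 * r) P S - 4 * cost2 r P F)"
proof -
  let ?\<Phi> = "cost2 (2 * r) P"
  obtain c where c: "\<And>p. c p \<in> F" "\<And>p. sdist p F = pdist p (c p)" "\<And>p. length (c p) = d"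
    using closest_center[OF F] by metis
  define C where "C = c ` P"
  have finC: "finite C" unfolding C_def using fin by simp
  have cardC: "card C \<le> k"
    using card_mono[of F C] F c(1) by (force simp: C_def solutions_def)
  have "\<forall>a\<in>C. \<exists>q. q \<in> P \<and> c q = a \<and> (\<forall>p\<in>P. c p = a \<longrightarrow> pdist q a \<le> pdist p a)"
  proof
    fix a assume "a \<in> C"
    then have "{p \<in> P. c p = a} \<noteq> {}" unfolding C_def by auto
    then obtain q where "is_arg_min (\<lambda>p. pdist p a) (\<lambda>p. p \<in> {p \<in> P. c p = a}) q"
      using ex_is_arg_min_if_finite[of "{p \<in> P. c p = a}" "\<lambda>p. pdist p a"] fin by auto
    then show "\<exists>q. q \<in> P \<and> c q = a \<and> (\<forall>p\<in>P. c p = a \<longrightarrow> pdist q a \<le> pdist p a)"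
      by (auto simp: is_arg_min_linorder)
  qed
  then obtain q where q: "\<And>a. a \<in> C \<Longrightarrow> q a \<in> P" "\<And>a. a \<in> C \<Longrightarrow> c (q a) = a"
      "\<And>a p. a \<in> C \<Longrightarrow> p \<in> P \<Longrightarrow> c p = a \<Longrightarrow> pdist (q a) a \<le> pdist p a"
    by metis
  \<comment> \<open>The way from \<open>p\<close> to \<open>q (c p)\<close> leads through the
    center, and \<open>q (c p)\<close> is no farther from it than \<open>p\<close>. Doubling
    distance and radius together multiplies the squared excess by 4.\<close>
  have near: "excess (2 * r) (pdist p (q (c p))) \<le> 4 * excess r (sdist p F)" if p: "p \<in> P" for p
  proof -
    have cp: "c p \<in> C" using p by (simp add: C_def)
    have "pdist p (q (c p)) \<le> pdist p (c p) + pdist (c p) (q (c p))"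
      using p cp q(1) len c(3) by (intro pdist_triangle) auto
    also have "pdist (c p) (q (c p)) = pdist (q (c p)) (c p)"
      using p cp q(1) len c(3) by (intro pdist_commute) auto
    also have "\<dots> \<le> pdist p (c p)" using q(3)[OF cp p] by simp
    finally have "pdist p (q (c p)) \<le> 2 * sdist p F" by (simp add: c(2))
    then have "excess (2 * r) (pdist p (q (c p))) \<le> excess (2 * r) (2 * sdist p F)"
      by (rule excess_mono)
    also have "max (2 * sdist p F - 2 * r) 0 = 2 * max (sdist p F - r) 0" by (auto simp: max_def)
    then have "excess (2 * r) (2 * sdist p F) = 4 * excess r (sdist p F)"
      unfolding excess_def by (simp only: power_mult_distrib) simp
    finally show ?thesis .
  qed
  let ?h = "\<lambda>p. excess (2 * r) (sdist p S)"
  have gain: "0 \<le> ?h p - excess (2 * r) (sdist p (insert a S))" for p a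
    using S by (simp add: sdist_insert excess_mono)
  have "?\<Phi> S - 4 * cost2 r P F \<le> (\<Sum>p\<in>P. ?h p - excess (2 * r) (pdist p (q (c p))))"
    using sum_mono[of P, OF near] by (simp add: cost2_excess sum_subtractf sum_distrib_left)
  also have "\<dots> = (\<Sum>a\<in>C. \<Sum>p\<in>{p \<in> P. c p = a}. ?h p - excess (2 * r) (pdist p (q (c p))))"
    unfolding C_def using fin by (intro sum.image_gen)
  also have "\<dots> \<le> (\<Sum>a\<in>C. ?\<Phi> S - ?\<Phi> (insert f S))"
  proof (rule sum_mono)
    fix a assume a: "a \<in> C"
    have "(\<Sum>p\<in>{p \<in> P. c p = a}. ?h p - excess (2 * r) (pdist p (q (c p))))
        \<le> (\<Sum>p\<in>{p \<in> P. c p = a}. ?h p - excess (2 * r) (sdist p (insert (q a) S)))"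
      using S by (intro sum_mono) (auto simp: sdist_insert intro!: excess_mono)
    \<comment> \<open>Outside the cluster of \<open>a\<close> an additional point cannot increase
      the distance, so the new summands are nonnegative.\<close>
    also have "\<dots> \<le> (\<Sum>p\<in>P. ?h p - excess (2 * r) (sdist p (insert (q a) S)))"
      using fin gain by (intro sum_mono2) auto
    also have "\<dots> = ?\<Phi> S - ?\<Phi> (insert (q a) S)"
      by (simp add: cost2_excess sum_subtractf)
    also have "\<dots> \<le> ?\<Phi> S - ?\<Phi> (insert f S)"
      using greedy q(1)[OF a] by simp
    finally show "(\<Sum>p\<in>{p \<in> P. c p = a}. ?h p - excess (2 * r) (pdist p (q (c p))))
        \<le> ?\<Phi> S - ?\<Phi> (insert f S)" .
  qed
  also have "\<dots> = real (card C) * (?\<Phi> S - ?\<Phi> (insert f S))" by simp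
  also have "\<dots> \<le> real k * (?\<Phi> S - ?\<Phi> (insert f S))"
  proof (rule mult_right_mono)
    have "0 \<le> (\<Sum>p\<in>P. ?h p - excess (2 * r) (sdist p (insert f S)))"
      using gain by (intro sum_nonneg) auto
    then show "0 \<le> ?\<Phi> S - ?\<Phi> (insert f S)" by (simp add: cost2_excess sum_subtractf)
  qed (use cardC in simp)
  finally show ?thesis using k by (simp add: field_simps)
qed

lemma greedy_iterate:
  assumes F: "F \<in> solutions d k" and m: "1 \<le> m"
    and greedy: "\<And>i q. m \<le> i \<Longrightarrow> i < m + N \<Longrightarrow> q \<in> P \<Longrightarrow>
       cost2 (2 * r) P (b ` {..i}) \<le> cost2 (2 * r) P (insert q (b ` {..<i}))"
  shows "cost2 (2 * r) P (b ` {..<m + N}) - 4 * cost2 r P F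
      \<le> (1 - 1 / real k) ^ N * (cost2 (2 * r) P (b ` {..<m}) - 4 * cost2 r P F)"
  using greedy
proof (induction N)
  case 0
  then show ?case by simp
next
  case (Suc N)
  have eq: "b ` {..<m + Suc N} = insert (b (m + N)) (b ` {..<m + N})"
    by (auto simp: less_Suc_eq)
  have eq': "b ` {..m + N} = insert (b (m + N)) (b ` {..<m + N})"
    by (auto simp: le_less)
  have "cost2 (2 * r) P (b ` {..<m + Suc N}) - 4 * cost2 r P F
      \<le> (1 - 1 / real k) * (cost2 (2 * r) P (b ` {..<m + N}) - 4 * cost2 r P F)"
    unfolding eq
  proof (rule greedy_step[OF F])
    show "b ` {..<m + N} \<noteq> {}" using m by (auto simp: lessThan_empty_iff)
    show "cost2 (2 * r) P (insert (b (m + N)) (b ` {..<m + N}))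
      \<le> cost2 (2 * r) P (insert q (b ` {..<m + N}))" if "q \<in> P" for q
      using Suc.prems[of "m + N" q] that unfolding eq' by simp
  qed auto
  also have "\<dots> \<le> (1 - 1 / real k) * ((1 - 1 / real k) ^ N *
      (cost2 (2 * r) P (b ` {..<m}) - 4 * cost2 r P F))"
    using k Suc.prems by (intro mult_left_mono Suc.IH) auto
  finally show ?case by simp
qed


text \<open>The number \<open>W\<close> has three roles: it counts the chosen points and must allow
  \<open>k + 1 + k * (L + 2)\<close> of them; it exceeds the largest scale exponent
  \<open>2 * L + 2\<close>; and as grid resolution it must give
  \<open>2 * d / W \<le> \<epsilon> / 200\<close>. The product in the last hypothesis is large
  enough for all three.\<close>

lemma candidates_good:
  fixes b :: "nat \<Rightarrow> real list" and \<epsilon> M :: real and W L :: nat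
  assumes F0: "F0 \<in> solutions d k" and d: "1 \<le> d" and eps: "0 < \<epsilon>" "\<epsilon> < 1"
    and b: "\<And>i. i < W \<Longrightarrow> b i \<in> P"
    and far: "\<And>j p. 1 \<le> j \<Longrightarrow> j \<le> k \<Longrightarrow> p \<in> P \<Longrightarrow> sdist p (b ` {..<j}) \<le> sdist (b j) (b ` {..<j})"
    and M: "M = sdist (b k) (b ` {..<k})"
    and greedy: "\<And>i q. k < i \<Longrightarrow> i < W \<Longrightarrow> q \<in> P \<Longrightarrow>
       cost2 (2 * r) P (b ` {..i}) \<le> cost2 (2 * r) P (insert q (b ` {..<i}))"
    and lam: "card P \<le> 2 ^ L"
    and W: "400 * real k * real d * (real L + 3) / \<epsilon> \<le> real W"
  shows "\<exists>g. (\<forall>i. g i < W) \<and>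
    cost2 ((1 + \<epsilon>) * r) P (grid_center b (r + M / real (card P)) W d g ` {..<k}) \<le> (1 + \<epsilon>) * cost2 r P F0"
proof -
  define n where "n = card P"
  have n1: "1 \<le> n" using fin ne by (simp add: n_def Suc_le_eq card_gt_0_iff)
  have "real n \<le> real (2 ^ L)" using lam by (simp only: n_def of_nat_le_iff)
  then have nL: "real n \<le> 2 ^ L" by simp
  have klam: "400 * (real k * (real L + 3)) \<le> real W" and dW: "400 * real d / \<epsilon> \<le> real W"
  proof -
    have "1 \<le> real d / \<epsilon>" using d eps by (simp add: field_simps)
    then have "400 * (real k * (real L + 3)) * 1 \<le> 400 * (real k * (real L + 3)) * (real d / \<epsilon>)"
      by (intro mult_left_mono) auto
    then show "400 * (real k * (real L + 3)) \<le> real W" using W by (simp add: field_simps)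
    have "1 * 1 \<le> real k * (real L + 3)" using k by (intro mult_mono) auto
    then have "400 * real d / \<epsilon> * 1 \<le> 400 * real d / \<epsilon> * (real k * (real L + 3))"
      using eps by (intro mult_left_mono) auto
    then show "400 * real d / \<epsilon> \<le> real W" using W by (simp add: field_simps)
  qed
  have Wnat: "400 * (k * (L + 3)) \<le> W"
  proof -
    have "real (400 * (k * (L + 3))) \<le> real W" using klam by simp
    then show ?thesis by linarith
  qed
  have "L + 3 \<le> k * (L + 3)" using k by (cases k) auto
  then have "400 * (L + 3) \<le> 400 * (k * (L + 3))" by (rule mult_le_mono2)
  with Wnat have "400 * (L + 3) \<le> W" by (rule order_trans[rotated])
  then have JW: "2 * L + 2 < W" by simp
  have Wk: "k + 1 + k * (L + 2) \<le> W"
    using Wnat k by (simp add: algebra_simps)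
  then have kW: "k < W" by simp
  have bk: "b ` {..<k} \<in> solutions d k"
    using b kW sub k card_image_le[of "{..<k}" b] by (auto simp: solutions_def lessThan_empty_iff)
  have M0: "0 \<le> M" unfolding M using k by (intro sdist_nonneg) (auto simp: lessThan_empty_iff)
  have costbk: "cost2 u P (b ` {..<k}) \<le> real n * excess u M" for u
    unfolding cost2_excess n_def
    by (rule sum_bounded_above, rule excess_mono) (use far[of k] k M in auto)
  have "cost2 r P (b ` {..<k}) \<le> real n * M\<^sup>2"
  proof -
    have "excess r M \<le> M\<^sup>2" unfolding excess_def using M0 r by (intro power_mono) auto
    then show ?thesis using costbk[of r] mult_left_mono[of "excess r M" "M\<^sup>2" "real n"] by simp
  qed
  then obtain F where F: "F \<in> solutions d k" and FF0: "cost2 r P F \<le> cost2 r P F0"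
    and VM: "cost2 r P F \<le> real n * M\<^sup>2"
    using F0 bk by (cases "cost2 r P F0 \<le> real n * M\<^sup>2") (auto intro: that)
  define V where "V = cost2 r P F"
  have V0: "0 \<le> V" unfolding V_def by (rule cost2_nonneg)
  have MV: "M \<le> 2 * (r + sqrt V)"
    unfolding V_def
  proof (rule separated_radius_le[OF F])
    show "b i \<in> P" if "i \<le> k" for i using b kW that by simp
  next
    fix i j assume ij: "i < j" "j \<le> k"
    have "M \<le> sdist (b k) (b ` {..<j})"
      unfolding M using ij by (intro sdist_antimono) (auto simp: lessThan_empty_iff)
    also have "\<dots> \<le> sdist (b j) (b ` {..<j})" using far ij b kW by auto
    also have "\<dots> \<le> pdist (b j) (b i)" using ij by (intro sdist_le) auto
    finally show "M \<le> pdist (b j) (b i)" .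
  qed
  define N where "N = W - (k + 1)"
  have WN: "W = k + 1 + N" "k * (L + 2) \<le> N" using Wk by (auto simp: N_def)
  \<comment> \<open>Since \<open>M - 2 * r \<le> 2 * sqrt V\<close>, the greedy phase starts with
    cost at most \<open>4 * n * V\<close>. At least \<open>k * (L + 2)\<close> steps shrink the gap
    by the factor \<open>exp (-(L + 2)) \<le> 1 / (4 * n)\<close>, which leaves at most
    \<open>V\<close> above \<open>4 * V\<close>.\<close>
  have B5: "cost2 (2 * r) P (b ` {..<W}) \<le> 5 * V"
  proof -
    let ?q = "1 - 1 / real k"
    have q: "0 \<le> ?q" using k by simp
    have "?q \<le> exp (- 1 / real k)" using exp_ge_add_one_self[of "- 1 / real k"] by simp
    then have "?q ^ N \<le> exp (- 1 / real k) ^ N" using q by (intro power_mono)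
    also have "\<dots> = exp (- (real N / real k))" by (simp flip: exp_of_nat_mult)
    also have "\<dots> \<le> exp (- (real L + 2))"
    proof -
      have "real (k * (L + 2)) \<le> real N" using WN by (simp only: of_nat_le_iff)
      then show ?thesis using k by (simp add: field_simps)
    qed
    also have "\<dots> = exp (-1) ^ (L + 2)"
      unfolding exp_of_nat_mult[symmetric] by (simp add: algebra_simps)
    also have "\<dots> \<le> (1/2) ^ (L + 2)"
      using exp_ge_add_one_self[of 1] by (intro power_mono) (auto simp: exp_minus field_simps)
    also have "\<dots> = 1 / (4 * 2 ^ L)" by (simp add: power_one_over field_simps)
    also have "\<dots> \<le> 1 / (4 * real n)"
      using nL n1 by (intro divide_left_mono) auto
    finally have qN: "?q ^ N \<le> 1 / (4 * real n)" .
    have "b ` {..<k} \<subseteq> b ` {..<k + 1}" by auto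
    then have "cost2 (2 * r) P (b ` {..<k + 1}) \<le> cost2 (2 * r) P (b ` {..<k})"
      unfolding cost2_excess using k
      by (intro sum_mono excess_mono sdist_antimono) (auto simp: lessThan_empty_iff)
    also have "\<dots> \<le> real n * excess (2 * r) M" by (rule costbk)
    also have "\<dots> \<le> real n * (2 * sqrt V)\<^sup>2"
      unfolding excess_def using MV V0 by (intro mult_left_mono power_mono) auto
    finally have init: "cost2 (2 * r) P (b ` {..<k + 1}) \<le> 4 * real n * V"
      using V0 by (simp add: power_mult_distrib)
    have "cost2 (2 * r) P (b ` {..<k + 1 + N}) - 4 * cost2 r P F
      \<le> ?q ^ N * (cost2 (2 * r) P (b ` {..<k + 1}) - 4 * cost2 r P F)"
      by (rule greedy_iterate[OF F]) (use greedy WN in auto)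
    also have "\<dots> \<le> ?q ^ N * (4 * real n * V)"
      using init V0 q by (intro mult_left_mono) (auto simp: V_def)
    also have "\<dots> \<le> 1 / (4 * real n) * (4 * real n * V)"
      using qN V0 by (intro mult_right_mono) auto
    also have "\<dots> = V" using n1 by simp
    finally show ?thesis unfolding WN(1) V_def by simp
  qed
  define S where "S = r + M / real n"
  define z where "z = 2 * sqrt V / real n"
  have S3: "S \<le> 3 * r + z"
  proof -
    have "M / real n \<le> 2 * (r + sqrt V) / real n"
      using MV n1 by (intro divide_right_mono) auto
    also have "\<dots> = 2 * r / real n + z" by (simp add: z_def add_divide_distrib distrib_left)
    also have "2 * r / real n \<le> 2 * r / 1" using r n1 by (intro divide_left_mono) auto
    finally show ?thesis unfolding S_def by simp
  qed
  have z0: "0 \<le> z" unfolding z_def using V0 by simp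
  have nz: "real n * z\<^sup>2 \<le> 4 * V"
  proof -
    have "real n * z\<^sup>2 = 4 * V / real n"
      unfolding z_def using V0 n1 by (simp add: power_divide power_mult_distrib power2_eq_square)
    also have "\<dots> \<le> 4 * V / 1" using V0 n1 by (intro divide_left_mono) auto
    finally show ?thesis by simp
  qed
  define x where "x p = max (sdist p F - r) 0" for p
  define y where "y p = max (sdist p (b ` {..<W}) - 2 * r) 0" for p
  have sumx: "(\<Sum>p\<in>P. (x p)\<^sup>2) = V" by (simp add: x_def V_def cost2_excess excess_def)
  have sumy: "(\<Sum>p\<in>P. (y p)\<^sup>2) \<le> 5 * V" using B5 by (simp add: y_def cost2_excess excess_def)
  obtain c where c: "\<And>p. c p \<in> F" "\<And>p. sdist p F = pdist p (c p)" "\<And>p. length (c p) = d"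
    using closest_center[OF F] by metis
  let ?B = "b ` {..<W}"
  have B: "finite ?B" "?B \<noteq> {}" using JW by (auto simp: lessThan_empty_iff)
  have dB: "sdist (c p) ?B \<le> 3 * r + x p + y p" if p: "p \<in> P" for p
  proof -
    obtain q where q: "q \<in> ?B" "sdist p ?B = pdist p q" using sdist_attained[OF B] by metis
    have "sdist (c p) ?B \<le> pdist (c p) q" using q B by (intro sdist_le) auto
    also have "\<dots> \<le> pdist (c p) p + pdist p q"
      using p q b c(3) len by (intro pdist_triangle) auto
    also have "pdist (c p) p = sdist p F" using p c len by (simp add: pdist_commute)
    finally show ?thesis unfolding x_def y_def q(2) by linarith
  qed
  \<comment> \<open>The exponent comes from \<open>4 * n^2 \<le> 2 ^ (2 * L + 2)\<close>: both
    \<open>r\<close> and \<open>n * M = n^2 * (M / n)\<close> are at most \<open>n^2 * S\<close>,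
    and \<open>sqrt V \<le> n * M\<close>.\<close>
  have dS: "sdist (c p) ?B \<le> S * 2 ^ (2 * L + 2)" if p: "p \<in> P" for p
  proof -
    have "x p \<le> sqrt V" using sdist_le_cost2[OF fin p, of F r] V0 by (simp add: x_def V_def)
    moreover have "y p \<le> sqrt (5 * V)"
    proof -
      have "sdist p ?B \<le> 2 * r + sqrt (5 * V)"
        by (rule order_trans[OF sdist_le_cost2[OF fin p, of ?B "2 * r"]
              add_left_mono[OF real_sqrt_le_mono[OF B5]]])
      then show ?thesis using V0 by (simp add: y_def)
    qed
    moreover have "sqrt (5 * V) \<le> sqrt (9 * V)" using V0 by simp
    moreover have "sqrt (9 * V) = 3 * sqrt V" using real_sqrt_mult[of 9 V] by simp
    ultimately have "sdist (c p) ?B \<le> 3 * r + 4 * sqrt V" using dB[OF p] by linarith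
    also have "sqrt V \<le> sqrt ((real n * M)\<^sup>2)"
    proof (rule real_sqrt_le_mono)
      have "real n * M\<^sup>2 \<le> real n * real n * M\<^sup>2" using n1 by (intro mult_right_mono) auto
      then show "V \<le> (real n * M)\<^sup>2" using VM by (simp add: V_def power2_eq_square algebra_simps)
    qed
    also have "sqrt ((real n * M)\<^sup>2) = real n * M" using M0 by simp
    also have "3 * r + 4 * (real n * M) \<le> 4 * (real n * real n) * S"
    proof -
      have "3 * r \<le> 4 * (real n * real n) * r"
        using r n1 mult_mono[of 1 "real n" 1 "real n"] by (intro mult_right_mono) auto
      moreover have "4 * (real n * real n) * S = 4 * (real n * real n) * r + 4 * (real n * M)"
        using n1 by (simp add: S_def distrib_left)
      ultimately show ?thesis by linarith
    qed
    also have "\<dots> \<le> 2 ^ (2 * L + 2) * S"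
    proof (rule mult_right_mono)
      have "real n * real n \<le> 2 ^ L * 2 ^ L" using nL by (intro mult_mono) auto
      moreover have "(2::real) ^ (2 * L + 2) = 4 * (2 ^ L * 2 ^ L)"
        unfolding power_add power_even_eq power2_eq_square by simp
      ultimately show "4 * (real n * real n) \<le> 2 ^ (2 * L + 2)" by linarith
    qed (use r M0 in \<open>simp add: S_def\<close>)
    finally show ?thesis by (simp add: mult.commute)
  qed
  \<comment> \<open>\<open>F\<close> may have fewer than \<open>k\<close> elements; the remaining
    places repeat \<open>h 0\<close>.\<close>
  obtain f where f: "f ` {..<k} = F"
  proof -
    have "card F \<le> k" "finite F" "F \<noteq> {}" using F by (auto simp: solutions_def)
    moreover from this obtain h where "bij_betw h {0..<card F} F"
      using ex_bij_betw_nat_finite by blast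
    then have "h ` {..<card F} = F" by (simp add: bij_betw_def atLeast0LessThan)
    ultimately have "(\<lambda>i. if i < card F then h i else h 0) ` {..<k} = F"
      by (force simp: card_gt_0_iff)
    then show ?thesis using that by blast
  qed
  \<comment> \<open>With this \<open>e\<close> the cost factor becomes
    \<open>1 + (25 + 24 * 5 + 6 * 4) * e = 1 + 169 * e\<close> and the radius factor
    \<open>1 + 9 * e\<close>; both are at most \<open>1 + \<epsilon>\<close>.\<close>
  let ?e = "\<epsilon> / 200"
  have "\<exists>h. (\<forall>e. h e < W) \<and> (\<forall>g. (\<forall>e<d + 2. g (i * (d + 2) + e) = h e) \<longrightarrow>
      f i \<in> c ` P \<longrightarrow> pdist (f i) (grid_center b S W d g i) \<le> ?e * (S + 2 * sdist (f i) ?B))" for i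
  proof (cases "f i \<in> c ` P")
    \<comment> \<open>A center that was assigned to no point has no controlled distance to the
      chosen points. No point relies on it, so arbitrary digits will do.\<close>
    case False
    then show ?thesis using JW by (intro exI[of _ "\<lambda>_. 0"]) auto
  next
    case True
    then obtain p where p: "p \<in> P" "f i = c p" by auto
    obtain q where q: "q \<in> ?B" "sdist (c p) ?B = pdist (c p) q" using sdist_attained[OF B] by metis
    then obtain i0 where i0: "i0 < W" "q = b i0" by auto
    obtain h where h: "\<forall>e. h e < W" "\<And>g ci. (\<forall>e<d + 2. g (ci * (d + 2) + e) = h e) \<Longrightarrow>
       pdist (c p) (grid_center b S W d g ci) \<le> 2 * real d / real W * (S + 2 * pdist (c p) (b i0))"
      using pdist_grid_center[of "c p" d b i0 W "2 * L + 2" S] c(3) len b i0 JW dS[OF p(1)] q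
      by metis
    have "2 * real d / real W * (S + 2 * pdist (c p) (b i0)) \<le> ?e * (S + 2 * pdist (c p) (b i0))"
    proof (rule mult_right_mono)
      show "2 * real d / real W \<le> ?e" using dW eps JW by (simp add: field_simps)
      show "0 \<le> S + 2 * pdist (c p) (b i0)" using r M0 pdist_nonneg by (simp add: S_def)
    qed
    with h show ?thesis unfolding p(2) q(2) i0(2) by (intro exI[of _ h]) (meson order_trans)
  qed
  then obtain h where h: "\<And>i e. h i e < W" "\<And>i g. (\<forall>e<d + 2. g (i * (d + 2) + e) = h i e) \<Longrightarrow>
      f i \<in> c ` P \<Longrightarrow> pdist (f i) (grid_center b S W d g i) \<le> ?e * (S + 2 * sdist (f i) ?B)"
    by metis
  define g where "g m = h (m div (d + 2)) (m mod (d + 2))" for m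
  have g: "\<forall>e<d + 2. g (i * (d + 2) + e) = h i e" for i
    unfolding g_def by (simp del: add_2_eq_Suc' mult_Suc_right)
  let ?C = "grid_center b S W d g ` {..<k}"
  have pt: "excess ((1 + \<epsilon>) * r) (sdist p ?C)
      \<le> (1 + 25 * ?e) * (x p)\<^sup>2 + 24 * ?e * (y p)\<^sup>2 + 6 * ?e * z\<^sup>2" if p: "p \<in> P" for p
  proof -
    obtain i where i: "i < k" "f i = c p" using f c(1)[of p] by auto
    have "sdist p ?C \<le> pdist p (grid_center b S W d g i)" using i by (intro sdist_le) auto
    also have "\<dots> \<le> pdist p (c p) + pdist (c p) (grid_center b S W d g i)"
      using p len c(3) by (intro pdist_triangle) (auto simp: grid_center_def)
    also have "pdist (c p) (grid_center b S W d g i) \<le> ?e * (S + 2 * sdist (c p) ?B)"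
      using h(2)[OF g, of i] i p by auto
    also have "\<dots> \<le> ?e * (9 * r + (2 * x p + 2 * y p + z))"
      using eps S3 dB[OF p] by (intro mult_left_mono) auto
    also have "pdist p (c p) \<le> r + x p" unfolding x_def c(2) by simp
    finally have "sdist p ?C \<le> r + x p + ?e * (9 * r + (2 * x p + 2 * y p + z))" by simp
    also have "\<dots> = x p + ?e * (2 * x p + 2 * y p + z) + (1 + 9 * ?e) * r"
      by (simp add: field_simps)
    also have "(1 + 9 * ?e) * r \<le> (1 + \<epsilon>) * r" using r eps by (intro mult_right_mono) auto
    finally have "sdist p ?C - (1 + \<epsilon>) * r \<le> x p + ?e * (2 * x p + 2 * y p + z)" by simp
    moreover have "0 \<le> x p" "0 \<le> y p" by (auto simp: x_def y_def)
    ultimately have "excess ((1 + \<epsilon>) * r) (sdist p ?C) \<le> (x p + ?e * (2 * x p + 2 * y p + z))\<^sup>2"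
      unfolding excess_def using eps z0 by (intro power_mono) auto
    also have "\<dots> \<le> (1 + 25 * ?e) * (x p)\<^sup>2 + 24 * ?e * (y p)\<^sup>2 + 6 * ?e * z\<^sup>2"
      using \<open>0 \<le> x p\<close> \<open>0 \<le> y p\<close> z0 eps by (intro excess_perturb) auto
    finally show ?thesis .
  qed
  have "cost2 ((1 + \<epsilon>) * r) P ?C
      \<le> (\<Sum>p\<in>P. (1 + 25 * ?e) * (x p)\<^sup>2 + 24 * ?e * (y p)\<^sup>2 + 6 * ?e * z\<^sup>2)"
    unfolding cost2_excess by (rule sum_mono[OF pt])
  also have "\<dots> = (1 + 25 * ?e) * (\<Sum>p\<in>P. (x p)\<^sup>2) + 24 * ?e * (\<Sum>p\<in>P. (y p)\<^sup>2) + 6 * ?e * (real n * z\<^sup>2)"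
    by (simp add: sum.distrib sum_distrib_left n_def)
  also have "\<dots> \<le> (1 + 25 * ?e) * V + 24 * ?e * (5 * V) + 6 * ?e * (4 * V)"
    using sumx sumy nz eps by (intro add_mono mult_left_mono) auto
  also have "\<dots> \<le> (1 + \<epsilon>) * V" using eps V0 by (simp add: field_simps)
  also have "\<dots> \<le> (1 + \<epsilon>) * cost2 r P F0" using eps FF0 by (intro mult_left_mono) (auto simp: V_def)
  finally have "cost2 ((1 + \<epsilon>) * r) P ?C \<le> (1 + \<epsilon>) * cost2 r P F0" .
  moreover have "\<forall>i. g i < W" using h(1) by (simp add: g_def)
  ultimately show ?thesis unfolding S_def n_def by blast
qed

end

section \<open>Total correctness with running time\<close>

text \<open>Running time if every loop makes at most \<open>U\<close> iterations whenever it is entered.\<close>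

fun tbound :: "nat \<Rightarrow> com \<Rightarrow> nat" where
  "tbound U (NAssign a e) = 1 + ncost a + ncost e"
| "tbound U (RAssign a e) = 1 + ncost a + rcost e"
| "tbound U (Random a e) = 1 + ncost a + ncost e"
| "tbound U (Seq c1 c2) = tbound U c1 + tbound U c2"
| "tbound U (Ite b c1 c2) = 1 + bcost b + tbound U c1 + tbound U c2"
| "tbound U (While b c) = (U + 1) * (1 + bcost b + tbound U c)"

text \<open>Each level of loop nesting contributes one factor \<open>U + 1\<close>. The program is
  fixed, so \<open>C\<close> and \<open>e\<close> are absolute constants. Exponents of consecutive
  parts are simply added, which is generous but still polynomial.\<close>

lemma tbound_polynomial: "\<exists>C e. \<forall>U. tbound U c \<le> C * (U + 1) ^ e"
proof (induction c)
  case (NAssign a e)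
  show ?case by (rule exI[of _ "1 + ncost a + ncost e"], rule exI[of _ 0]) simp
next
  case (RAssign a e)
  show ?case by (rule exI[of _ "1 + ncost a + rcost e"], rule exI[of _ 0]) simp
next
  case (Random a e)
  show ?case by (rule exI[of _ "1 + ncost a + ncost e"], rule exI[of _ 0]) simp
next
  case (Seq c1 c2)
  then obtain C1 e1 C2 e2 where *: "\<And>U. tbound U c1 \<le> C1 * (U + 1) ^ e1" "\<And>U. tbound U c2 \<le> C2 * (U + 1) ^ e2"
    by metis
  have "tbound U (Seq c1 c2) \<le> (C1 + C2) * (U + 1) ^ (e1 + e2)" for U
  proof -
    have "C1 * (U + 1) ^ e1 \<le> C1 * (U + 1) ^ (e1 + e2)" "C2 * (U + 1) ^ e2 \<le> C2 * (U + 1) ^ (e1 + e2)"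
      by (auto intro!: mult_left_mono power_increasing)
    with *[of U] show ?thesis unfolding tbound.simps distrib_right by linarith
  qed
  then show ?case by blast
next
  case (Ite b c1 c2)
  then obtain C1 e1 C2 e2 where *: "\<And>U. tbound U c1 \<le> C1 * (U + 1) ^ e1" "\<And>U. tbound U c2 \<le> C2 * (U + 1) ^ e2"
    by metis
  have "tbound U (Ite b c1 c2) \<le> (1 + bcost b + C1 + C2) * (U + 1) ^ (e1 + e2)" for U
  proof -
    have "C1 * (U + 1) ^ e1 \<le> C1 * (U + 1) ^ (e1 + e2)" "C2 * (U + 1) ^ e2 \<le> C2 * (U + 1) ^ (e1 + e2)"
      "(1 + bcost b) * 1 \<le> (1 + bcost b) * (U + 1) ^ (e1 + e2)"
      by (auto intro!: mult_left_mono power_increasing simp del: mult_Suc)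
    with *[of U] show ?thesis unfolding tbound.simps distrib_right by linarith
  qed
  then show ?case by blast
next
  case (While b c)
  then obtain C e where *: "\<And>U. tbound U c \<le> C * (U + 1) ^ e" by metis
  have "tbound U (While b c) \<le> (1 + bcost b + C) * (U + 1) ^ Suc e" for U
  proof -
    have "(1 + bcost b) * 1 \<le> (1 + bcost b) * (U + 1) ^ e"
      by (intro mult_left_mono) auto
    with *[of U] have "1 + bcost b + tbound U c \<le> (1 + bcost b + C) * (U + 1) ^ e"
      unfolding distrib_right by linarith
    then have "(U + 1) * (1 + bcost b + tbound U c) \<le> (U + 1) * ((1 + bcost b + C) * (U + 1) ^ e)"
      by (rule mult_le_mono2)
    then show ?thesis by (simp only: tbound.simps power_Suc mult_ac)
  qed
  then show ?case by blast
qed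

text \<open>The final distribution is required to be a point mass, so the calculus describes runs
  with a certain outcome, and the success probability will be 1. The time budget depends only on
  \<open>c\<close> and \<open>U\<close>: timing enters later proofs only as the bound
  \<open>U\<close> on loop lengths.\<close>

definition wp :: "nat \<Rightarrow> com \<Rightarrow> (state \<Rightarrow> bool) \<Rightarrow> state \<Rightarrow> bool" where
  "wp U c Q s \<longleftrightarrow> (\<exists>s' t. exec c s (return_pmf (s', t)) \<and> t \<le> tbound U c \<and> Q s')"

lemma add_time_return [simp]: "add_time t (return_pmf (s, u)) = return_pmf (s, t + u)"
  by (simp add: add_time_def)

lemma wp_mono: "wp U c Q s \<Longrightarrow> (\<And>s'. Q s' \<Longrightarrow> R s') \<Longrightarrow> wp U c R s"
  unfolding wp_def by blast

lemma wp_NAssign: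
  "Q ((fst s)(neval a s := neval e s), snd s) \<Longrightarrow> wp U (NAssign a e) Q s"
  unfolding wp_def using exec.NAssign[of a e s] by fastforce

lemma wp_RAssign:
  "Q (fst s, (snd s)(neval a s := reval e s)) \<Longrightarrow> wp U (RAssign a e) Q s"
  unfolding wp_def using exec.RAssign[of a e s] by fastforce

lemma exec_Seq_return:
  assumes "exec c1 s (return_pmf (s1, t1))" "exec c2 s1 (return_pmf (s2, t2))"
  shows "exec (Seq c1 c2) s (return_pmf (s2, t1 + t2))"
proof -
  have "exec (Seq c1 c2) s (bind_pmf (return_pmf (s1, t1)) (\<lambda>(s', t). add_time t (return_pmf (s2, t2))))"
    using assms by (intro exec.Seq) auto
  then show ?thesis by (simp add: bind_return_pmf)
qed

lemma wp_Seq: "wp U c1 (wp U c2 Q) s \<Longrightarrow> wp U (Seq c1 c2) Q s"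
  unfolding wp_def by (fastforce intro: exec_Seq_return)

lemma wp_Ite:
  assumes "beval b s \<Longrightarrow> wp U c1 Q s" "\<not> beval b s \<Longrightarrow> wp U c2 Q s"
  shows "wp U (Ite b c1 c2) Q s"
proof (cases "beval b s")
  case True
  with assms obtain s' t where "exec c1 s (return_pmf (s', t))" "t \<le> tbound U c1" "Q s'"
    unfolding wp_def by blast
  with exec.IteTrue[OF True, of c1 _ c2] show ?thesis unfolding wp_def by fastforce
next
  case False
  with assms obtain s' t where "exec c2 s (return_pmf (s', t))" "t \<le> tbound U c2" "Q s'"
    unfolding wp_def by blast
  with exec.IteFalse[OF False, of c2 _ c1] show ?thesis unfolding wp_def by fastforce
qed

text \<open>The number \<open>m\<close> of iterations is named in advance and the invariant is
  indexed by the iterations completed, so termination, time and correctness come from one induction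
  on \<open>m - i\<close>.\<close>

lemma wp_While:
  assumes "m \<le> U" "I 0 s"
    and step: "\<And>i s. i < m \<Longrightarrow> I i s \<Longrightarrow> beval b s \<and> wp U c (I (Suc i)) s"
    and fin: "\<And>s. I m s \<Longrightarrow> \<not> beval b s \<and> Q s"
  shows "wp U (While b c) Q s"
proof -
  let ?T = "1 + bcost b + tbound U c"
  have "\<exists>s' t. exec (While b c) s (return_pmf (s', t)) \<and> t \<le> (m - i + 1) * ?T \<and> Q s'"
    if "i \<le> m" "I i s" for i s
    using that
  proof (induction "m - i" arbitrary: i s)
    case 0
    then have "i = m" by simp
    with 0 fin exec.WhileFalse[of b s c] show ?case by fastforce
  next
    case (Suc j)
    then have i: "i < m" "j = m - Suc i" by auto
    from step[OF i(1) Suc.prems(2)] obtain s1 t1 where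
      1: "beval b s" "exec c s (return_pmf (s1, t1))" "t1 \<le> tbound U c" "I (Suc i) s1"
      unfolding wp_def by blast
    from Suc.hyps(1)[OF i(2) _ 1(4)] i obtain s2 t2 where
      2: "exec (While b c) s1 (return_pmf (s2, t2))" "t2 \<le> (m - Suc i + 1) * ?T" "Q s2"
      by auto
    have "exec (While b c) s (return_pmf (s2, 1 + bcost b + (t1 + t2)))"
      using exec.WhileTrue[OF 1(1) exec_Seq_return[OF 1(2) 2(1)]] by simp
    moreover have "1 + bcost b + (t1 + t2) \<le> (m - i + 1) * ?T"
    proof -
      have "m - i + 1 = Suc (m - Suc i + 1)" using i by simp
      then have "(m - i + 1) * ?T = ?T + (m - Suc i + 1) * ?T" by (simp only: mult_Suc)
      then show ?thesis using 1(3) 2(2) by linarith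
    qed
    ultimately show ?case using 2(3) by blast
  qed
  from this[of 0 s] assms(2) obtain s' t where
    "exec (While b c) s (return_pmf (s', t))" "t \<le> (m + 1) * ?T" "Q s'" by auto
  moreover have "(m + 1) * ?T \<le> (U + 1) * ?T" using assms(1) by (intro mult_le_mono1) simp
  ultimately show ?thesis unfolding wp_def tbound.simps by (meson order_trans)
qed

abbreviation Cell :: "nat \<Rightarrow> nexp" where "Cell x \<equiv> NMem (NConst x)"

text \<open>A step other than 1 lets the counter run through multiples of \<open>d\<close>, which
  replaces the multiplication of naturals. The bound \<open>hi\<close> and the step
  \<open>st\<close> are evaluated anew in each round.\<close>

definition Loop :: "nat \<Rightarrow> nexp \<Rightarrow> nexp \<Rightarrow> nexp \<Rightarrow> com \<Rightarrow> com" where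
  "Loop x lo hi st c = Seq (NAssign (NConst x) lo)
     (While (NLess (Cell x) hi) (Seq c (NAssign (NConst x) (NAdd (Cell x) st))))"

lemma wp_Loop:
  assumes "m \<le> U" and hi: "a + m * h = b" and h: "1 \<le> h"
    and lo: "neval lo s = a"
    and init: "I 0 ((fst s)(x := a), snd s)"
    and inv: "\<And>i s. i \<le> m \<Longrightarrow> I i s \<Longrightarrow> fst s x = a + i * h \<and> neval hi s = b"
    and step: "\<And>i s. i < m \<Longrightarrow> I i s \<Longrightarrow> fst s x = a + i * h \<Longrightarrow>
        wp U c (\<lambda>s'. fst s' x = a + i * h \<and> neval st s' = h
           \<and> I (Suc i) ((fst s')(x := a + i * h + h), snd s')) s"
    and fin: "\<And>s. I m s \<Longrightarrow> fst s x = b \<Longrightarrow> Q s"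
  shows "wp U (Loop x lo hi st c) Q s"
  unfolding Loop_def
proof (rule wp_Seq, rule wp_NAssign, rule wp_While[OF assms(1), where I = I])
  show "I 0 ((fst s)(neval (NConst x) s := neval lo s), snd s)" using init lo by simp
next
  fix i s assume i: "i < m" and I: "I i s"
  from inv[OF _ I] i have x: "fst s x = a + i * h" "neval hi s = b" by auto
  have "a + i * h < b" unfolding hi[symmetric] using i h by simp
  then have "beval (NLess (Cell x) hi) s" using x by simp
  moreover have "wp U (Seq c (NAssign (NConst x) (NAdd (Cell x) st))) (I (Suc i)) s"
    by (rule wp_Seq, rule wp_mono[OF step[OF i I x(1)]], rule wp_NAssign) auto
  ultimately show "beval (NLess (Cell x) hi) s \<and>
      wp U (Seq c (NAssign (NConst x) (NAdd (Cell x) st))) (I (Suc i)) s" by simp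
next
  fix s assume I: "I m s"
  with inv[OF _ I] hi show "\<not> beval (NLess (Cell x) hi) s \<and> Q s" using fin by simp
qed

section \<open>Choosing the points\<close>

abbreviation Skip :: com where "Skip \<equiv> NAssign (NConst 9) (Cell 9)"

lemma wp_Skip: "Q s \<Longrightarrow> wp U Skip Q s"
  by (rule wp_NAssign) simp

text \<open>
  Memory layout.  The real cells below \<open>Z = 2 + n * d\<close> keep the input; the cells above are dealt out
  cyclically to four unbounded arrays: scalars (0), the distances to the points chosen so far (1),
  the current centers (2) and the best centers found (3).  Of the natural cells, 3 holds \<open>Z\<close>,
  4 holds \<open>k * d\<close>, 7 and 8 hold the base \<open>W\<close> and the number of candidate solutions, and the cells
  from 100 on hold the chosen points.  A point of the input is represented by its address.
\<close>

definition slot :: "nat \<Rightarrow> nat \<Rightarrow> nat \<Rightarrow> nat" where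
  "slot Z c i = Z + 4 * i + c"

text \<open>The product \<open>4 * e\<close> must be written as a sum, because naturals have no
  unit-time multiplication.\<close>

definition slotE :: "nat \<Rightarrow> nexp \<Rightarrow> nexp" where
  "slotE c e = NAdd (NAdd (Cell 3) (NAdd (NAdd e e) (NAdd e e))) (NConst c)"

abbreviation Scalar :: "nat \<Rightarrow> nexp" where "Scalar j \<equiv> slotE 0 (NConst j)"

lemma neval_slotE [simp]: "neval (slotE c e) s = slot (fst s 3) c (neval e s)"
  by (simp add: slotE_def slot_def)

lemma slot_eq [simp]: "c < 4 \<Longrightarrow> c' < 4 \<Longrightarrow> slot Z c i = slot Z c' i' \<longleftrightarrow> c = c' \<and> i = i'"
  unfolding slot_def by presburger

lemma slot_ge [simp]: "Z \<le> slot Z c i"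
  by (simp add: slot_def)

lemma slot_neq [simp]: "a < Z \<Longrightarrow> a \<noteq> slot Z c i" "a < Z \<Longrightarrow> slot Z c i \<noteq> a"
  by (auto simp: slot_def)

lemma slot_range [simp]: "c < 4 \<Longrightarrow> c' < 4 \<Longrightarrow> slot Z c i \<in> range (slot Z c') \<longleftrightarrow> c = c'"
  by auto

section \<open>Frame conditions and the distance routine\<close>

definition agree :: "nat set \<Rightarrow> nat set \<Rightarrow> state \<Rightarrow> state \<Rightarrow> bool" where
  "agree X Y s s' \<longleftrightarrow> (\<forall>a. a \<notin> X \<longrightarrow> fst s' a = fst s a) \<and> (\<forall>a. a \<notin> Y \<longrightarrow> snd s' a = snd s a)"

lemma agree_refl [simp]: "agree X Y s s"
  by (simp add: agree_def)

lemma agree_fst: "agree X Y s s' \<Longrightarrow> a \<notin> X \<Longrightarrow> fst s' a = fst s a"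
  by (simp add: agree_def)

lemma agree_snd: "agree X Y s s' \<Longrightarrow> a \<notin> Y \<Longrightarrow> snd s' a = snd s a"
  by (simp add: agree_def)

lemma agree_trans:
  "agree X Y s s' \<Longrightarrow> agree X' Y' s' s'' \<Longrightarrow> X \<subseteq> X'' \<Longrightarrow> X' \<subseteq> X'' \<Longrightarrow> Y \<subseteq> Y'' \<Longrightarrow> Y' \<subseteq> Y'' \<Longrightarrow> agree X'' Y'' s s''"
  unfolding agree_def by (metis subsetD)

lemma agree_updN [simp]: "x \<in> X \<Longrightarrow> agree X Y s (f(x := v), R) \<longleftrightarrow> agree X Y s (f, R)"
  by (auto simp: agree_def)

lemma agree_updR [simp]: "x \<in> Y \<Longrightarrow> agree X Y s (f, R(x := v)) \<longleftrightarrow> agree X Y s (f, R)"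
  by (auto simp: agree_def)

text \<open>The argument \<open>e\<close> is the difference in one coordinate, as an expression that
  reads the coordinate index from cell 9. This makes the routine usable for two input points as well
  as for a point and a center.\<close>

definition Dist :: "rexp \<Rightarrow> com" where
  "Dist e = Seq (RAssign (Scalar 0) (ROfNat (NConst 0)))
     (Seq (Loop 9 (NConst 0) (Cell 2) (NConst 1) (RAssign (Scalar 0) (RAdd (RMem (Scalar 0)) (RMul e e))))
        (RAssign (Scalar 0) (RSqrt (RMem (Scalar 0)))))"

lemma wp_Dist:
  assumes dU: "d \<le> U" and d: "fst s 2 = d" and Z: "fst s 3 = Z"
    and e: "\<And>l s'. l < d \<Longrightarrow> agree {9} {slot Z 0 0} s s' \<Longrightarrow> fst s' 9 = l \<Longrightarrow> reval e s' = g l"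
  shows "wp U (Dist e) (\<lambda>s'. agree {9} {slot Z 0 0} s s' \<and> snd s' (slot Z 0 0) = L2_set g {..<d}) s"
  unfolding Dist_def
proof (rule wp_Seq, rule wp_RAssign, rule wp_Seq,
    rule wp_Loop[where m = d and a = 0 and h = 1 and b = d and
      I = "\<lambda>i s'. agree {9} {slot Z 0 0} s s' \<and> fst s' 9 = i \<and> snd s' (slot Z 0 0) = (\<Sum>l<i. (g l)\<^sup>2)"],
    goal_cases)
  case (6 i s')
  then have ag: "agree {9} {slot Z 0 0} s s'" by simp
  from 6 show ?case using d by (simp add: agree_fst[OF ag])
next
  case (7 i s')
  then have ag: "agree {9} {slot Z 0 0} s s'" by simp
  have "fst s' 3 = Z" using Z by (simp add: agree_fst[OF ag])
  with 7 e[of i s'] show ?case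
    by (intro wp_RAssign) (auto simp: power2_eq_square)
next
  case (8 s')
  then have ag: "agree {9} {slot Z 0 0} s s'" by simp
  have "fst s' 3 = Z" using Z by (simp add: agree_fst[OF ag])
  with 8 show ?case by (intro wp_RAssign) (auto simp: L2_set_def)
qed (use dU Z in auto)

definition PP :: "nat \<Rightarrow> nat \<Rightarrow> rexp" where
  "PP x y = RSub (RMem (NAdd (Cell x) (Cell 9))) (RMem (NAdd (Cell y) (Cell 9)))"

text \<open>\<open>U\<close> bounds the lengths of all loops and \<open>R0\<close> is the initial
  real memory. By \<open>inj\<close> the stored points are distinct, so sums over the set of points
  are sums over their positions.\<close>

locale machine =
  fixes U n k d :: nat and R0 :: "nat \<Rightarrow> real"
  assumes nU: "n \<le> U" and kU: "k \<le> U" and dU: "d + 2 \<le> U" and d1: "1 \<le> d" and k1: "1 \<le> k"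
    and inj: "inj_on (\<lambda>j. map (\<lambda>l. R0 (2 + j * d + l)) [0..<d]) {..<n}"
begin

definition "Z = 2 + n * d"
definition "padr j = 2 + j * d"
definition pt :: "nat \<Rightarrow> real list" where "pt a = map (\<lambda>l. R0 (a + l)) [0..<d]"
abbreviation "r \<equiv> R0 1"
abbreviation "eps \<equiv> R0 0"

definition "P = (\<lambda>j. pt (padr j)) ` {..<n}"

definition base :: "state \<Rightarrow> bool" where
  "base s \<longleftrightarrow> fst s 0 = n \<and> fst s 1 = k \<and> fst s 2 = d \<and> fst s 3 = Z \<and> (\<forall>a<Z. snd s a = R0 a)"

lemma padr_eq [simp]: "padr i = padr j \<longleftrightarrow> i = j"
  using d1 by (simp add: padr_def)

lemma padr_le: "j < n \<Longrightarrow> padr j + d \<le> Z"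
proof -
  assume "j < n"
  then have "(j + 1) * d \<le> n * d" by (intro mult_le_mono1) simp
  then show ?thesis by (simp add: Z_def padr_def)
qed

lemma Z2 [simp]: "0 < Z" "Suc 0 < Z"
  by (auto simp: Z_def)

lemma base_agree:
  assumes b: "base s" and ag: "agree X Y s s'" and X: "X \<inter> {0, 1, 2, 3} = {}" and Y: "\<forall>y\<in>Y. Z \<le> y"
  shows "base s'"
proof -
  have "0 \<notin> X" "1 \<notin> X" "2 \<notin> X" "3 \<notin> X" using X by auto
  moreover have "a \<notin> Y" if "a < Z" for a using Y that by (metis leD)
  ultimately show ?thesis using b by (simp add: base_def agree_fst[OF ag] agree_snd[OF ag])
qed

lemma base_updN [simp]: "x \<notin> {0, 1, 2, 3} \<Longrightarrow> base (f(x := v), R) \<longleftrightarrow> base (f, R)"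
  by (auto simp: base_def)

lemma base_updR [simp]: "Z \<le> x \<Longrightarrow> base (f, R(x := v)) \<longleftrightarrow> base (f, R)"
  by (auto simp: base_def)

lemma base_simps [simp]:
  assumes "base s"
  shows "fst s 0 = n" "fst s (Suc 0) = k" "fst s 2 = d" "fst s 3 = Z" "a < Z \<Longrightarrow> snd s a = R0 a"
  using assms by (auto simp: base_def)

lemma length_pt [simp]: "length (pt a) = d"
  by (simp add: pt_def)

lemma pdist_pt: "pdist (pt a) (pt b) = L2_set (\<lambda>l. R0 (a + l) - R0 (b + l)) {..<d}"
  unfolding pdist_def by (intro L2_set_cong) (auto simp: pt_def)

lemma wp_Dist_PP:
  assumes b: "base s" and x: "x \<noteq> 9" "fst s x + d \<le> Z" and y: "y \<noteq> 9" "fst s y + d \<le> Z"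
  shows "wp U (Dist (PP x y)) (\<lambda>s'. agree {9} {slot Z 0 0} s s' \<and>
     snd s' (slot Z 0 0) = pdist (pt (fst s x)) (pt (fst s y))) s"
  unfolding pdist_pt
proof (rule wp_Dist)
  fix l s' assume l: "l < d" and a: "agree {9} {slot Z 0 0} s s'" and l9: "fst s' 9 = l"
  have "fst s' x = fst s x" "fst s' y = fst s y" using a x y by (auto simp: agree_fst)
  moreover have "snd s' (fst s x + l) = R0 (fst s x + l)" "snd s' (fst s y + l) = R0 (fst s y + l)"
    using b l x y by (auto simp: agree_snd[OF a])
  ultimately show "reval (PP x y) s' = R0 (fst s x + l) - R0 (fst s y + l)"
    using l9 by (simp add: PP_def)
qed (use b dU in auto)

text \<open>Distances are indexed by the address of a point rather than by its number, so that the
  counter of a loop over the points is directly the index. The gaps in the array do no harm.\<close>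

definition near :: "real list set \<Rightarrow> state \<Rightarrow> bool" where
  "near S s \<longleftrightarrow> (\<forall>j<n. snd s (slot Z 1 (padr j)) = sdist (pt (padr j)) S)"

text \<open>For \<open>n = 0\<close> the chosen points are the meaningless address 2.\<close>

abbreviation pnt :: "nat \<Rightarrow> bool" where
  "pnt a \<equiv> \<exists>j. j < max 1 n \<and> a = padr j"

lemma pnt_le: "pnt a \<Longrightarrow> 0 < n \<Longrightarrow> a + d \<le> Z"
  using padr_le by auto

end

text \<open>The counter is the address of the current point, running from 2 in steps of
  \<open>d\<close> up to \<open>Z\<close>.\<close>

definition PLoop :: "nat \<Rightarrow> com \<Rightarrow> com" where
  "PLoop x c = Loop x (NConst 2) (Cell 3) (Cell 2) c"

definition Update :: com where
  "Update = PLoop 10 (Seq (Dist (PP 10 13))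
     (Ite (RLess (RMem (Scalar 0)) (RMem (slotE 1 (Cell 10)))) (RAssign (slotE 1 (Cell 10)) (RMem (Scalar 0))) Skip))"

definition Init :: com where
  "Init = PLoop 10 (Seq (Dist (PP 10 13)) (RAssign (slotE 1 (Cell 10)) (RMem (Scalar 0))))"

definition Far :: com where
  "Far = Seq (NAssign (NConst 13) (NConst 2)) (Seq (RAssign (Scalar 1) (ROfNat (NConst 0)))
     (PLoop 10 (Ite (RLess (RMem (Scalar 1)) (RMem (slotE 1 (Cell 10))))
        (Seq (RAssign (Scalar 1) (RMem (slotE 1 (Cell 10)))) (NAssign (NConst 13) (Cell 10))) Skip)))"

definition AddExcess :: "rexp \<Rightarrow> nat \<Rightarrow> com" where
  "AddExcess u m = Ite (RLess u (RMem (Scalar m)))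
     (RAssign (Scalar 3) (RAdd (RMem (Scalar 3)) (RMul (RSub (RMem (Scalar m)) u) (RSub (RMem (Scalar m)) u)))) Skip"

abbreviation "r2 \<equiv> RAdd (RMem (NConst 1)) (RMem (NConst 1))"

definition Phi :: com where
  "Phi = Seq (RAssign (Scalar 3) (ROfNat (NConst 0))) (PLoop 10 (Seq (Dist (PP 10 11))
     (Seq (Ite (RLess (RMem (slotE 1 (Cell 10))) (RMem (Scalar 0))) (RAssign (Scalar 0) (RMem (slotE 1 (Cell 10)))) Skip)
        (AddExcess r2 0))))"

text \<open>No start value is safe for the running minimum. The test \<open>2 <\<close> cell 11
  recognizes the first point by its address and forces its acceptance.\<close>

definition Greedy :: com where
  "Greedy = Seq (NAssign (NConst 13) (NConst 2)) (PLoop 11 (Seq Phi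
     (Ite (BAnd (NLess (NConst 2) (Cell 11)) (BNot (RLess (RMem (Scalar 3)) (RMem (Scalar 2))))) Skip
        (Seq (RAssign (Scalar 2) (RMem (Scalar 3))) (NAssign (NConst 13) (Cell 11))))))"

context machine
begin

lemma wp_PLoop:
  assumes init: "I 0 ((fst s)(x := 2), snd s)"
    and inv: "\<And>i s. i \<le> n \<Longrightarrow> I i s \<Longrightarrow> base s \<and> fst s x = padr i"
    and step: "\<And>i s. i < n \<Longrightarrow> I i s \<Longrightarrow> base s \<Longrightarrow> fst s x = padr i \<Longrightarrow>
        wp U c (\<lambda>s'. fst s' x = padr i \<and> fst s' 2 = d
           \<and> I (Suc i) ((fst s')(x := padr (Suc i)), snd s')) s"
    and fin: "\<And>s. I n s \<Longrightarrow> base s \<Longrightarrow> fst s x = Z \<Longrightarrow> Q s"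
  shows "wp U (PLoop x c) Q s"
  unfolding PLoop_def
proof (rule wp_Loop[where m = n and a = 2 and h = d and b = Z and I = I], goal_cases)
  case (6 i s)
  then show ?case using inv[of i s] by (simp add: padr_def)
next
  case (7 i s)
  then have "base s" "fst s x = padr i" using inv[of i s] by auto
  note st = step[OF 7(1,2) this]
  show ?case by (rule wp_mono[OF st]) (auto simp: padr_def algebra_simps)
next
  case (8 s)
  then show ?case using inv[of n s] fin by simp
qed (use nU d1 init in \<open>auto simp: Z_def\<close>)

lemma wp_Update:
  assumes b: "base s" and S: "near S s" "finite S" "S \<noteq> {}" and f: "pnt (fst s 13)"
  shows "wp U Update (\<lambda>s'. agree {9, 10} ({slot Z 0 0} \<union> range (slot Z 1)) s s' \<and>
     near (insert (pt (fst s 13)) S) s') s"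
  unfolding Update_def
proof (rule wp_PLoop[where I = "\<lambda>i s'. agree {9, 10} ({slot Z 0 0} \<union> range (slot Z 1)) s s' \<and> fst s' 10 = padr i
    \<and> (\<forall>j<n. snd s' (slot Z 1 (padr j)) =
        sdist (pt (padr j)) (if j < i then insert (pt (fst s 13)) S else S))"], goal_cases)
  case 1
  then show ?case using S by (simp add: near_def padr_def)
next
  case (2 i s')
  then have ag: "agree {9, 10} ({slot Z 0 0} \<union> range (slot Z 1)) s s'" by simp
  show ?case using 2 base_agree[OF b ag] by auto
next
  case (3 i s')
  note b' = 3(3)
  have ag: "agree {9, 10} ({slot Z 0 0} \<union> range (slot Z 1)) s s'" using 3 by simp
  have f': "fst s' 13 = fst s 13" by (simp add: agree_fst[OF ag])
  have le: "fst s' 10 + d \<le> Z" "fst s' 13 + d \<le> Z"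
    using 3 padr_le pnt_le[OF f] f' by auto
  show ?case
  proof (rule wp_Seq, rule wp_mono[OF wp_Dist_PP[OF b' _ le(1) _ le(2)]], simp, simp, elim conjE)
    fix s2 assume s2: "agree {9} {slot Z 0 0} s' s2"
        "snd s2 (slot Z 0 0) = pdist (pt (fst s' 10)) (pt (fst s' 13))"
    have b2: "base s2" using base_agree[OF b' s2(1)] by auto
    have a2: "agree {9, 10} ({slot Z 0 0} \<union> range (slot Z 1)) s s2"
      by (rule agree_trans[OF ag s2(1)]) auto
    have n2: "snd s2 (slot Z 1 (padr j)) =
        sdist (pt (padr j)) (if j < i then insert (pt (fst s 13)) S else S)" if "j < n" for j
      using 3 that by (simp add: agree_snd[OF s2(1)])
    have x2: "fst s2 10 = padr i" using 3 by (simp add: agree_fst[OF s2(1)])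
    have v2: "snd s2 (slot Z 0 0) = pdist (pt (padr i)) (pt (fst s 13))" using s2 3 f' by simp
    show "wp U (Ite (RLess (RMem (Scalar 0)) (RMem (slotE 1 (Cell 10)))) (RAssign (slotE 1 (Cell 10)) (RMem (Scalar 0))) Skip)
       (\<lambda>s'. fst s' 10 = padr i \<and> fst s' 2 = d \<and>
           agree {9, 10} ({slot Z 0 0} \<union> range (slot Z 1)) s ((fst s')(10 := padr (Suc i)), snd s') \<and>
           fst ((fst s')(10 := padr (Suc i)), snd s') 10 = padr (Suc i) \<and>
           (\<forall>j<n. snd ((fst s')(10 := padr (Suc i)), snd s') (slot Z 1 (padr j)) =
             sdist (pt (padr j)) (if j < Suc i then insert (pt (fst s 13)) S else S))) s2"
      using b2 a2 n2 x2 v2 3(1) S(2,3)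
      by (intro wp_Ite wp_RAssign wp_Skip) (auto simp: sdist_insert less_Suc_eq)
  qed
next
  case (4 s')
  then show ?case unfolding near_def by auto
qed

end

definition Build :: com where
  "Build = Seq (NAssign (NConst 13) (NConst 2)) (Seq Init (Seq (NAssign (NConst 100) (NConst 2))
     (Seq (Loop 12 (NConst 1) (NAdd (Cell 1) (NConst 1)) (NConst 1)
        (Seq Far (Seq (NAssign (NAdd (NConst 100) (Cell 12)) (Cell 13)) Update)))
      (Loop 12 (NAdd (Cell 1) (NConst 1)) (Cell 7) (NConst 1)
        (Seq Greedy (Seq (NAssign (NAdd (NConst 100) (Cell 12)) (Cell 13)) Update))))))"

context machine
begin

lemma cost2_P: "cost2 u P F = (\<Sum>j<n. excess u (sdist (pt (padr j)) F))"
  unfolding cost2_excess P_def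
  by (subst sum.reindex) (use inj in \<open>auto simp: pt_def padr_def\<close>)

lemma wp_Init:
  assumes b: "base s" and f: "pnt (fst s 13)"
  shows "wp U Init (\<lambda>s'. agree {9, 10} ({slot Z 0 0} \<union> range (slot Z 1)) s s' \<and>
     near {pt (fst s 13)} s') s"
  unfolding Init_def
proof (rule wp_PLoop[where I = "\<lambda>i s'. agree {9, 10} ({slot Z 0 0} \<union> range (slot Z 1)) s s' \<and> fst s' 10 = padr i
    \<and> (\<forall>j<i. snd s' (slot Z 1 (padr j)) = sdist (pt (padr j)) {pt (fst s 13)})"], goal_cases)
  case 1
  then show ?case by (simp add: padr_def)
next
  case (2 i s')
  then have ag: "agree {9, 10} ({slot Z 0 0} \<union> range (slot Z 1)) s s'" by simp
  show ?case using 2 base_agree[OF b ag] by auto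
next
  case (3 i s')
  note b' = 3(3)
  have ag: "agree {9, 10} ({slot Z 0 0} \<union> range (slot Z 1)) s s'" using 3 by simp
  have f': "fst s' 13 = fst s 13" by (simp add: agree_fst[OF ag])
  have le: "fst s' 10 + d \<le> Z" "fst s' 13 + d \<le> Z"
    using 3 padr_le pnt_le[OF f] f' by auto
  show ?case
  proof (rule wp_Seq, rule wp_mono[OF wp_Dist_PP[OF b' _ le(1) _ le(2)]], goal_cases)
    case (3 s2)
    then have s2: "agree {9} {slot Z 0 0} s' s2" by simp
    have "base s2" using base_agree[OF b' s2] by auto
    moreover have "agree {9, 10} ({slot Z 0 0} \<union> range (slot Z 1)) s s2"
      by (rule agree_trans[OF ag s2]) auto
    moreover have "snd s2 (slot Z 1 (padr j)) = sdist (pt (padr j)) {pt (fst s 13)}" if "j < i" for j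
      using \<open>_ \<and> _ \<and> _\<close> that by (simp add: agree_snd[OF s2])
    moreover have "fst s2 10 = padr i" using \<open>_ \<and> _ \<and> _\<close> by (simp add: agree_fst[OF s2])
    moreover have "snd s2 (slot Z 0 0) = pdist (pt (padr i)) (pt (fst s 13))"
      using 3 f' \<open>fst s' 10 = padr i\<close> by simp
    ultimately show ?case
      by (intro wp_RAssign) (auto simp: less_Suc_eq)
  qed auto
next
  case (4 s')
  then show ?case unfolding near_def by auto
qed

text \<open>The running maximum starts with value 0 and address 2. If it never rises, all distances
  are 0 and the point at address 2 is a correct answer; this explains the alternative
  \<open>= 0\<close> in the invariant. The value in \<open>Scalar 1\<close> is part of the result
  because the last traversal step leaves the covering radius \<open>M\<close> there.\<close>

lemma wp_Far:
  assumes b: "base s" and S: "near S s" "finite S" "S \<noteq> {}"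
  shows "wp U Far (\<lambda>s'. agree {9, 10, 13} {slot Z 0 1} s s' \<and> pnt (fst s' 13) \<and>
     (\<forall>p\<in>P. sdist p S \<le> sdist (pt (fst s' 13)) S) \<and>
     (0 < n \<longrightarrow> snd s' (slot Z 0 1) = sdist (pt (fst s' 13)) S)) s"
  unfolding Far_def
proof (rule wp_Seq, rule wp_NAssign, rule wp_Seq, rule wp_RAssign,
    rule wp_PLoop[where I = "\<lambda>i s'. agree {9, 10, 13} {slot Z 0 1} s s' \<and> fst s' 10 = padr i
    \<and> 0 \<le> snd s' (slot Z 0 1) \<and> (\<forall>j<i. sdist (pt (padr j)) S \<le> snd s' (slot Z 0 1))
    \<and> (\<exists>f. f < max 1 n \<and> fst s' 13 = padr f \<and> (snd s' (slot Z 0 1) = 0 \<or> sdist (pt (padr f)) S = snd s' (slot Z 0 1)))"], goal_cases)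
  case 1
  then show ?case using b by (auto simp: padr_def intro!: exI[of _ 0])
next
  case (2 i s')
  then have ag: "agree {9, 10, 13} {slot Z 0 1} s s'" by simp
  show ?case using 2 base_agree[OF b ag] by auto
next
  case (3 i s')
  have ag: "agree {9, 10, 13} {slot Z 0 1} s s'" using 3 by simp
  let ?M = "snd s' (slot Z 0 1)"
  have nr: "snd s' (slot Z 1 (padr i)) = sdist (pt (padr i)) S"
    using S 3(1) by (simp add: agree_snd[OF ag] near_def)
  have le: "sdist (pt (padr j)) S \<le> ?M" if "j < i" for j using 3 that by auto
  show ?case
  proof (rule wp_Ite, goal_cases)
    case 1
    then have M: "?M < sdist (pt (padr i)) S" using 3(3,4) nr by simp
    have "sdist (pt (padr j)) S \<le> sdist (pt (padr i)) S" if "j < Suc i" for j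
      using le[of j] M that by (cases "j = i") auto
    with M show ?case using 3 nr
      by (intro wp_Seq wp_RAssign wp_NAssign) (auto intro!: exI[of _ i])
  next
    case 2
    then have M: "sdist (pt (padr i)) S \<le> ?M" using 3(3,4) nr by simp
    have "sdist (pt (padr j)) S \<le> ?M" if "j < Suc i" for j
      using le[of j] M that by (cases "j = i") auto
    then show ?case using 3 nr by (intro wp_Skip) auto
  qed
next
  case (4 s')
  then obtain f where f: "f < max 1 n" "fst s' 13 = padr f"
    "snd s' (slot Z 0 1) = 0 \<or> sdist (pt (padr f)) S = snd s' (slot Z 0 1)" by auto
  have le: "sdist (pt (padr j)) S \<le> snd s' (slot Z 0 1)" if "j < n" for j using 4 that by auto
  have "sdist (pt (padr f)) S = snd s' (slot Z 0 1)" if "0 < n"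
    using f le[of f] sdist_nonneg[OF S(2,3), of "pt (padr f)"] that by auto
  moreover have "\<forall>p\<in>P. sdist p S \<le> sdist (pt (padr f)) S"
    using le calculation unfolding P_def by fastforce
  ultimately show ?case using f 4 by auto
qed

lemma wp_AddExcess:
  assumes "base s" "Q (fst s, (snd s)(slot Z 0 3 := snd s (slot Z 0 3) + excess (reval u s) (snd s (slot Z 0 m))))"
  shows "wp U (AddExcess u m) Q s"
  using assms unfolding AddExcess_def
  by (intro wp_Ite wp_RAssign wp_Skip) (auto simp: excess_def power2_eq_square max_def)

lemma wp_Phi:
  assumes b: "base s" and S: "near S s" "finite S" "S \<noteq> {}" and f: "pnt (fst s 11)"
  shows "wp U Phi (\<lambda>s'. agree {9, 10} {slot Z 0 0, slot Z 0 3} s s' \<and>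
     snd s' (slot Z 0 3) = cost2 (2 * r) P (insert (pt (fst s 11)) S)) s"
  unfolding Phi_def
proof (rule wp_Seq, rule wp_RAssign,
    rule wp_PLoop[where I = "\<lambda>i s'. agree {9, 10} {slot Z 0 0, slot Z 0 3} s s' \<and> fst s' 10 = padr i
    \<and> snd s' (slot Z 0 3) = (\<Sum>j<i. excess (2 * r) (sdist (pt (padr j)) (insert (pt (fst s 11)) S)))"], goal_cases)
  case 1
  then show ?case using b by (auto simp: padr_def)
next
  case (2 i s')
  then have ag: "agree {9, 10} {slot Z 0 0, slot Z 0 3} s s'" by simp
  show ?case using 2 base_agree[OF b ag] by auto
next
  case (3 i s')
  note b' = 3(3)
  have ag: "agree {9, 10} {slot Z 0 0, slot Z 0 3} s s'" using 3 by simp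
  have f': "fst s' 11 = fst s 11" by (simp add: agree_fst[OF ag])
  have le: "fst s' 10 + d \<le> Z" "fst s' 11 + d \<le> Z"
    using 3 padr_le pnt_le[OF f] f' by auto
  have nr: "snd s' (slot Z 1 (padr i)) = sdist (pt (padr i)) S"
    using S 3(1) by (simp add: agree_snd[OF ag] near_def)
  show ?case
  proof (rule wp_Seq, rule wp_mono[OF wp_Dist_PP[OF b' _ le(1) _ le(2)]], goal_cases)
    case (3 s2)
    then have s2: "agree {9} {slot Z 0 0} s' s2" by simp
    have b2: "base s2" using base_agree[OF b' s2] by auto
    have a2: "agree {9, 10} {slot Z 0 0, slot Z 0 3} s s2"
      by (rule agree_trans[OF ag s2]) auto
    have x2: "fst s2 10 = padr i" using \<open>_ \<and> _ \<and> _\<close> by (simp add: agree_fst[OF s2])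
    have d2: "snd s2 (slot Z 0 0) = pdist (pt (padr i)) (pt (fst s 11))"
      using 3 f' \<open>fst s' 10 = padr i\<close> by simp
    have n2: "snd s2 (slot Z 1 (padr i)) = sdist (pt (padr i)) S"
      using nr by (simp add: agree_snd[OF s2])
    have v2: "snd s2 (slot Z 0 3) = (\<Sum>j<i. excess (2 * r) (sdist (pt (padr j)) (insert (pt (fst s 11)) S)))"
      using \<open>_ \<and> _ \<and> _\<close> by (simp add: agree_snd[OF s2])
    have "sdist (pt (padr i)) (insert (pt (fst s 11)) S)
        = (if sdist (pt (padr i)) S < pdist (pt (padr i)) (pt (fst s 11)) then sdist (pt (padr i)) S
           else pdist (pt (padr i)) (pt (fst s 11)))"
      using S(2,3) by (auto simp: sdist_insert min_def)
    then show ?case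
      using b2 a2 x2 d2 n2 v2
      by (intro wp_Seq wp_Ite wp_RAssign wp_Skip wp_AddExcess) auto
  qed auto
next
  case (4 s')
  then show ?case by (auto simp: cost2_P)
qed

lemma wp_Greedy:
  assumes b: "base s" and S: "near S s" "finite S" "S \<noteq> {}"
  shows "wp U Greedy (\<lambda>s'. agree {9, 10, 11, 13} {slot Z 0 0, slot Z 0 2, slot Z 0 3} s s' \<and> pnt (fst s' 13) \<and>
     (\<forall>q\<in>P. cost2 (2 * r) P (insert (pt (fst s' 13)) S) \<le> cost2 (2 * r) P (insert q S))) s"
  unfolding Greedy_def
proof (rule wp_Seq, rule wp_NAssign,
    rule wp_PLoop[where I = "\<lambda>i s'. agree {9, 10, 11, 13} {slot Z 0 0, slot Z 0 2, slot Z 0 3} s s' \<and> fst s' 11 = padr i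
    \<and> (\<exists>f. f < max 1 n \<and> fst s' 13 = padr f \<and> (0 < i \<longrightarrow> snd s' (slot Z 0 2) = cost2 (2 * r) P (insert (pt (padr f)) S)))
    \<and> (\<forall>j<i. snd s' (slot Z 0 2) \<le> cost2 (2 * r) P (insert (pt (padr j)) S))"], goal_cases)
  case 1
  then show ?case using b by (auto simp: padr_def intro!: exI[of _ 0])
next
  case (2 i s')
  then have ag: "agree {9, 10, 11, 13} {slot Z 0 0, slot Z 0 2, slot Z 0 3} s s'" by simp
  show ?case using 2 base_agree[OF b ag] by auto
next
  case (3 i s')
  note b' = 3(3)
  have ag: "agree {9, 10, 11, 13} {slot Z 0 0, slot Z 0 2, slot Z 0 3} s s'" using 3 by simp
  have nr: "near S s'"
    using S by (simp add: agree_snd[OF ag] near_def)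
  have pn: "pnt (fst s' 11)" using 3 by auto
  show ?case
  proof (rule wp_Seq, rule wp_mono[OF wp_Phi[OF b' nr S(2,3) pn]], goal_cases)
    case (1 s2)
    then have s2: "agree {9, 10} {slot Z 0 0, slot Z 0 3} s' s2" by simp
    have b2: "base s2" using base_agree[OF b' s2] by auto
    have a2: "agree {9, 10, 11, 13} {slot Z 0 0, slot Z 0 2, slot Z 0 3} s s2"
      by (rule agree_trans[OF ag s2]) auto
    have x2: "fst s2 11 = padr i" using 3 by (simp add: agree_fst[OF s2])
    have d2: "snd s2 (slot Z 0 3) = cost2 (2 * r) P (insert (pt (padr i)) S)"
      using 1 3 by simp
    let ?M = "snd s2 (slot Z 0 2)"
    obtain f where f2: "f < max 1 n" "fst s2 13 = padr f" "0 < i \<longrightarrow> ?M = cost2 (2 * r) P (insert (pt (padr f)) S)"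
      using 3 by (auto simp: agree_snd[OF s2] agree_fst[OF s2])
    have le: "?M \<le> cost2 (2 * r) P (insert (pt (padr j)) S)" if "j < i" for j
      using 3 that by (auto simp: agree_snd[OF s2])
    have i0: "2 < padr i \<longleftrightarrow> 0 < i" using d1 by (auto simp: padr_def)
    have i: "i < max 1 n" using 3 by simp
    show ?case
    proof (rule wp_Ite, goal_cases)
      case 1
      then have M: "0 < i" "?M \<le> cost2 (2 * r) P (insert (pt (padr i)) S)" using b2 x2 i0 d2 by auto
      have "?M \<le> cost2 (2 * r) P (insert (pt (padr j)) S)" if "j < Suc i" for j
        using le[of j] M that by (cases "j = i") auto
      then show ?case using b2 a2 x2 f2 M(1) by (intro wp_Skip) (auto intro!: exI[of _ f])
    next
      case 2
      then have M: "0 < i \<Longrightarrow> cost2 (2 * r) P (insert (pt (padr i)) S) \<le> ?M" using b2 x2 i0 d2 by auto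
      have "cost2 (2 * r) P (insert (pt (padr i)) S) \<le> cost2 (2 * r) P (insert (pt (padr j)) S)"
        if "j < Suc i" for j
        using le[of j] M that by (cases "j = i") auto
      then show ?case using b2 a2 x2 i d2
        by (intro wp_Seq wp_RAssign wp_NAssign) (auto intro!: exI[of _ i])
    qed
  qed
next
  case (4 s')
  then show ?case by (auto simp: P_def)
qed

end

section \<open>The complete selection of \<open>W\<close> points\<close>

context machine
begin

definition "bp B j = pt (B j)" for B :: "nat \<Rightarrow> nat"

abbreviation "Bs s \<equiv> \<lambda>j. fst s (100 + j)"

definition farB :: "(nat \<Rightarrow> nat) \<Rightarrow> nat \<Rightarrow> bool" where
  "farB B i \<longleftrightarrow> (\<forall>j p. 1 \<le> j \<longrightarrow> j < i \<longrightarrow> j \<le> k \<longrightarrow> p \<in> P \<longrightarrow>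
     sdist p (bp B ` {..<j}) \<le> sdist (bp B j) (bp B ` {..<j}))"

definition grB :: "(nat \<Rightarrow> nat) \<Rightarrow> nat \<Rightarrow> bool" where
  "grB B i \<longleftrightarrow> (\<forall>j q. k < j \<longrightarrow> j < i \<longrightarrow> q \<in> P \<longrightarrow>
     cost2 (2 * r) P (bp B ` {..j}) \<le> cost2 (2 * r) P (insert q (bp B ` {..<j})))"

text \<open>Only the first \<open>i\<close> entries of the list are constrained, so writing entry
  \<open>i\<close> cannot destroy what is known already.\<close>

definition okB :: "nat \<Rightarrow> state \<Rightarrow> bool" where
  "okB i s \<longleftrightarrow> (\<forall>j<i. pnt (Bs s j)) \<and> near (bp (Bs s) ` {..<i}) s \<and> farB (Bs s) i \<and> grB (Bs s) i"

lemma bp_upd: "j \<le> i \<Longrightarrow> bp (B(i := f)) ` {..<j} = bp B ` {..<j}"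
  "j < i \<Longrightarrow> bp (B(i := f)) ` {..j} = bp B ` {..j}"
  "bp (B(i := f)) i = pt f" "j < i \<Longrightarrow> bp (B(i := f)) j = bp B j"
  by (auto simp: bp_def intro!: image_cong)

text \<open>The common end of a round of both selection loops. Exactly one of the premises
  \<open>far\<close> and \<open>gr\<close> has content, depending on whether
  \<open>i \<le> k\<close>.\<close>

lemma wp_Store:
  assumes b: "base s" and ok: "okB i s" and i: "1 \<le> i" "fst s 12 = i" and f: "pnt (fst s 13)"
    and far: "i \<le> k \<Longrightarrow> \<forall>p\<in>P. sdist p (bp (Bs s) ` {..<i}) \<le> sdist (pt (fst s 13)) (bp (Bs s) ` {..<i})"
    and gr: "k < i \<Longrightarrow> \<forall>q\<in>P. cost2 (2 * r) P (insert (pt (fst s 13)) (bp (Bs s) ` {..<i}))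
       \<le> cost2 (2 * r) P (insert q (bp (Bs s) ` {..<i}))"
  shows "wp U (Seq (NAssign (NAdd (NConst 100) (Cell 12)) (Cell 13)) Update)
    (\<lambda>s'. agree {9, 10, 100 + i} ({slot Z 0 0} \<union> range (slot Z 1)) s s' \<and> okB (Suc i) s' \<and>
       Bs s' = (Bs s)(i := fst s 13)) s"
proof -
  let ?S = "bp (Bs s) ` {..<i}"
  define s1 where "s1 = ((fst s)(100 + i := fst s 13), snd s)"
  have S: "finite ?S" "?S \<noteq> {}" using i by (auto simp: lessThan_empty_iff)
  have b1: "base s1" using b unfolding s1_def by simp
  have n1: "near ?S s1" using ok by (simp add: s1_def near_def okB_def)
  have f1: "fst s1 13 = fst s 13" by (simp add: s1_def)
  show ?thesis
  proof (rule wp_Seq, rule wp_NAssign, simp only: neval.simps i(2), fold s1_def,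
      rule wp_mono[OF wp_Update[OF b1 n1 S]], goal_cases)
    case 1
    then show ?case using f f1 by simp
  next
    case (2 s')
    then have ag: "agree {9, 10} ({slot Z 0 0} \<union> range (slot Z 1)) s1 s'" by simp
    have B: "Bs s' = (Bs s)(i := fst s 13)"
      by (rule ext) (simp add: agree_fst[OF ag], simp add: s1_def)
    have "agree {100 + i} {} s s1" by (simp add: s1_def agree_def)
    then have "agree {9, 10, 100 + i} ({slot Z 0 0} \<union> range (slot Z 1)) s s'"
      by (rule agree_trans[OF _ ag]) auto
    moreover have "bp (Bs s') ` {..<Suc i} = insert (pt (fst s 13)) ?S"
      unfolding B lessThan_Suc image_insert bp_upd(1)[OF order_refl] by (simp add: bp_upd(3))
    moreover have "bp (Bs s') ` {..i} = insert (pt (fst s 13)) ?S"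
      using calculation by (simp add: lessThan_Suc_atMost)
    moreover have "pnt (Bs s' j)" if "j < Suc i" for j
      using ok f that by (auto simp: fun_cong[OF B] okB_def less_Suc_eq)
    moreover have "farB (Bs s') (Suc i)"
      using ok far unfolding B farB_def okB_def by (auto simp: bp_upd less_Suc_eq)
    moreover have "grB (Bs s') (Suc i)"
      unfolding grB_def
    proof (intro allI impI)
      fix j q assume j: "k < j" "j < Suc i" "q \<in> P"
      show "cost2 (2 * r) P (bp (Bs s') ` {..j}) \<le> cost2 (2 * r) P (insert q (bp (Bs s') ` {..<j}))"
      proof (cases "j = i")
        case True
        have "bp (Bs s') ` {..<i} = ?S" unfolding B by (simp add: bp_upd)
        then show ?thesis using gr j True calculation(3) by simp
      next
        case False
        then have "j < i" using j by simp
        then have "bp (Bs s') ` {..<j} = bp (Bs s) ` {..<j}" "bp (Bs s') ` {..j} = bp (Bs s) ` {..j}"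
          unfolding B by (simp_all add: bp_upd)
        then show ?thesis using ok j \<open>j < i\<close> by (simp add: okB_def grB_def)
      qed
    qed
    ultimately show ?case using 2 B f1 by (simp add: okB_def)
  qed
qed

text \<open>\<open>Scalar 1\<close> holds the distance found by the \<open>k\<close>-th traversal
  step, which is \<open>M\<close>. It survives the greedy phase since neither \<open>Greedy\<close>
  nor \<open>Update\<close> writes to that cell.\<close>

lemma wp_Build:
  assumes b: "base s" and W: "fst s 7 = W" "k + 1 \<le> W" "W \<le> U"
  shows "wp U Build (\<lambda>s'. agree ({9, 10, 11, 12, 13} \<union> {100..})
       ({slot Z 0 0, slot Z 0 1, slot Z 0 2, slot Z 0 3} \<union> range (slot Z 1)) s s' \<and>
     (\<forall>j<W. pnt (Bs s' j)) \<and> farB (Bs s') W \<and> grB (Bs s') W \<and>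
     (0 < n \<longrightarrow> snd s' (slot Z 0 1) = sdist (bp (Bs s') k) (bp (Bs s') ` {..<k}))) s"
proof -
  let ?X = "{9, 10, 11, 12, 13} \<union> {100..} :: nat set"
  let ?Y = "{slot Z 0 0, slot Z 0 1, slot Z 0 2, slot Z 0 3} \<union> range (slot Z 1)"
  have bs: "base s'" if "agree ?X ?Y s s'" for s'
    by (rule base_agree[OF b that]) auto
  have W': "fst s' 7 = W" if "agree ?X ?Y s s'" for s'
    using agree_fst[OF that, of 7] W by simp
  define s1 where "s1 = ((fst s)(13 := 2), snd s)"
  have b1: "base s1" using b by (simp add: s1_def)
  have p1: "pnt (fst s1 13)" by (rule exI[of _ 0]) (simp add: s1_def padr_def)
  have f1: "fst s1 13 = 2" by (simp add: s1_def)
  show ?thesis unfolding Build_def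
  proof (rule wp_Seq, rule wp_NAssign, simp only: neval.simps, fold s1_def,
      rule wp_Seq, rule wp_mono[OF wp_Init[OF b1 p1]], goal_cases)
    case (1 s2)
    then have s2: "agree {9, 10} ({slot Z 0 0} \<union> range (slot Z 1)) s1 s2" "near {pt 2} s2" using f1 by auto
    have "agree ?X ?Y s s1" by (simp add: s1_def)
    then have ag2: "agree ?X ?Y s s2" by (rule agree_trans[OF _ s2(1)]) auto
    define s3 where "s3 = ((fst s2)(100 := 2), snd s2)"
    have ag3: "agree ?X ?Y s s3" using ag2 by (simp add: s3_def)
    have "bp (Bs s3) ` {..<1} = {pt 2}" by (auto simp: bp_def s3_def lessThan_Suc)
    then have ok3: "okB 1 s3"
      using s2(2) by (auto simp: okB_def s3_def near_def farB_def grB_def padr_def intro!: exI[of _ 0])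
    show ?case
    proof (rule wp_Seq, rule wp_NAssign, simp only: neval.simps, fold s3_def, rule wp_Seq,
        rule wp_Loop[where m = k and a = 1 and h = 1 and b = "k + 1" and
          I = "\<lambda>i s'. agree ?X ?Y s s' \<and> fst s' 12 = 1 + i \<and> okB (1 + i) s' \<and>
            (0 < i \<and> 0 < n \<longrightarrow> snd s' (slot Z 0 1) = sdist (bp (Bs s') i) (bp (Bs s') ` {..<i}))"], goal_cases)
      case 5
      then show ?case using ag3 ok3 by (simp add: okB_def near_def)
    next
      case (6 i s')
      then show ?case using bs[of s'] by simp
    next
      case (7 i s')
      have ag: "agree ?X ?Y s s'" and ok: "okB (1 + i) s'" and x: "fst s' 12 = 1 + i" using 7 by auto
      let ?S = "bp (Bs s') ` {..<1 + i}"
      have S: "near ?S s'" "finite ?S" "?S \<noteq> {}" using ok by (auto simp: okB_def lessThan_empty_iff)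
      show ?case
      proof (rule wp_Seq, rule wp_mono[OF wp_Far[OF bs[OF ag] S]], goal_cases)
        case (1 s4)
        then have s4: "agree {9, 10, 13} {slot Z 0 1} s' s4" by simp
        have ag4: "agree ?X ?Y s s4" by (rule agree_trans[OF ag s4]) auto
        have B4: "Bs s4 = Bs s'" by (rule ext) (simp add: agree_fst[OF s4])
        have ok4: "okB (1 + i) s4" using ok by (simp add: okB_def B4 fun_cong[OF B4] near_def agree_snd[OF s4])
        have x4: "fst s4 12 = 1 + i" using x by (simp add: agree_fst[OF s4])
        show ?case
        proof (rule wp_mono[OF wp_Store[OF bs[OF ag4] ok4 _ x4]], goal_cases)
          case (5 s5)
          then have s5: "agree {9, 10, 100 + (1 + i)} ({slot Z 0 0} \<union> range (slot Z 1)) s4 s5"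
            and B5: "Bs s5 = (Bs s4)(1 + i := fst s4 13)" and ok5: "okB (Suc (1 + i)) s5" by auto
          have ag5: "agree ?X ?Y s s5" by (rule agree_trans[OF ag4 s5]) auto
          have "bp (Bs s5) ` {..<Suc i} = ?S" "bp (Bs s5) (Suc i) = pt (fst s4 13)"
            unfolding B5 by (simp_all add: bp_upd B4)
          moreover have "snd s5 (slot Z 0 1) = snd s4 (slot Z 0 1)" by (simp add: agree_snd[OF s5])
          moreover have "fst s5 12 = 1 + i" using x4 by (simp add: agree_fst[OF s5])
          ultimately show ?case using 1 ag5 ok5 by (auto simp: okB_def near_def)
        qed (use 1 7 B4 in auto)
      qed
    next
      case (8 s')
      have ag: "agree ?X ?Y s s'" and ok: "okB (1 + k) s'" using 8 by auto
      have W7: "fst s' 7 = W" by (rule W'[OF ag])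
      show ?case
      proof (rule wp_Loop[where m = "W - (k + 1)" and a = "k + 1" and h = 1 and b = W and
          I = "\<lambda>i s'. agree ?X ?Y s s' \<and> fst s' 12 = k + 1 + i \<and> okB (k + 1 + i) s' \<and>
            (0 < n \<longrightarrow> snd s' (slot Z 0 1) = sdist (bp (Bs s') k) (bp (Bs s') ` {..<k}))"], goal_cases)
        case 4
        then show ?case using bs[OF ag] by simp
      next
        case 5
        then show ?case using 8 k1 by (simp add: okB_def near_def)
      next
        case (6 i s')
        then show ?case using W'[of s'] by simp
      next
        case (7 i s')
        have ag: "agree ?X ?Y s s'" and ok: "okB (k + 1 + i) s'" and x: "fst s' 12 = k + 1 + i" using 7 by auto
        let ?S = "bp (Bs s') ` {..<k + 1 + i}"
        have S: "near ?S s'" "finite ?S" "?S \<noteq> {}" using ok by (auto simp: okB_def lessThan_empty_iff)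
        show ?case
        proof (rule wp_Seq, rule wp_mono[OF wp_Greedy[OF bs[OF ag] S]], goal_cases)
          case (1 s4)
          then have s4: "agree {9, 10, 11, 13} {slot Z 0 0, slot Z 0 2, slot Z 0 3} s' s4" by simp
          have ag4: "agree ?X ?Y s s4" by (rule agree_trans[OF ag s4]) auto
          have B4: "Bs s4 = Bs s'" by (rule ext) (simp add: agree_fst[OF s4])
          have ok4: "okB (k + 1 + i) s4" using ok by (simp add: okB_def B4 fun_cong[OF B4] near_def agree_snd[OF s4])
          have x4: "fst s4 12 = k + 1 + i" using x by (simp add: agree_fst[OF s4])
          show ?case
          proof (rule wp_mono[OF wp_Store[OF bs[OF ag4] ok4 _ x4]], goal_cases)
            case (5 s5)
            then have s5: "agree {9, 10, 100 + (k + 1 + i)} ({slot Z 0 0} \<union> range (slot Z 1)) s4 s5"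
              and B5: "Bs s5 = (Bs s4)(k + 1 + i := fst s4 13)" and ok5: "okB (Suc (k + 1 + i)) s5" by auto
            have ag5: "agree ?X ?Y s s5" by (rule agree_trans[OF ag4 s5]) auto
            have "bp (Bs s5) ` {..<k} = bp (Bs s') ` {..<k}" "bp (Bs s5) k = bp (Bs s') k"
              unfolding B5 by (simp_all add: bp_upd B4)
            moreover have "snd s5 (slot Z 0 1) = snd s' (slot Z 0 1)"
              by (simp add: agree_snd[OF s5] agree_snd[OF s4])
            moreover have "fst s5 12 = k + 1 + i" using x4 by (simp add: agree_fst[OF s5])
            ultimately show ?case using 7 ag5 ok5 by (auto simp: okB_def near_def)
          qed (use 1 7 B4 in auto)
        qed
      next
        case (8 s')
        then show ?case using W by (simp add: okB_def)
      qed (use W in auto)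
    qed (use kU in auto)
  qed
qed

end

section \<open>Enumerating the candidate solutions\<close>

text \<open>Division by repeated subtraction. The quotient replaces the dividend in cell 15, so
  consecutive calls peel off the digits of a number from the lowest upwards.\<close>

definition DivMod :: "nat \<Rightarrow> com" where
  "DivMod y = Seq (NAssign (NConst 16) (NConst 0)) (Seq
     (While (BNot (NLess (Cell 15) (Cell 7)))
        (Seq (NAssign (NConst 15) (NSub (Cell 15) (Cell 7))) (NAssign (NConst 16) (NAdd (Cell 16) (NConst 1)))))
     (Seq (NAssign (NConst y) (Cell 15)) (NAssign (NConst 15) (Cell 16))))"

lemma wp_DivMod:
  assumes x: "fst s 15 = x" "x \<le> U" and W: "fst s 7 = W" "1 \<le> W" and y: "y \<notin> {7, 15, 16}"
  shows "wp U (DivMod y) (\<lambda>s'. agree {15, 16, y} {} s s' \<and> fst s' y = x mod W \<and> fst s' 15 = x div W) s"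
  unfolding DivMod_def
proof (rule wp_Seq, rule wp_NAssign, rule wp_Seq,
    rule wp_While[where m = "x div W" and I = "\<lambda>i s'. agree {15, 16, y} {} s s' \<and> fst s' 7 = W \<and>
      fst s' 15 = x - i * W \<and> fst s' 16 = i"], goal_cases)
  case 1
  have "x div W \<le> x" by simp
  then show ?case using x by linarith
next
  case 2
  then show ?case using x W by simp
next
  case (3 i s')
  have "(i + 1) * W \<le> x div W * W" using 3 by (intro mult_le_mono1) simp
  also have "\<dots> \<le> x" by simp
  finally have "W \<le> x - i * W" "x - i * W - W = x - Suc i * W" by auto
  with 3 show ?case by (auto intro!: wp_Seq wp_NAssign)
next
  case (4 s')
  have "x - x div W * W = x mod W" by (simp add: minus_div_mult_eq_mod)
  with 4 W y show ?case by (auto intro!: wp_Seq wp_NAssign)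
qed

definition digit :: "nat \<Rightarrow> nat \<Rightarrow> nat \<Rightarrow> nat" where
  "digit W t i = t div W ^ i mod W"

text \<open>Adding \<open>g m * W ^ m\<close> sets digit \<open>m\<close> and changes the quotients
  that determine the lower digits only by multiples of \<open>W\<close>.\<close>

lemma digits_exist:
  assumes "\<And>i. g i < W"
  shows "\<exists>t<W ^ m. \<forall>i<m. digit W t i = g i"
proof (induction m)
  case 0
  then show ?case by simp
next
  case (Suc m)
  then obtain t where t: "t < W ^ m" "\<forall>i<m. digit W t i = g i" by auto
  have W: "0 < W" using assms[of 0] by simp
  let ?t = "t + g m * W ^ m"
  have "?t < W ^ m + g m * W ^ m" using t by simp
  also have "\<dots> = (g m + 1) * W ^ m" by simp
  also have "\<dots> \<le> W * W ^ m" using assms[of m] by (intro mult_le_mono1) simp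
  finally have "?t < W ^ Suc m" by simp
  moreover have "digit W ?t i = g i" if "i < Suc m" for i
  proof (cases "i = m")
    case True
    then show ?thesis using t(1) W assms[of m] by (simp add: digit_def)
  next
    case False
    then have i: "i < m" using that by simp
    then have "W ^ m = W ^ i * (W * W ^ (m - Suc i))"
      by (simp flip: power_Suc power_add)
    then have "?t = t + W ^ i * (W * (g m * W ^ (m - Suc i)))" by (simp add: mult_ac)
    then have "?t div W ^ i = (t + W ^ i * (W * (g m * W ^ (m - Suc i)))) div W ^ i" by (rule arg_cong)
    also have "\<dots> = t div W ^ i + W * (g m * W ^ (m - Suc i))" using W by simp
    finally show ?thesis using t(2) i by (simp add: digit_def)
  qed
  ultimately show ?case by blast
qed

definition CLoop :: "nat \<Rightarrow> com \<Rightarrow> com" where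
  "CLoop x c = Loop x (NConst 0) (Cell 4) (Cell 2) c"

text \<open>The digits are consumed in the order of \<open>grid_center\<close>: cell 17 gets the
  index of the chosen point, cell 18 the exponent, and cell 9 one grid coordinate after the other.
  \<open>Scalar 5\<close> becomes \<open>S * 2 ^ j\<close> by \<open>j\<close> doublings. Cell 20
  holds \<open>c * d\<close> for the current center \<open>c\<close>.\<close>

definition Decode :: com where
  "Decode = Seq (NAssign (NConst 15) (Cell 14)) (CLoop 20 (Seq (DivMod 17) (Seq (DivMod 18)
     (Seq (RAssign (Scalar 5) (RMem (Scalar 4)))
     (Seq (Loop 9 (NConst 0) (Cell 18) (NConst 1) (RAssign (Scalar 5) (RAdd (RMem (Scalar 5)) (RMem (Scalar 5)))))
       (Loop 19 (NConst 0) (Cell 2) (NConst 1) (Seq (DivMod 9)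
         (RAssign (slotE 2 (NAdd (Cell 20) (Cell 19)))
           (RAdd (RMem (NAdd (NMem (NAdd (NConst 100) (Cell 17))) (Cell 19)))
              (RMul (RMem (Scalar 5)) (RSub (RDiv (RMul (ROfNat (NConst 2)) (ROfNat (Cell 9))) (ROfNat (Cell 7)))
                (ROfNat (NConst 1)))))))))))))"

definition PF :: rexp where
  "PF = RSub (RMem (NAdd (Cell 10) (Cell 9))) (RMem (slotE 2 (NAdd (Cell 20) (Cell 9))))"

abbreviation "ue \<equiv> RMul (RAdd (ROfNat (NConst 1)) (RMem (NConst 0))) (RMem (NConst 1))"

definition Eval :: com where
  "Eval = Seq (RAssign (Scalar 3) (ROfNat (NConst 0))) (PLoop 10 (Seq
     (CLoop 20 (Seq (Dist PF) (Ite (BAnd (NLess (NConst 0) (Cell 20)) (BNot (RLess (RMem (Scalar 0)) (RMem (Scalar 6)))))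
        Skip (RAssign (Scalar 6) (RMem (Scalar 0))))))
     (AddExcess ue 6)))"

definition Search :: com where
  "Search = Loop 14 (NConst 0) (Cell 8) (NConst 1) (Seq Decode (Seq Eval
     (Ite (BAnd (NLess (NConst 0) (Cell 14)) (BNot (RLess (RMem (Scalar 3)) (RMem (Scalar 2))))) Skip
       (Seq (RAssign (Scalar 2) (RMem (Scalar 3)))
         (Loop 9 (NConst 0) (Cell 4) (NConst 1) (RAssign (slotE 3 (Cell 9)) (RMem (slotE 2 (Cell 9)))))))))"

definition Output :: com where
  "Output = Seq (Loop 9 (NConst 0) (Cell 4) (NConst 1) (RAssign (Cell 9) (RMem (slotE 3 (Cell 9)))))
     (NAssign (NConst 0) (Cell 1))"

locale search = machine +
  fixes W :: nat and S :: real and B :: "nat \<Rightarrow> nat"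
  assumes W1: "1 \<le> W" and WU: "W \<le> U" and TU: "W ^ (k * (d + 2)) \<le> U" and kdU: "k * d \<le> U"
    and B: "\<And>j. j < W \<Longrightarrow> pnt (B j)"
begin

definition glob :: "state \<Rightarrow> bool" where
  "glob s \<longleftrightarrow> base s \<and> fst s 4 = k * d \<and> fst s 7 = W \<and> fst s 8 = W ^ (k * (d + 2)) \<and> Bs s = B \<and> snd s (slot Z 0 4) = S"

lemma glob_agree:
  assumes g: "glob s" and ag: "agree X Y s s'" and X: "X \<inter> ({0, 1, 2, 3, 4, 7, 8} \<union> {100..}) = {}"
    and Y: "\<forall>y\<in>Y. Z \<le> y" "slot Z 0 4 \<notin> Y"
  shows "glob s'"
proof -
  have "base s'" by (rule base_agree[OF _ ag]) (use g X Y in \<open>auto simp: glob_def\<close>)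
  moreover have "4 \<notin> X" "7 \<notin> X" "8 \<notin> X" "\<And>j. 100 + j \<notin> X" using X by auto
  ultimately show ?thesis
    using g Y(2) by (simp add: glob_def agree_fst[OF ag] agree_snd[OF ag])
qed

lemma glob_simps [simp]:
  assumes "glob s"
  shows "fst s 4 = k * d" "fst s 7 = W" "fst s 8 = W ^ (k * (d + 2))" "fst s (100 + j) = B j" "snd s (slot Z 0 4) = S"
proof -
  from assms have a: "fst s 4 = k * d" "fst s 7 = W" "fst s 8 = W ^ (k * (d + 2))" "Bs s = B"
    "snd s (slot Z 0 4) = S" unfolding glob_def by blast+
  from a(1-3) fun_cong[OF a(4), of j] a(5)
  show "fst s 4 = k * d" "fst s 7 = W" "fst s 8 = W ^ (k * (d + 2))" "fst s (100 + j) = B j" "snd s (slot Z 0 4) = S" .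
qed

lemma glob_base [simp]: "glob s \<Longrightarrow> base s"
  unfolding glob_def by blast

lemma wp_CLoop:
  assumes init: "I 0 ((fst s)(x := 0), snd s)"
    and inv: "\<And>i s. i \<le> k \<Longrightarrow> I i s \<Longrightarrow> glob s \<and> fst s x = i * d"
    and step: "\<And>i s. i < k \<Longrightarrow> I i s \<Longrightarrow> glob s \<Longrightarrow> fst s x = i * d \<Longrightarrow>
        wp U c (\<lambda>s'. fst s' x = i * d \<and> fst s' 2 = d
           \<and> I (Suc i) ((fst s')(x := Suc i * d), snd s')) s"
    and fin: "\<And>s. I k s \<Longrightarrow> glob s \<Longrightarrow> Q s"
  shows "wp U (CLoop x c) Q s"
  unfolding CLoop_def
proof (rule wp_Loop[where m = k and a = 0 and h = d and b = "k * d" and I = I], goal_cases)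
  case (6 i s)
  then show ?case using inv[of i s] by simp
next
  case (7 i s)
  then have "glob s" "fst s x = i * d" using inv[of i s] by auto
  note st = step[OF 7(1,2) this]
  show ?case by (rule wp_mono[OF st]) (auto simp: algebra_simps)
next
  case (8 s)
  then show ?case using inv[of k s] fin by simp
qed (use kU d1 init in auto)

abbreviation "C t \<equiv> grid_center (bp B) S W d (digit W t)"

definition center_at :: "nat \<Rightarrow> state \<Rightarrow> nat \<Rightarrow> real list" where
  "center_at a s c = map (\<lambda>l. snd s (slot Z a (c * d + l))) [0..<d]"

lemma center_at_snd [simp]: "center_at a (f, snd s) = center_at a s"
  by (rule ext) (simp add: center_at_def)

definition "decode_cells = {slot Z 0 5} \<union> range (slot Z 2)"

text \<open>For \<open>n = 0\<close> the chosen address 2 lies beyond the input and the decoded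
  coordinates mean nothing. The run must still terminate in time and respect the frame, so only the
  last claim is restricted to \<open>0 < n\<close>.\<close>

lemma wp_Decode:
  assumes g: "glob s" and t: "fst s 14 = t" "t \<le> U"
  shows "wp U Decode (\<lambda>s'. agree {9, 15, 16, 17, 18, 19, 20} decode_cells s s' \<and>
     (0 < n \<longrightarrow> (\<forall>c<k. center_at 2 s' c = C t c))) s"
  unfolding Decode_def
proof (rule wp_Seq, rule wp_NAssign, rule wp_CLoop[where I = "\<lambda>i s'.
      agree {9, 15, 16, 17, 18, 19, 20} decode_cells s s' \<and> fst s' 20 = i * d \<and>
      fst s' 15 = t div W ^ (i * (d + 2)) \<and> (0 < n \<longrightarrow> (\<forall>c<i. center_at 2 s' c = C t c))"], goal_cases)
  case 1
  then show ?case using t by simp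
next
  case (2 i s')
  then have ag: "agree {9, 15, 16, 17, 18, 19, 20} decode_cells s s'" by simp
  show ?case using 2 glob_agree[OF g ag] by (auto simp: decode_cells_def)
next
  case (3 i s')
  note g' = 3(3)
  have ag: "agree {9, 15, 16, 17, 18, 19, 20} decode_cells s s'" using 3 by simp
  let ?a = "i * (d + 2)"
  have dvU: "t div x \<le> U" for x using t(2) div_le_dividend[of t x] by linarith
  have x15: "fst s' 15 = t div W ^ ?a" and old: "0 < n \<longrightarrow> (\<forall>c<i. center_at 2 s' c = C t c)"
    and x20: "fst s' 20 = i * d" using 3 by auto
  have dv: "t div W ^ e div W = t div W ^ (e + 1)" for e
    by (simp add: div_mult2_eq[symmetric] mult.commute)
  have W7: "fst s' 7 = W" using g' by simp
  show ?case
  proof (rule wp_Seq, rule wp_mono[OF wp_DivMod[OF x15 dvU W7 W1]], goal_cases)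
    case (2 s1)
    then have s1: "agree {15, 16, 17} {} s' s1" "fst s1 17 = digit W t ?a" "fst s1 15 = t div W ^ (?a + 1)"
      unfolding dv digit_def by auto
    have g1: "glob s1" by (rule glob_agree[OF g' s1(1)]) auto
    have W1': "fst s1 7 = W" using g1 by simp
    show ?case
    proof (rule wp_Seq, rule wp_mono[OF wp_DivMod[OF s1(3) dvU W1' W1]], goal_cases)
      case (2 s2)
      then have s2: "agree {15, 16, 18} {} s1 s2" "fst s2 18 = digit W t (?a + 1)"
        "fst s2 15 = t div W ^ (?a + 2)"
        unfolding dv digit_def by (auto simp: add.assoc)
      have g2: "glob s2" by (rule glob_agree[OF g1 s2(1)]) auto
      have a2: "agree {15, 16, 17, 18} {} s' s2" by (rule agree_trans[OF s1(1) s2(1)]) auto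
      have x2: "fst s2 17 = digit W t ?a" using s1(2) by (simp add: agree_fst[OF s2(1)])
      let ?j = "digit W t (?a + 1)"
      have jU: "?j \<le> U" using W1 WU mod_less_divisor[of W "t div W ^ (?a + 1)"] unfolding digit_def by linarith
      define s3 where "s3 = (fst s2, (snd s2)(slot Z 0 5 := S))"
      have g3: "glob s3" by (rule glob_agree[OF g2, of "{}" "{slot Z 0 5}"]) (auto simp: s3_def agree_def)
      have e3: "(fst s2, (snd s2)(neval (Scalar 5) s2 := reval (RMem (Scalar 4)) s2)) = s3"
        using g2 by (simp add: s3_def)
      show ?case
      proof (rule wp_Seq, rule wp_RAssign, unfold e3, rule wp_Seq,
          rule wp_Loop[where m = ?j and a = 0 and h = 1 and b = ?j and I = "\<lambda>i s'.
            agree {9} {slot Z 0 5} s3 s' \<and> fst s' 9 = i \<and> snd s' (slot Z 0 5) = S * 2 ^ i"], goal_cases)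
        case 5
        have "snd s3 (slot Z 0 5) = S" by (simp add: s3_def)
        then show ?case by simp
      next
        case (6 m s4)
        then have a4: "agree {9} {slot Z 0 5} s3 s4" by simp
        show ?case using 6 s2(2) by (simp add: agree_fst[OF a4], simp add: s3_def)
      next
        case (7 m s4)
        then have a4: "agree {9} {slot Z 0 5} s3 s4" by simp
        have "glob s4" by (rule glob_agree[OF g3 a4]) auto
        with 7 show ?case by (intro wp_RAssign) auto
      next
        case (8 s4)
        then have a4: "agree {9} {slot Z 0 5} s3 s4" "snd s4 (slot Z 0 5) = S * 2 ^ ?j" by auto
        have g4: "glob s4" by (rule glob_agree[OF g3 a4(1)]) auto
        have "agree {} {slot Z 0 5} s2 s3" by (simp add: s3_def agree_def)
        then have a4': "agree {9} {slot Z 0 5} s2 s4" by (rule agree_trans[OF _ a4(1)]) auto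
        then have a4'': "agree {9, 15, 16, 17, 18} {slot Z 0 5} s' s4" by (rule agree_trans[OF a2]) auto
        have x4: "fst s4 17 = digit W t ?a" "fst s4 15 = t div W ^ (?a + 2)"
          using x2 s2(3) by (simp_all add: agree_fst[OF a4'])
        have x420: "fst s4 20 = i * d" using x20 by (simp add: agree_fst[OF a4''])
        show ?case
        proof (rule wp_Loop[where m = d and a = 0 and h = 1 and b = d and I = "\<lambda>l s5.
            agree {9, 15, 16, 19} (slot Z 2 ` {i * d..}) s4 s5 \<and> fst s5 19 = l \<and> fst s5 15 = t div W ^ (?a + 2 + l) \<and>
            (0 < n \<longrightarrow> (\<forall>l'<l. snd s5 (slot Z 2 (i * d + l')) = C t i ! l'))"], goal_cases)
          case 5
          then show ?case using x4 by simp
        next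
          case (6 l s5)
          then have a5: "agree {9, 15, 16, 19} (slot Z 2 ` {i * d..}) s4 s5" by simp
          have "glob s5" by (rule glob_agree[OF g4 a5]) auto
          then show ?case using 6 by simp
        next
          case (7 l s5)
          then have a5: "agree {9, 15, 16, 19} (slot Z 2 ` {i * d..}) s4 s5"
            and x5: "fst s5 15 = t div W ^ (?a + 2 + l)" by auto
          have g5: "glob s5" by (rule glob_agree[OF g4 a5]) auto
          have W5: "fst s5 7 = W" using g5 by simp
          show ?case
          proof (rule wp_Seq, rule wp_mono[OF wp_DivMod[OF x5 dvU W5 W1]], goal_cases)
            case (2 s6)
            then have s6: "agree {15, 16, 9} {} s5 s6" "fst s6 9 = digit W t (?a + 2 + l)"
              "fst s6 15 = t div W ^ (?a + 2 + Suc l)"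
              unfolding dv digit_def by (auto simp: add.assoc)
            have g6: "glob s6" by (rule glob_agree[OF g5 s6(1)]) auto
            have x6: "fst s6 19 = l" "fst s6 20 = i * d" "fst s6 17 = digit W t ?a"
              using 7 x420 x4 by (auto simp: agree_fst[OF s6(1)] agree_fst[OF a5])
            have r6: "snd s6 (slot Z 0 5) = S * 2 ^ ?j"
              using a4(2) by (auto simp: agree_snd[OF s6(1)] agree_snd[OF a5] image_iff)
            have old6: "0 < n \<longrightarrow> (\<forall>l'<l. snd s6 (slot Z 2 (i * d + l')) = C t i ! l')"
              using 7 by (auto simp: agree_snd[OF s6(1)])
            have a6: "agree {9, 15, 16, 19} (slot Z 2 ` {i * d..}) s4 s6"
              by (rule agree_trans[OF a5 s6(1)]) auto
            have pn: "pnt (B (digit W t ?a))" using B W1 by (simp add: digit_def)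
            have rd: "snd s6 (B (digit W t ?a) + l) = bp B (digit W t ?a) ! l" if "0 < n"
            proof -
              have "B (digit W t ?a) + l < Z" using pnt_le[OF pn that] 7(1) by linarith
              then show ?thesis using glob_base[OF g6] 7(1) by (simp add: bp_def pt_def)
            qed
            have Cl: "C t i ! l = bp B (digit W t ?a) ! l + S * 2 ^ ?j * (2 * real (digit W t (?a + 2 + l)) / real W - 1)"
              using 7(1) by (simp add: grid_center_def)
            show ?case
              using g6 x6 r6 old6 a6 s6(2,3) rd
              by (intro wp_RAssign) (auto simp: less_Suc_eq Cl)
          qed auto
        next
          case (8 s5)
          then have a5: "agree {9, 15, 16, 19} (slot Z 2 ` {i * d..}) s4 s5" by simp
          have g5: "glob s5" by (rule glob_agree[OF g4 a5]) auto
          have a5': "agree {9, 15, 16, 17, 18, 19, 20} decode_cells s' s5"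
            by (rule agree_trans[OF a4'' a5]) (auto simp: decode_cells_def)
          have ag5: "agree {9, 15, 16, 17, 18, 19, 20} decode_cells s s5"
            by (rule agree_trans[OF ag a5']) auto
          \<comment> \<open>The coordinate loop writes only at indices from \<open>i * d\<close> on,
            behind all centers decoded before.\<close>
          have oldc: "center_at 2 s5 c = center_at 2 s' c" if c: "c < i" for c
          proof -
            have "(c + 1) * d \<le> i * d" using c by (intro mult_le_mono1) simp
            then have "\<not> i * d \<le> c * d + l" if "l < d" for l using that by simp
            then show ?thesis
              unfolding center_at_def by (auto simp: agree_snd[OF a5] agree_snd[OF a4''] image_iff)
          qed
          have newc: "center_at 2 s5 i = C t i" if "0 < n"
            using 8 that by (intro nth_equalityI) (auto simp: center_at_def grid_center_def)
          have f15: "fst s5 15 = t div W ^ (Suc i * (d + 2))" using 8 by (simp add: algebra_simps)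
          have "fst s5 20 = i * d" using x420 by (simp add: agree_fst[OF a5])
          then show ?case using ag5 oldc newc old g5 f15
            by (auto simp: less_Suc_eq)
        qed (use dU g4 in auto)
      qed (use jU in auto)
    qed auto
  qed auto
next
  case (4 s')
  then show ?case by simp
qed


text \<open>When the loop over the centers starts, \<open>Scalar 6\<close> contains an unrelated
  value. Center 0 therefore overwrites it unconditionally, and the invariant speaks about it only
  for \<open>0 < c\<close>.\<close>

lemma wp_Eval:
  assumes g: "glob s"
  shows "wp U Eval (\<lambda>s'. agree {9, 10, 20} {slot Z 0 0, slot Z 0 3, slot Z 0 6} s s' \<and>
     snd s' (slot Z 0 3) = cost2 ((1 + eps) * r) P (center_at 2 s ` {..<k})) s"
proof -
  let ?X = "{9, 10, 20} :: nat set"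
  let ?Y = "{slot Z 0 0, slot Z 0 3, slot Z 0 6}"
  have gl: "glob s'" if "agree ?X ?Y s s'" for s' by (rule glob_agree[OF g that]) auto
  have fpe: "center_at 2 s' = center_at 2 s" if "agree ?X ?Y s s'" for s'
    by (rule ext) (simp add: center_at_def agree_snd[OF that])
  show ?thesis unfolding Eval_def
  proof (rule wp_Seq, rule wp_RAssign, rule wp_PLoop[where I = "\<lambda>i s'. agree ?X ?Y s s' \<and> fst s' 10 = padr i \<and>
      snd s' (slot Z 0 3) = (\<Sum>j<i. excess ((1 + eps) * r) (sdist (pt (padr j)) (center_at 2 s ` {..<k})))"], goal_cases)
    case 1
    then show ?case using g by (simp add: padr_def)
  next
    case (2 i s')
    then show ?case using gl[of s'] by simp
  next
    case (3 i s')
    then have ag: "agree ?X ?Y s s'" by simp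
    show ?case
    proof (rule wp_Seq, rule wp_CLoop[where I = "\<lambda>c s2. agree {9, 20} {slot Z 0 0, slot Z 0 6} s' s2 \<and> fst s2 20 = c * d \<and>
        (0 < c \<longrightarrow> snd s2 (slot Z 0 6) = sdist (pt (padr i)) (center_at 2 s ` {..<c}))"], goal_cases)
      case 1
      then show ?case by simp
    next
      case (2 c s2)
      then have a2: "agree {9, 20} {slot Z 0 0, slot Z 0 6} s' s2" by simp
      show ?case using 2 glob_agree[OF gl[OF ag] a2] by auto
    next
      case (3 c s2)
      note g2 = 3(3)
      have a2: "agree {9, 20} {slot Z 0 0, slot Z 0 6} s' s2" using 3 by simp
      have x2: "fst s2 10 = padr i" using \<open>fst s' 10 = padr i\<close> by (simp add: agree_fst[OF a2])
      have pz: "padr i + d \<le> Z" using padr_le \<open>i < n\<close> by simp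
      have ev: "reval PF s3 = R0 (padr i + l) - snd s (slot Z 2 (c * d + l))"
        if l: "l < d" and a3: "agree {9} {slot Z 0 0} s2 s3" and x9: "fst s3 9 = l" for l s3
      proof -
        have "glob s3" by (rule glob_agree[OF g2 a3]) auto
        moreover have "fst s3 10 = padr i" "fst s3 20 = c * d"
          using x2 3 by (auto simp: agree_fst[OF a3])
        moreover have "snd s3 (slot Z 2 (c * d + l)) = snd s (slot Z 2 (c * d + l))"
          by (simp add: agree_snd[OF a3] agree_snd[OF a2] agree_snd[OF ag])
        ultimately show ?thesis using x9 l pz by (simp add: PF_def)
      qed
      have pd: "pdist (pt (padr i)) (center_at 2 s c) = L2_set (\<lambda>l. R0 (padr i + l) - snd s (slot Z 2 (c * d + l))) {..<d}"
        unfolding pdist_def by (intro L2_set_cong) (auto simp: pt_def center_at_def)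
      have dU': "d \<le> U" using dU by simp
      have e2: "fst s2 2 = d" "fst s2 3 = Z" using glob_base[OF g2] by simp_all
      show ?case
      proof (rule wp_Seq, rule wp_mono[OF wp_Dist[OF dU' e2 ev]], assumption, assumption, assumption, fold pd, goal_cases)
        case (1 s3)
        then have a3: "agree {9} {slot Z 0 0} s2 s3" and v3: "snd s3 (slot Z 0 0) = pdist (pt (padr i)) (center_at 2 s c)" by auto
        have g3: "glob s3" by (rule glob_agree[OF g2 a3]) auto
        have a3': "agree {9, 20} {slot Z 0 0, slot Z 0 6} s' s3" by (rule agree_trans[OF a2 a3]) auto
        have x3: "fst s3 20 = c * d" using 3 by (simp add: agree_fst[OF a3])
        have o3: "0 < c \<longrightarrow> snd s3 (slot Z 0 6) = sdist (pt (padr i)) (center_at 2 s ` {..<c})"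
          using 3 by (simp add: agree_snd[OF a3])
        have "sdist (pt (padr i)) (center_at 2 s ` {..<Suc c}) = (if c = 0 then pdist (pt (padr i)) (center_at 2 s c)
           else min (pdist (pt (padr i)) (center_at 2 s c)) (sdist (pt (padr i)) (center_at 2 s ` {..<c})))"
          by (cases "c = 0") (simp_all add: lessThan_Suc sdist_insert lessThan_empty_iff)
        then show ?case using g3 a3' x3 o3 v3 d1
          by (intro wp_Ite wp_Skip wp_RAssign) (auto simp: min_def)
      qed
    next
      case (4 s2)
      then have a2: "agree {9, 20} {slot Z 0 0, slot Z 0 6} s' s2"
        and v2: "snd s2 (slot Z 0 6) = sdist (pt (padr i)) (center_at 2 s ` {..<k})" using k1 by auto
      have g2: "glob s2" by (rule 4)
      have a2': "agree ?X ?Y s s2" by (rule agree_trans[OF ag a2]) auto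
      have "fst s2 10 = padr i" "snd s2 (slot Z 0 3) = (\<Sum>j<i. excess ((1 + eps) * r) (sdist (pt (padr j)) (center_at 2 s ` {..<k})))"
        using 3 by (simp_all add: agree_fst[OF a2] agree_snd[OF a2])
      with g2 a2' v2 show ?case by (intro wp_AddExcess) auto
    qed
  next
    case (4 s')
    then show ?case by (auto simp: cost2_P)
  qed
qed

text \<open>The result is stated for array 3 because the next candidate overwrites array 2.
  \<open>Scalar 2\<close> is left over from the greedy phase, so candidate 0 is accepted without
  comparison.\<close>

lemma wp_Search:
  assumes g: "glob s"
  shows "wp U Search (\<lambda>s'. glob s' \<and>
     (0 < n \<longrightarrow> (\<forall>t<W ^ (k * (d + 2)). cost2 ((1 + eps) * r) P (center_at 3 s' ` {..<k})
        \<le> cost2 ((1 + eps) * r) P (C t ` {..<k})))) s"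
proof -
  let ?c = "cost2 ((1 + eps) * r) P"
  let ?T = "W ^ (k * (d + 2))"
  have T1: "0 < ?T" using W1 by simp
  show ?thesis unfolding Search_def
  proof (rule wp_Loop[where m = ?T and a = 0 and h = 1 and b = ?T and I = "\<lambda>i s'. glob s' \<and> fst s' 14 = i \<and>
      (0 < i \<longrightarrow> snd s' (slot Z 0 2) = ?c (center_at 3 s' ` {..<k})) \<and>
      (0 < n \<longrightarrow> (\<forall>t<i. snd s' (slot Z 0 2) \<le> ?c (C t ` {..<k})))"], goal_cases)
    case 5
    have "agree {14} {} s ((fst s)(14 := 0), snd s)" by simp
    then have "glob ((fst s)(14 := 0), snd s)" by (rule glob_agree[OF g]) auto
    then show ?case by simp
  next
    case (6 i s')
    then show ?case by simp
  next
    case (7 i s')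
    then have g': "glob s'" and x: "fst s' 14 = i" by auto
    have iU: "i \<le> U" using 7(1) TU by linarith
    show ?case
    proof (rule wp_Seq, rule wp_mono[OF wp_Decode[OF g' x iU]], goal_cases)
      case (1 s1)
      then have a1: "agree {9, 15, 16, 17, 18, 19, 20} decode_cells s' s1" by simp
      have g1: "glob s1" by (rule glob_agree[OF g' a1]) (auto simp: decode_cells_def)
      have F1: "center_at 2 s1 ` {..<k} = C i ` {..<k}" if "0 < n"
        using 1 that by (intro image_cong) auto
      show ?case
      proof (rule wp_Seq, rule wp_mono[OF wp_Eval[OF g1]], goal_cases)
        case (1 s2)
        then have a2: "agree {9, 10, 20} {slot Z 0 0, slot Z 0 3, slot Z 0 6} s1 s2"
          and v2: "snd s2 (slot Z 0 3) = ?c (center_at 2 s1 ` {..<k})" by auto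
        have g2: "glob s2" by (rule glob_agree[OF g1 a2]) auto
        have f2: "center_at 2 s2 = center_at 2 s1" by (rule ext) (simp add: center_at_def agree_snd[OF a2])
        have f3: "center_at 3 s2 = center_at 3 s'" by (rule ext) (simp add: center_at_def agree_snd[OF a2] agree_snd[OF a1] decode_cells_def)
        have x2: "fst s2 14 = i" using x by (simp add: agree_fst[OF a2] agree_fst[OF a1])
        have b2: "snd s2 (slot Z 0 2) = snd s' (slot Z 0 2)" by (simp add: agree_snd[OF a2] agree_snd[OF a1] decode_cells_def)
        have o2: "0 < i \<longrightarrow> snd s2 (slot Z 0 2) = ?c (center_at 3 s2 ` {..<k})"
          "0 < n \<Longrightarrow> t < i \<Longrightarrow> snd s2 (slot Z 0 2) \<le> ?c (C t ` {..<k})" for t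
          using 7 by (auto simp: b2 f3)
        have gupd: "glob ((fst s3)(14 := v), snd s3)" if "glob s3" for s3 v
          by (rule glob_agree[OF that, of "{14}" "{}"]) auto
        show ?case
        proof (rule wp_Ite, goal_cases)
          case 1
          then have c: "0 < i" "snd s2 (slot Z 0 2) \<le> ?c (center_at 2 s1 ` {..<k})" using g2 x2 v2 by auto
          have "snd s2 (slot Z 0 2) \<le> ?c (C t ` {..<k})" if "t < Suc i" "0 < n" for t
            using o2(2)[of t] c(2) F1 that by (cases "t = i") auto
          then show ?case using c(1) g2 gupd[OF g2] o2(1) x2 by (intro wp_Skip) auto
        next
          case 2
          then have c: "0 < i \<Longrightarrow> ?c (center_at 2 s1 ` {..<k}) \<le> snd s2 (slot Z 0 2)" using g2 x2 v2 by auto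
          have best: "?c (center_at 2 s1 ` {..<k}) \<le> ?c (C t ` {..<k})" if "t < Suc i" "0 < n" for t
            using o2(2)[of t] c F1 that by (cases "t = i") auto
          define s3 where "s3 = (fst s2, (snd s2)(slot Z 0 2 := ?c (center_at 2 s1 ` {..<k})))"
          have e3: "(fst s2, (snd s2)(neval (Scalar 2) s2 := reval (RMem (Scalar 3)) s2)) = s3"
            using g2 v2 by (simp add: s3_def)
          have a3: "agree {} {slot Z 0 2} s2 s3" by (simp add: s3_def agree_def)
          have g3: "glob s3" by (rule glob_agree[OF g2 a3]) auto
          have v3: "snd s3 (slot Z 0 2) = ?c (center_at 2 s1 ` {..<k})" by (simp add: s3_def)
          show ?case
          proof (rule wp_Seq, rule wp_RAssign, unfold e3,
              rule wp_Loop[where m = "k * d" and a = 0 and h = 1 and b = "k * d" and I = "\<lambda>l s4.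
                agree {9} (range (slot Z 3)) s3 s4 \<and> fst s4 9 = l \<and>
                (\<forall>m<l. snd s4 (slot Z 3 m) = snd s3 (slot Z 2 m))"], goal_cases)
            case 5
            then show ?case by simp
          next
            case (6 l s4)
            then have a4: "agree {9} (range (slot Z 3)) s3 s4" by simp
            have "glob s4" by (rule glob_agree[OF g3 a4]) auto
            then show ?case using 6 by simp
          next
            case (7 l s4)
            then have a4: "agree {9} (range (slot Z 3)) s3 s4" by simp
            have "glob s4" by (rule glob_agree[OF g3 a4]) auto
            moreover have "snd s4 (slot Z 2 l) = snd s3 (slot Z 2 l)" by (simp add: agree_snd[OF a4])
            ultimately show ?case using 7 by (intro wp_RAssign) (auto simp: less_Suc_eq)
          next
            case (8 s4)
            then have a4: "agree {9} (range (slot Z 3)) s3 s4" by simp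
            have g4: "glob s4" by (rule glob_agree[OF g3 a4]) auto
            have "center_at 3 s4 c = center_at 2 s1 c" if c: "c < k" for c
            proof -
              have "(c + 1) * d \<le> k * d" using c by (intro mult_le_mono1) simp
              then have "c * d + l < k * d" if "l < d" for l using that by simp
              then have "center_at 3 s4 c = center_at 2 s3 c" using 8 unfolding center_at_def by auto
              also have "\<dots> = center_at 2 s2 c" by (simp add: center_at_def agree_snd[OF a3])
              finally show ?thesis by (simp add: f2)
            qed
            then have "center_at 3 s4 ` {..<k} = center_at 2 s1 ` {..<k}" by (intro image_cong) auto
            moreover have "snd s4 (slot Z 0 2) = ?c (center_at 2 s1 ` {..<k})" using v3 by (simp add: agree_snd[OF a4])
            moreover have "fst s4 14 = i" using x2 by (simp add: agree_fst[OF a4] agree_fst[OF a3])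
            ultimately show ?case using g4 gupd[OF g4] best by auto
          qed (use kdU in auto)
        qed
      qed
    qed
  next
    case (8 s')
    then have e: "snd s' (slot Z 0 2) = ?c (center_at 3 s' ` {..<k})" using T1 by blast
    from 8 show ?case unfolding e by blast
  qed (use TU g in auto)
qed

text \<open>
  The output may overwrite the array it is copied from, but only behind the copying position,
  since the slot of index \<open>l\<close> has an address above \<open>l\<close>.
\<close>

lemma wp_Output:
  assumes g: "glob s"
  shows "wp U Output (\<lambda>s'. output_set d s' = center_at 3 s ` {..<k}) s"
  unfolding Output_def
proof (rule wp_Seq, rule wp_Loop[where m = "k * d" and a = 0 and h = 1 and b = "k * d" and I = "\<lambda>l s'.
     agree {9} {..<l} s s' \<and> fst s' 9 = l \<and> (\<forall>m<l. snd s' m = snd s (slot Z 3 m))"], goal_cases)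
  case 5
  then show ?case by simp
next
  case (6 l s')
  then have a: "agree {9} {..<l} s s'" by simp
  have "fst s' 4 = fst s 4" by (simp add: agree_fst[OF a])
  with 6 show ?case using g by simp
next
  case (7 l s')
  then have a: "agree {9} {..<l} s s'" by simp
  have "fst s' 3 = fst s 3" by (simp add: agree_fst[OF a])
  then have "fst s' 3 = Z" using glob_base[OF g] by simp
  moreover have "snd s' (slot Z 3 l) = snd s (slot Z 3 l)"
    by (rule agree_snd[OF a]) (simp add: slot_def)
  ultimately show ?case using 7 by (intro wp_RAssign) (auto simp: agree_def less_Suc_eq)
next
  case (8 s')
  then have a: "agree {9} {..<k * d} s s'" by simp
  have k': "fst s' 1 = k" using glob_base[OF g] by (simp add: agree_fst[OF a])
  have "c * d + l < k * d" if "c < k" "l < d" for c l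
  proof -
    have "(c + 1) * d \<le> k * d" using that by (intro mult_le_mono1) simp
    then show ?thesis using that by simp
  qed
  then have "map (\<lambda>j. snd s' (c * d + j)) [0..<d] = center_at 3 s c" if "c < k" for c
    using 8 that unfolding center_at_def by auto
  then show ?case using k' by (intro wp_NAssign) (auto simp: output_set_def)
qed (use kdU in auto)

end

section \<open>Computing the parameters, and correctness of the whole algorithm\<close>

definition log2_up :: "nat \<Rightarrow> nat" where
  "log2_up n = (LEAST L. n \<le> 2 ^ L)"

lemma log2_up_le: "n \<le> 2 ^ log2_up n"
  unfolding log2_up_def by (rule LeastI[of _ n]) (simp add: less_imp_le)

lemma log2_up_less: "i < log2_up n \<Longrightarrow> 2 ^ i < n"
  unfolding log2_up_def using not_less_Least not_le by blast

lemma log2_up_bound: "2 ^ log2_up n \<le> 2 * max 1 n"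
proof (cases "log2_up n")
  case (Suc i)
  then show ?thesis using log2_up_less[of i n] by simp
qed simp

definition Wexp :: rexp where
  "Wexp = RDiv (RMul (RMul (RMul (ROfNat (NConst 400)) (ROfNat (Cell 1))) (ROfNat (Cell 2)))
     (RAdd (ROfNat (Cell 5)) (ROfNat (NConst 3)))) (RMem (NConst 0))"

text \<open>Reals cannot be rounded, so \<open>W\<close> is found by counting upwards until
  \<open>Wexp\<close> is reached. The products \<open>n * d\<close>, \<open>k * d\<close> and the
  power of \<open>W\<close> are built by repeated addition, and the binary logarithm by
  doubling.\<close>

definition Setup :: com where
  "Setup = Seq (NAssign (NConst 3) (NConst 2))
    (Seq (Loop 9 (NConst 0) (Cell 0) (NConst 1) (NAssign (NConst 3) (NAdd (Cell 3) (Cell 2))))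
    (Seq (Loop 9 (NConst 0) (Cell 1) (NConst 1) (NAssign (NConst 4) (NAdd (Cell 4) (Cell 2))))
    (Seq (NAssign (NConst 6) (NConst 1))
    (Seq (While (NLess (Cell 6) (Cell 0))
       (Seq (NAssign (NConst 6) (NAdd (Cell 6) (Cell 6))) (NAssign (NConst 5) (NAdd (Cell 5) (NConst 1)))))
    (Seq (While (RLess (ROfNat (Cell 7)) Wexp) (NAssign (NConst 7) (NAdd (Cell 7) (NConst 1))))
    (Seq (NAssign (NConst 8) (NConst 1))
      (Loop 9 (NConst 0) (Cell 1) (NConst 1) (Loop 10 (NConst 0) (NAdd (Cell 2) (NConst 2)) (NConst 1)
        (Seq (NAssign (NConst 6) (NConst 0))
        (Seq (Loop 11 (NConst 0) (Cell 7) (NConst 1) (NAssign (NConst 6) (NAdd (Cell 6) (Cell 8))))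
           (NAssign (NConst 8) (Cell 6))))))))))))"

definition Alg :: com where
  "Alg = Seq Setup (Seq Build
     (Seq (RAssign (Scalar 4) (RAdd (RMem (NConst 1)) (RDiv (RMem (Scalar 1)) (ROfNat (Cell 0)))))
       (Seq Search Output)))"

context machine
begin

definition Wd :: nat where
  "Wd = nat \<lceil>400 * real k * real d * (real (log2_up n) + 3) / eps\<rceil>"

definition setup_state :: "nat \<Rightarrow> nat \<Rightarrow> nat \<Rightarrow> nat \<Rightarrow> state \<Rightarrow> bool" where
  "setup_state z a l w s \<longleftrightarrow> snd s = R0 \<and> fst s 0 = n \<and> fst s 1 = k \<and> fst s 2 = d \<and> fst s 3 = z \<and> fst s 4 = a \<and>
     fst s 5 = l \<and> fst s 7 = w"

lemma wp_Setup:
  assumes s: "snd s = R0" "fst s = (\<lambda>_. 0)(0 := n, 1 := k, 2 := d)"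
    and U: "log2_up n \<le> U" "Wd \<le> U"
  shows "wp U Setup (\<lambda>s'. base s' \<and> fst s' 4 = k * d \<and> fst s' 7 = Wd \<and> fst s' 8 = Wd ^ (k * (d + 2))) s"
  unfolding Setup_def
proof (rule wp_Seq, rule wp_NAssign, rule wp_Seq,
    rule wp_Loop[where m = n and a = 0 and h = 1 and b = n and
      I = "\<lambda>i s. setup_state (2 + i * d) 0 0 0 s \<and> fst s 9 = i"], goal_cases)
  case 5
  then show ?case using s by (simp add: setup_state_def)
next
  case (7 i s)
  then show ?case by (intro wp_NAssign) (simp add: setup_state_def)
next
  case (8 s)
  show ?case
  proof (rule wp_Seq, rule wp_Loop[where m = k and a = 0 and h = 1 and b = k and
      I = "\<lambda>i s. setup_state Z (i * d) 0 0 s \<and> fst s 9 = i"], goal_cases)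
    case 5
    then show ?case using 8 by (simp add: setup_state_def Z_def)
  next
    case (7 i s)
    then show ?case by (intro wp_NAssign) (simp add: setup_state_def)
  next
    case (8 s)
    show ?case
    proof (rule wp_Seq, rule wp_NAssign, rule wp_Seq, rule wp_While[where m = "log2_up n" and
        I = "\<lambda>i s. setup_state Z (k * d) i 0 s \<and> fst s 6 = 2 ^ i"], goal_cases)
      case 2
      then show ?case using 8 by (simp add: setup_state_def)
    next
      case (3 i s)
      then have "beval (NLess (Cell 6) (Cell 0)) s" using log2_up_less[of i n] by (simp add: setup_state_def)
      moreover have "wp U (Seq (NAssign (NConst 6) (NAdd (Cell 6) (Cell 6))) (NAssign (NConst 5) (NAdd (Cell 5) (NConst 1))))
          (\<lambda>s. setup_state Z (k * d) (Suc i) 0 s \<and> fst s 6 = 2 ^ Suc i) s"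
        using 3 by (intro wp_Seq wp_NAssign) (simp add: setup_state_def)
      ultimately show ?case by blast
    next
      case (4 s)
      let ?E = "400 * real k * real d * (real (log2_up n) + 3) / eps"
      have W: "reval Wexp s = ?E" if "setup_state Z (k * d) (log2_up n) w s" for w s
        using that by (simp add: Wexp_def setup_state_def)
      have "\<not> beval (NLess (Cell 6) (Cell 0)) s" using 4 log2_up_le[of n] by (simp add: setup_state_def not_less)
      moreover have "wp U (Seq (While (RLess (ROfNat (Cell 7)) Wexp) (NAssign (NConst 7) (NAdd (Cell 7) (NConst 1))))
        (Seq (NAssign (NConst 8) (NConst 1))
          (Loop 9 (NConst 0) (Cell 1) (NConst 1) (Loop 10 (NConst 0) (NAdd (Cell 2) (NConst 2)) (NConst 1)
            (Seq (NAssign (NConst 6) (NConst 0))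
            (Seq (Loop 11 (NConst 0) (Cell 7) (NConst 1) (NAssign (NConst 6) (NAdd (Cell 6) (Cell 8))))
               (NAssign (NConst 8) (Cell 6)))))))) (\<lambda>s'. base s' \<and> fst s' 4 = k * d \<and> fst s' 7 = Wd \<and> fst s' 8 = Wd ^ (k * (d + 2))) s"
      proof (rule wp_Seq, rule wp_While[where m = Wd and I = "\<lambda>i s. setup_state Z (k * d) (log2_up n) i s"], goal_cases)
        case 2
        then show ?case using 4 by simp
      next
        case (3 i s)
        then have "real i < ?E" unfolding Wd_def by linarith
        then have "beval (RLess (ROfNat (Cell 7)) Wexp) s" using 3 W[of i s] by (simp add: setup_state_def)
        moreover have "wp U (NAssign (NConst 7) (NAdd (Cell 7) (NConst 1))) (setup_state Z (k * d) (log2_up n) (Suc i)) s"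
          using 3 by (intro wp_NAssign) (simp add: setup_state_def)
        ultimately show ?case by blast
      next
        case (4 s)
        have "?E \<le> real Wd" unfolding Wd_def by linarith
        then have "\<not> beval (RLess (ROfNat (Cell 7)) Wexp) s" using 4 W[of Wd s] by (simp add: setup_state_def)
        moreover have "wp U (Seq (NAssign (NConst 8) (NConst 1))
          (Loop 9 (NConst 0) (Cell 1) (NConst 1) (Loop 10 (NConst 0) (NAdd (Cell 2) (NConst 2)) (NConst 1)
            (Seq (NAssign (NConst 6) (NConst 0))
            (Seq (Loop 11 (NConst 0) (Cell 7) (NConst 1) (NAssign (NConst 6) (NAdd (Cell 6) (Cell 8))))
               (NAssign (NConst 8) (Cell 6))))))) (\<lambda>s'. base s' \<and> fst s' 4 = k * d \<and> fst s' 7 = Wd \<and> fst s' 8 = Wd ^ (k * (d + 2))) s"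
        proof (rule wp_Seq, rule wp_NAssign, rule wp_Loop[where m = k and a = 0 and h = 1 and b = k and
            I = "\<lambda>i s. setup_state Z (k * d) (log2_up n) Wd s \<and> fst s 9 = i \<and> fst s 8 = Wd ^ (i * (d + 2))"], goal_cases)
          case 5
          then show ?case using 4 by (simp add: setup_state_def)
        next
          case (7 i s)
          show ?case
          proof (rule wp_Loop[where m = "d + 2" and a = 0 and h = 1 and b = "d + 2" and
              I = "\<lambda>j s. setup_state Z (k * d) (log2_up n) Wd s \<and> fst s 9 = i \<and> fst s 10 = j \<and> fst s 8 = Wd ^ (i * (d + 2) + j)"], goal_cases)
            case 5
            then show ?case using 7 by (simp add: setup_state_def)
          next
            case (7 j s)
            show ?case
            proof (rule wp_Seq, rule wp_NAssign, rule wp_Seq,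
                rule wp_Loop[where m = Wd and a = 0 and h = 1 and b = Wd and
                  I = "\<lambda>m s. setup_state Z (k * d) (log2_up n) Wd s \<and> fst s 9 = i \<and> fst s 10 = j \<and> fst s 11 = m \<and>
                    fst s 8 = Wd ^ (i * (d + 2) + j) \<and> fst s 6 = m * Wd ^ (i * (d + 2) + j)"], goal_cases)
              case 5
              then show ?case using 7 by (simp add: setup_state_def)
            next
              case (7 m s)
              then show ?case by (intro wp_NAssign) (simp add: setup_state_def)
            next
              case (8 s)
              then show ?case by (intro wp_NAssign) (simp add: setup_state_def)
            qed (use U in \<open>auto simp: setup_state_def\<close>)
          next
            case (8 s)
            then show ?case by (simp add: setup_state_def algebra_simps)
          qed (use dU in \<open>auto simp: setup_state_def\<close>)
        next
          case (8 s)
          then show ?case unfolding setup_state_def base_def by simp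
        qed (use kU in \<open>auto simp: setup_state_def\<close>)
        ultimately show ?case by blast
      qed (use U in auto)
      ultimately show ?case by blast
    qed (use U in auto)
  qed (use kU in \<open>auto simp: setup_state_def\<close>)
qed (use nU in \<open>auto simp: setup_state_def\<close>)

end

text \<open>Only the first \<open>k * (d + 2)\<close> digits matter. This passes from the
  unrestricted digit function of \<open>candidates_good\<close> to the digits of one of the
  enumerated numbers.\<close>

lemma grid_center_cong:
  assumes "\<And>i. i < k * (d + 2) \<Longrightarrow> g i = g' i" "c < k"
  shows "grid_center b S W d g c = grid_center b S W d g' c"
proof -
  have "(c + 1) * (d + 2) \<le> k * (d + 2)" using assms(2) by (intro mult_le_mono1) simp
  then have *: "c * (d + 2) + e < k * (d + 2)" if "e < d + 2" for e using that by simp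
  have "g (c * (d + 2)) = g' (c * (d + 2))" "g (c * (d + 2) + 1) = g' (c * (d + 2) + 1)"
    using assms(1)[OF *[of 0]] assms(1)[OF *[of 1]] by simp_all
  moreover have "g (c * (d + 2) + 2 + l) = g' (c * (d + 2) + 2 + l)" if "l < d" for l
    using assms(1)[OF *[of "2 + l"]] that by (simp add: add.assoc)
  ultimately show ?thesis unfolding grid_center_def by (intro map_cong) (auto simp del: mult_Suc_right add_2_eq_Suc')
qed

lemma (in machine) wp_Alg:
  assumes s: "snd s = R0" "fst s = (\<lambda>_. 0)(0 := n, 1 := k, 2 := d)"
    and U: "log2_up n \<le> U" "Wd \<le> U" "Wd ^ (k * (d + 2)) \<le> U" "k * d \<le> U"
    and eps: "0 < eps" "eps < 1" and r: "0 \<le> r"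
  shows "wp U Alg (\<lambda>s'. output_set d s' \<in> solutions d k \<and>
     (\<forall>F\<in>solutions d k. cost2 ((1 + eps) * r) P (output_set d s') \<le> (1 + eps) * cost2 r P F)) s"
proof -
  have WE: "400 * real k * real d * (real (log2_up n) + 3) / eps \<le> real Wd"
    unfolding Wd_def by linarith
  \<comment> \<open>\<open>Build\<close> needs room for the traversal points even when there is no
    input point, so this bound cannot be taken from \<open>candidates_good\<close>.\<close>
  have kW: "k + 1 \<le> Wd"
  proof -
    have "1 \<le> real d / eps" using d1 eps by (simp add: field_simps)
    then have "1 * 3 \<le> (real d / eps) * (real (log2_up n) + 3)" by (intro mult_mono) auto
    then have "real k * 3 \<le> real k * ((real d / eps) * (real (log2_up n) + 3))"
      by (intro mult_left_mono) auto
    also have "400 * \<dots> \<le> real Wd" using WE by (simp add: field_simps)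
    finally show ?thesis using k1 by linarith
  qed
  show ?thesis unfolding Alg_def
  proof (rule wp_Seq, rule wp_mono[OF wp_Setup[OF s U(1,2)]], goal_cases)
    case (1 s1)
    then have b1: "base s1" and W1: "fst s1 7 = Wd" by auto
    show ?case
    proof (rule wp_Seq, rule wp_mono[OF wp_Build[OF b1 W1 kW U(2)]], goal_cases)
      case (1 s2)
      let ?X = "{9, 10, 11, 12, 13} \<union> {100..} :: nat set"
      let ?Y = "{slot Z 0 0, slot Z 0 1, slot Z 0 2, slot Z 0 3} \<union> range (slot Z 1)"
      from 1 have a2: "agree ?X ?Y s1 s2" and B2: "\<forall>j<Wd. pnt (Bs s2 j)"
        and far2: "farB (Bs s2) Wd" and gr2: "grB (Bs s2) Wd"
        and M2: "0 < n \<longrightarrow> snd s2 (slot Z 0 1) = sdist (bp (Bs s2) k) (bp (Bs s2) ` {..<k})" by auto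
      have b2: "base s2" by (rule base_agree[OF b1 a2]) auto
      define M where "M = snd s2 (slot Z 0 1)"
      define S where "S = r + M / real n"
      define B where "B = Bs s2"
      define s3 where "s3 = (fst s2, (snd s2)(slot Z 0 4 := S))"
      have e3: "(fst s2, (snd s2)(neval (Scalar 4) s2 := reval (RAdd (RMem (NConst 1)) (RDiv (RMem (Scalar 1)) (ROfNat (Cell 0)))) s2)) = s3"
        using b2 by (simp add: s3_def S_def M_def)
      interpret search U n k d R0 Wd S B
        by unfold_locales (use kW U B2 in \<open>auto simp: B_def\<close>)
      have "fst s2 4 = k * d" "fst s2 7 = Wd" "fst s2 8 = Wd ^ (k * (d + 2))"
        using \<open>base s1 \<and> _\<close> by (simp_all add: agree_fst[OF a2])
      moreover have "base s3" using b2 by (simp add: s3_def)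
      ultimately have g3: "glob s3" unfolding glob_def by (simp add: s3_def B_def)
      show ?case
      proof (rule wp_Seq, rule wp_RAssign, unfold e3, rule wp_Seq, rule wp_mono[OF wp_Search[OF g3]],
          elim conjE, rule wp_mono[OF wp_Output], assumption, goal_cases)
        case (1 s4 s5)
        let ?F = "center_at 3 s4 ` {..<k}"
        \<comment> \<open>This holds whatever the memory contains: the output consists of vectors of
          length \<open>d\<close>, at least one and at most \<open>k\<close> different ones.\<close>
        have sol: "?F \<in> solutions d k"
          using k1 card_image_le[of "{..<k}" "center_at 3 s4"]
          by (auto simp: solutions_def Rn_def center_at_def lessThan_empty_iff)
        have "cost2 ((1 + eps) * r) P ?F \<le> (1 + eps) * cost2 r P F" if F: "F \<in> solutions d k" for F
        proof (cases "0 < n")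
          case False
          then have "P = {}" unfolding P_def by simp
          then show ?thesis by (simp add: cost2_def)
        next
          case True
          interpret hybrid_instance P d k r
            by unfold_locales (use True k1 r in \<open>auto simp: P_def Rn_def\<close>)
          have cardP: "card P = n"
            unfolding P_def by (subst card_image) (use inj in \<open>auto simp: pt_def padr_def\<close>)
          have "\<exists>g. (\<forall>i. g i < Wd) \<and> cost2 ((1 + eps) * r) P (grid_center (bp B) (r + M / real (card P)) Wd d g ` {..<k})
              \<le> (1 + eps) * cost2 r P F"
          proof (rule candidates_good[OF F d1 eps])
            show "bp B i \<in> P" if "i < Wd" for i
              using B2[rule_format, OF that] True by (auto simp: B_def bp_def P_def)
            show "sdist p (bp B ` {..<j}) \<le> sdist (bp B j) (bp B ` {..<j})" if "1 \<le> j" "j \<le> k" "p \<in> P" for j p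
              using far2 that kW unfolding farB_def B_def by auto
            show "M = sdist (bp B k) (bp B ` {..<k})" using M2 True by (simp add: M_def B_def)
            show "cost2 (2 * r) P (bp B ` {..i}) \<le> cost2 (2 * r) P (insert q (bp B ` {..<i}))"
              if "k < i" "i < Wd" "q \<in> P" for i q
              using gr2 that unfolding grB_def B_def by auto
            show "card P \<le> 2 ^ log2_up n" using log2_up_le by (simp add: cardP)
            show "400 * real k * real d * (real (log2_up n) + 3) / eps \<le> real Wd" by (rule WE)
          qed
          then obtain g where g: "\<And>i. g i < Wd"
            "cost2 ((1 + eps) * r) P (grid_center (bp B) S Wd d g ` {..<k}) \<le> (1 + eps) * cost2 r P F"
            unfolding cardP S_def by blast
          obtain t where t: "t < Wd ^ (k * (d + 2))" "\<forall>i<k * (d + 2). digit Wd t i = g i"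
            using digits_exist[of g Wd "k * (d + 2)"] g(1) by blast
          have "C t ` {..<k} = grid_center (bp B) S Wd d g ` {..<k}"
            by (intro image_cong refl grid_center_cong[where k = k]) (use t in auto)
          moreover have "cost2 ((1 + eps) * r) P ?F \<le> cost2 ((1 + eps) * r) P (C t ` {..<k})"
            using 1 True t(1) by blast
          ultimately show ?thesis using g(2) by simp
        qed
        with sol 1 show ?case by simp
      qed
    qed
  qed
qed

section \<open>The running time\<close>

lemma nth_concat_blocks:
  assumes "\<forall>p\<in>set ps. length p = d" "j < length ps" "l < d"
  shows "j * d + l < length (concat ps) \<and> concat ps ! (j * d + l) = ps ! j ! l"
  using assms
proof (induction ps arbitrary: j)
  case (Cons p ps)
  then show ?case by (cases j) (auto simp: nth_append add.assoc)
qed simp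

text \<open>This is the \<open>m\<close>-th power of \<open>y \<le> exp y\<close> for
  \<open>y = x / m\<close>.\<close>

lemma power_le_exp:
  fixes x :: real
  assumes "0 \<le> x" "1 \<le> m"
  shows "x ^ m \<le> real m ^ m * exp x"
proof -
  have "x / real m \<le> exp (x / real m)" using exp_ge_add_one_self[of "x / real m"] by linarith
  then have "(x / real m) ^ m \<le> exp (x / real m) ^ m" using assms by (intro power_mono) auto
  also have "\<dots> = exp x" using assms by (simp flip: exp_of_nat_mult)
  finally show ?thesis using assms by (simp add: power_divide field_simps)
qed

lemma le_two_powr: "(x::real) \<le> 2 powr x" if "1 \<le> x"
proof -
  define m where "m = nat \<lfloor>x\<rfloor>"
  have m: "real m \<le> x" "x < real m + 1" using that unfolding m_def by linarith+
  have "m + 1 \<le> 2 ^ m" by (induction m) auto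
  then have "real (m + 1) \<le> real (2 ^ m)" by (simp only: of_nat_le_iff)
  then have "real m + 1 \<le> 2 ^ m" by simp
  also have "\<dots> = 2 powr real m" by (simp add: powr_realpow)
  also have "\<dots> \<le> 2 powr x" using m by simp
  finally show ?thesis using m by linarith
qed

lemma two_powr_power: "(2 powr y) ^ m = (2::real) powr (real m * y)"
  by (subst powr_realpow[symmetric]) (simp_all add: powr_powr mult.commute)

text \<open>The larger of \<open>x\<close> and \<open>y\<close> dominates the product. The purpose
  is to remove a constant factor from an exponent: a constant times \<open>K^2\<close> is at most
  \<open>K^3\<close> plus a constant.\<close>

lemma mult_square_le_cubes:
  fixes x y :: real
  assumes "0 \<le> x" "0 \<le> y"
  shows "x * y\<^sup>2 \<le> y ^ 3 + x ^ 3"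
proof (cases "x \<le> y")
  case True
  then have "x * y\<^sup>2 \<le> y * y\<^sup>2" by (intro mult_right_mono) auto
  then show ?thesis using zero_le_power[OF assms(1), of 3]
    by (simp add: power3_eq_cube power2_eq_square mult.assoc)
next
  case False
  then have "x * y\<^sup>2 \<le> x * x\<^sup>2" using assms by (intro mult_left_mono power_mono) auto
  then show ?thesis using zero_le_power[OF assms(2), of 3]
    by (simp add: power3_eq_cube power2_eq_square mult.assoc)
qed

text \<open>The critical term is \<open>W ^ (k * (d + 2))\<close>, with \<open>W\<close> of order
  \<open>K * log n\<close>. \<open>power_le_exp\<close> is applied to the logarithmic factor alone,
  which separates a polynomial in \<open>n\<close> from a quantity depending only on
  \<open>K\<close>.\<close>

lemma iterations_bound:
  fixes \<epsilon> :: real and n k d :: nat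
  defines "K \<equiv> real k * real d / \<epsilon>"
  defines "W \<equiv> nat \<lceil>400 * real k * real d * (real (log2_up n) + 3) / \<epsilon>\<rceil>"
  assumes eps: "0 < \<epsilon>" "\<epsilon> < 1" and k: "1 \<le> k" and d: "1 \<le> d"
  shows "real (n + k * d + k + d + 2 + W + W ^ (k * (d + 2)) + log2_up n + 1)
    \<le> 2048 * real (max 1 n) ^ 3 * 2 powr (39 * K\<^sup>2)"
proof -
  let ?N = "real (max 1 n)"
  define m where "m = k * (d + 2)"
  define x where "x = real (log2_up n) + 3"
  \<comment> \<open>The step from 400 to 401 absorbs the rounding in \<open>W\<close>, because
    \<open>1 \<le> K * x\<close>.\<close>
  define A where "A = 401 * K * x"
  have kd: "real k * real d \<le> K" 
    unfolding K_def using eps divide_left_mono[of \<epsilon> 1 "real k * real d"] by simp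
  have kd1: "1 \<le> real k" "1 \<le> real d" using k d by auto
  have "1 * 1 \<le> real k * real d" using kd1 by (intro mult_mono) auto
  then have K1: "1 \<le> K" using kd by linarith
  have "real k * 1 \<le> real k * real d" "1 * real d \<le> real k * real d"
    using kd1 by (intro mult_left_mono mult_right_mono; simp)+
  then have kK: "real k \<le> K" and dK: "real d \<le> K" using kd by linarith+
  have m1: "1 \<le> m" using k by (simp add: m_def)
  have mK: "real m \<le> 3 * K"
  proof -
    have "real m = real k * real d + 2 * real k" by (simp add: m_def algebra_simps)
    then show ?thesis using kd kK by linarith
  qed
  have x3: "3 \<le> x" by (simp add: x_def)
  have Kx: "K \<le> K * x" "x \<le> K * x"
    using K1 x3 mult_left_mono[of 1 x K] mult_right_mono[of 1 K x] by auto
  have WA: "real W \<le> A"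
  proof -
    have "400 * real k * real d * (real (log2_up n) + 3) / \<epsilon> = 400 * (K * x)" by (simp add: K_def x_def)
    moreover have "0 \<le> 400 * (K * x)" "1 \<le> K * x" using Kx x3 K1 by linarith+
    ultimately show ?thesis unfolding W_def A_def by linarith
  qed
  have A: "K \<le> A" "3 \<le> A" "real (log2_up n) \<le> A" "1 \<le> A" "1 \<le> K * x"
    using Kx K1 x3 unfolding A_def x_def by linarith+
  have AA: "A \<le> A ^ m" using A(4) m1 self_le_power[of A m] by simp
  have Am: "A ^ m \<le> 2 powr (39 * K\<^sup>2) * (256 * ?N\<^sup>2)"
  proof -
    have "A ^ m = (401 * K) ^ m * x ^ m" by (simp add: A_def power_mult_distrib)
    also have "x ^ m \<le> real m ^ m * exp x" using x3 m1 by (intro power_le_exp) auto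
    also have "exp x \<le> 256 * ?N\<^sup>2"
    proof -
      have "exp x = exp 1 ^ (log2_up n + 3)" unfolding x_def exp_of_nat_mult[symmetric] by simp
      also have "\<dots> \<le> 4 ^ (log2_up n + 3)" using exp_le by (intro power_mono) auto
      also have "(4::real) ^ (log2_up n + 3) = 64 * (2 ^ log2_up n)\<^sup>2"
        by (simp add: power_add power_even_eq[symmetric] power_mult)
      also have "(2 ^ log2_up n :: real) \<le> 2 * ?N"
      proof -
        have "real (2 ^ log2_up n) \<le> real (2 * max 1 n)" using log2_up_bound by (simp only: of_nat_le_iff)
        then show ?thesis by simp
      qed
      then have "64 * (2 ^ log2_up n)\<^sup>2 \<le> 64 * (2 * ?N)\<^sup>2" by (intro mult_left_mono power_mono) auto
      also have "64 * (2 * ?N)\<^sup>2 = 256 * ?N\<^sup>2" by (simp only: power_mult_distrib) simp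
      finally show ?thesis by simp
    qed
    finally have "A ^ m \<le> (401 * K) ^ m * (real m ^ m * (256 * ?N\<^sup>2))"
      using K1 by (simp add: mult_left_mono)
    also have "\<dots> = (401 * K * real m) ^ m * (256 * ?N\<^sup>2)"
      by (simp add: power_mult_distrib)
    \<comment> \<open>With \<open>m \<le> 3 * K\<close>, \<open>401 * 3 \<le> 2 ^ 11\<close> and
      \<open>K \<le> 2 powr K\<close>, the exponent is at most
      \<open>3 * K * (11 + 2 * K) \<le> 39 * K^2\<close>.\<close>
    also have "(401 * K * real m) ^ m \<le> 2 powr (39 * K\<^sup>2)"
    proof -
      have "401 * K * real m \<le> 401 * K * (3 * K)" using mK K1 by (intro mult_left_mono) auto
      also have "\<dots> \<le> 2 powr 11 * (K * K)" using K1 by simp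
      also have "\<dots> \<le> 2 powr 11 * (2 powr K * 2 powr K)"
        using le_two_powr[OF K1] K1 by (intro mult_left_mono mult_mono) auto
      also have "\<dots> = 2 powr (11 + 2 * K)" by (simp only: powr_add mult_2)
      finally have "(401 * K * real m) ^ m \<le> (2 powr (11 + 2 * K)) ^ m"
        using K1 by (intro power_mono) auto
      also have "\<dots> = 2 powr (real m * (11 + 2 * K))"
        by (rule two_powr_power)
      also have "\<dots> \<le> 2 powr (39 * K\<^sup>2)"
      proof -
        have "real m * (11 + 2 * K) \<le> 3 * K * (11 + 2 * K)" using mK K1 by (intro mult_right_mono) auto
        also have "\<dots> \<le> 39 * K\<^sup>2" using K1 mult_left_mono[of 1 K K] by (simp add: power2_eq_square algebra_simps)
        finally show ?thesis by simp
      qed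
      finally show ?thesis .
    qed
    finally show ?thesis by (simp add: mult_right_mono)
  qed
  have "real (n + k * d + k + d + 2 + W + W ^ (k * (d + 2)) + log2_up n + 1)
      = real n + real k * real d + real k + real d + 3 + real W + real W ^ m + real (log2_up n)"
    by (simp add: m_def)
  also have "\<dots> \<le> ?N + 7 * A ^ m"
  proof -
    have "real W ^ m \<le> A ^ m" using WA by (intro power_mono) auto
    moreover have "real n \<le> ?N" by simp
    ultimately show ?thesis using kd kK dK A WA AA by linarith
  qed
  also have "\<dots> \<le> 8 * (?N * A ^ m)"
  proof -
    have "?N * 1 \<le> ?N * A ^ m" "1 * A ^ m \<le> ?N * A ^ m"
      using A(4) by (intro mult_left_mono mult_right_mono; simp)+
    then show ?thesis by linarith
  qed
  also have "\<dots> \<le> 8 * (?N * (2 powr (39 * K\<^sup>2) * (256 * ?N\<^sup>2)))"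
    using Am by (intro mult_left_mono) auto
  also have "\<dots> = 2048 * ?N ^ 3 * 2 powr (39 * K\<^sup>2)"
    by (simp add: power2_eq_square power3_eq_cube mult_ac)
  finally show ?thesis .
qed

theorem theorem15:
  "\<exists>(A :: com) (C :: real) (a :: nat) (b :: nat) (\<delta> :: real). \<delta> > 0 \<and>
     (\<forall>(\<epsilon> :: real) (d :: nat) (k :: nat) (r :: real) (P :: real list set) (ps :: real list list).
        0 < \<epsilon> \<and> \<epsilon> < 1 \<and> 1 \<le> d \<and> 1 \<le> k \<and> 0 \<le> r \<and>
        finite P \<and> P \<subseteq> Rn d \<and> distinct ps \<and> set ps = P \<longrightarrow>
        (\<exists>D. exec A (input_state \<epsilon> ps k r d) D \<and>
           (\<forall>(s, t) \<in> set_pmf D.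
              real t \<le> C * 2 powr ((real k * real d / \<epsilon>) ^ a) * real (max 1 (card P)) ^ b) \<and>
           measure_pmf.prob D
             {(s, t). output_set d s \<in> solutions d k \<and>
                cost2 ((1 + \<epsilon>) * r) P (output_set d s) \<le> (1 + \<epsilon>) * OPT2 d k r P} \<ge> \<delta>))"
proof -
  obtain c e where ce: "\<And>U. tbound U Alg \<le> c * (U + 1) ^ e" using tbound_polynomial[of Alg] by blast
  \<comment> \<open>The exponent 3 of \<open>K\<close> and the last factor of \<open>C\<close> come
    from \<open>39 * e * K^2 \<le> K^3 + (39 * e)^3\<close>. The power \<open>3 * e\<close> of
    \<open>n\<close> is the cube in the bound on \<open>U + 1\<close>, raised to the degree
    \<open>e\<close> of the time bound.\<close>
  define C where "C = real c * 2048 ^ e * 2 powr ((39 * real e) ^ 3)"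
  show ?thesis
  proof (rule exI[of _ Alg], rule exI[of _ C], rule exI[of _ 3], rule exI[of _ "3 * e"], rule exI[of _ 1],
      intro conjI allI impI)
    fix \<epsilon> :: real and d k :: nat and r :: real and P :: "real list set" and ps :: "real list list"
    assume "0 < \<epsilon> \<and> \<epsilon> < 1 \<and> 1 \<le> d \<and> 1 \<le> k \<and> 0 \<le> r \<and> finite P \<and> P \<subseteq> Rn d \<and> distinct ps \<and> set ps = P"
    then have eps: "0 < \<epsilon>" "\<epsilon> < 1" and d: "1 \<le> d" and k: "1 \<le> k" and r: "0 \<le> r"
      and P: "finite P" "P \<subseteq> Rn d" "distinct ps" "set ps = P" by auto
    define n where "n = length ps"
    have cardP: "card P = n" using P distinct_card[of ps] by (auto simp: n_def)
    have len: "\<forall>p\<in>set ps. length p = d" using P by (auto simp: Rn_def)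
    define R0 where "R0 = snd (input_state \<epsilon> ps k r d)"
    have R0: "R0 0 = \<epsilon>" "R0 1 = r" by (simp_all add: R0_def input_state_def)
    have Rp: "map (\<lambda>l. R0 (2 + j * d + l)) [0..<d] = ps ! j" if "j < n" for j
    proof (rule nth_equalityI)
      have "length (ps ! j) = d" using len that by (simp add: n_def)
      then show "length (map (\<lambda>l. R0 (2 + j * d + l)) [0..<d]) = length (ps ! j)" by simp
      fix l assume "l < length (map (\<lambda>l. R0 (2 + j * d + l)) [0..<d])"
      then have l: "l < d" by simp
      from nth_concat_blocks[OF len _ l, of j] that
      have *: "j * d + l < length (concat ps)" "concat ps ! (j * d + l) = ps ! j ! l" by (auto simp: n_def)
      have "R0 (2 + j * d + l) = (if 2 + (j * d + l) < length (\<epsilon> # r # concat ps)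
          then (\<epsilon> # r # concat ps) ! (2 + (j * d + l)) else 0)"
        unfolding R0_def input_state_def by (simp only: snd_conv Let_def add.assoc)
      then have "R0 (2 + j * d + l) = ps ! j ! l" using * by simp
      then show "map (\<lambda>l. R0 (2 + j * d + l)) [0..<d] ! l = ps ! j ! l" using l by simp
    qed
    define W where "W = nat \<lceil>400 * real k * real d * (real (log2_up n) + 3) / \<epsilon>\<rceil>"
    define U where "U = n + k * d + k + d + 2 + W + W ^ (k * (d + 2)) + log2_up n"
    interpret machine U n k d R0
    proof
      show "inj_on (\<lambda>j. map (\<lambda>l. R0 (2 + j * d + l)) [0..<d]) {..<n}"
      proof (rule inj_onI)
        fix i j assume ij: "i \<in> {..<n}" "j \<in> {..<n}"
          and "map (\<lambda>l. R0 (2 + i * d + l)) [0..<d] = map (\<lambda>l. R0 (2 + j * d + l)) [0..<d]"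
        then have "ps ! i = ps ! j" using Rp[of i] Rp[of j] by (simp only: lessThan_iff)
        then show "i = j" using ij P(3) by (simp add: n_def nth_eq_iff_index_eq)
      qed
    qed (use d k in \<open>auto simp: U_def\<close>)
    have WdW: "Wd = W" by (simp add: Wd_def W_def R0)
    have PP: "machine.P n d R0 = P"
    proof -
      have "machine.P n d R0 = (\<lambda>j. ps ! j) ` {..<n}"
        unfolding P_def pt_def padr_def by (intro image_cong refl Rp) simp
      then show ?thesis using P(4) by (auto simp: n_def set_conv_nth)
    qed
    have "wp U Alg (\<lambda>s'. output_set d s' \<in> solutions d k \<and>
       (\<forall>F\<in>solutions d k. cost2 ((1 + \<epsilon>) * r) P (output_set d s') \<le> (1 + \<epsilon>) * cost2 r P F))
       (input_state \<epsilon> ps k r d)"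
    proof -
      have "fst (input_state \<epsilon> ps k r d) = (\<lambda>_. 0)(0 := n, 1 := k, 2 := d)"
        by (simp add: input_state_def n_def)
      moreover have "log2_up n \<le> U" "Wd \<le> U" "Wd ^ (k * (d + 2)) \<le> U" "k * d \<le> U"
        unfolding WdW by (simp_all add: U_def)
      moreover have "0 < R0 0" "R0 0 < 1" "0 \<le> R0 1" using eps r by (simp_all only: R0)
      ultimately show ?thesis using wp_Alg[OF R0_def[symmetric]] unfolding PP R0 by blast
    qed
    then obtain s t where st: "exec Alg (input_state \<epsilon> ps k r d) (return_pmf (s, t))" "t \<le> tbound U Alg"
      "output_set d s \<in> solutions d k"
      "\<And>F. F \<in> solutions d k \<Longrightarrow> cost2 ((1 + \<epsilon>) * r) P (output_set d s) \<le> (1 + \<epsilon>) * cost2 r P F"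
      unfolding wp_def by blast
    \<comment> \<open>\<open>OPT2\<close> is an infimum: dividing by \<open>1 + \<epsilon>\<close>
      turns the comparison with each single solution into a lower bound for all of them.\<close>
    have opt: "cost2 ((1 + \<epsilon>) * r) P (output_set d s) \<le> (1 + \<epsilon>) * OPT2 d k r P"
    proof -
      have "cost2 ((1 + \<epsilon>) * r) P (output_set d s) / (1 + \<epsilon>) \<le> OPT2 d k r P"
        unfolding OPT2_def using st(3,4) eps by (intro cINF_greatest) (auto simp: field_simps)
      then show ?thesis using eps by (simp add: field_simps)
    qed
    have time: "real t \<le> C * 2 powr ((real k * real d / \<epsilon>) ^ 3) * real (max 1 (card P)) ^ (3 * e)"
    proof -
      let ?K = "real k * real d / \<epsilon>" and ?N = "real (max 1 n)"
      have UB: "real (U + 1) \<le> 2048 * ?N ^ 3 * 2 powr (39 * ?K\<^sup>2)"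
        using iterations_bound[OF eps k d, of n] unfolding U_def W_def .
      have "real t \<le> real (c * (U + 1) ^ e)" using st(2) ce[of U] by (simp only: of_nat_le_iff)
      also have "\<dots> = real c * real (U + 1) ^ e" by simp
      also have "real (U + 1) ^ e \<le> (2048 * ?N ^ 3 * 2 powr (39 * ?K\<^sup>2)) ^ e"
        by (rule power_mono[OF UB]) simp
      also have "\<dots> = 2048 ^ e * ?N ^ (3 * e) * 2 powr (39 * real e * ?K\<^sup>2)"
        by (simp only: power_mult_distrib two_powr_power power_mult mult.assoc mult.left_commute[of "real e"])
      also have "2 powr (39 * real e * ?K\<^sup>2) \<le> 2 powr (?K ^ 3 + (39 * real e) ^ 3)"
      proof -
        have "39 * real e * ?K\<^sup>2 \<le> ?K ^ 3 + (39 * real e) ^ 3"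
          using eps by (intro mult_square_le_cubes) auto
        then show ?thesis by simp
      qed
      finally have "real t \<le> real c * (2048 ^ e * ?N ^ (3 * e) * 2 powr (?K ^ 3 + (39 * real e) ^ 3))"
        by (simp add: mult_left_mono)
      then show ?thesis unfolding C_def cardP by (simp add: powr_add mult_ac)
    qed
    show "\<exists>D. exec Alg (input_state \<epsilon> ps k r d) D \<and>
           (\<forall>(s, t) \<in> set_pmf D.
              real t \<le> C * 2 powr ((real k * real d / \<epsilon>) ^ 3) * real (max 1 (card P)) ^ (3 * e)) \<and>
           measure_pmf.prob D
             {(s, t). output_set d s \<in> solutions d k \<and>
                cost2 ((1 + \<epsilon>) * r) P (output_set d s) \<le> (1 + \<epsilon>) * OPT2 d k r P} \<ge> 1"
      by (rule exI[of _ "return_pmf (s, t)"]) (use st opt time in \<open>auto simp: measure_return_pmf indicator_def\<close>)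
  qed simp
qed

end
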